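(* Let $u:(M^m,g)\to(N,h)$ be a $\Phi_{(3)}$-harmonic map between Riemannian manifolds and let $u_{s,t}:M^m\to N$, $-\varepsilon<s,t<\varepsilon$, be a smooth compactly supported two-parameter variation with $u_{0,0}=u$ and variation vector fields $V=\frac{\partial u_{s,t}}{\partial t}\big|_{s=t=0}$, $W=\frac{\partial u_{s,t}}{\partial s}\big|_{s=t=0}$. Then $I(V,W):=\frac{\partial^2}{\partial s\partial t}E_{\Phi_{(3)}}(u_{s,t})\big|_{s=t=0}$ is given by $$\begin{aligned}I(V,W)=&\int_M\sum_{i=1}^m h\big(R^N(V,du(e_i))W,d_{(3)}u(e_i)\big)\,dv_g\\ &+\int_M\sum_{i,j,k=1}^m h(\widetilde\nabla_{e_i}V,\widetilde\nabla_{e_k}W)\,h(du(e_k),du(e_j))\,h(du(e_i),du(e_j))\,dv_g\\ &+\int_M\sum_{i,j,k=1}^m h(\widetilde\nabla_{e_i}V,du(e_k))\,h(\widetilde\nabla_{e_k}W,du(e_j))\,h(du(e_i),du(e_j))\,dv_g\\ &+\int_M\sum_{i,j,k=1}^m h(\widetilde\nabla_{e_i}V,du(e_k))\,h(du(e_k),\widetilde\nabla_{e_j}W)\,h(du(e_i),du(e_j))\,dv_g\\ &+\int_M\sum_{i,j,k=1}^m h(\widetilde\nabla_{e_i}V,du(e_k))\,h(du(e_k),du(e_j))\,h(\widetilde\nabla_{e_i}W,du(e_j))\,dv_g\\ &+\int_M\sum_{i,j,k=1}^m h(\widetilde\nabla_{e_i}V,du(e_k))\,h(du(e_k),du(e_j))\,h(du(e_i),\widetilde\nabla_{e_j}W)\,dv_g,\end{aligned}$$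 where $R^N$ is the curvature tensor of $N$.
   Context: $\{e_i\}_{i=1}^m$ is a local orthonormal frame on $M$ and $\widetilde\nabla$ is the induced connection on $u^{-1}TN$. The curvature convention is $R^N(X,Y)Z=\nabla_X\nabla_YZ-\nabla_Y\nabla_XZ-\nabla_{[X,Y]}Z$. Define $d_{(3)}u(X)=\sum_{j,k}h(du(X),du(e_j))h(du(e_j),du(e_k))du(e_k)$, $\|d_{(3)}u\|^2=\sum_i h(d_{(3)}u(e_i),du(e_i))$, and $E_{\Phi_{(3)}}(u)=\int_M\frac{\|d_{(3)}u\|^2}{6}dv_g$. A smooth map is $\Phi_{(3)}$-harmonic if it is a critical point of $E_{\Phi_{(3)}}$ with respect to every smooth compactly supported variation; equivalently $\operatorname{div}(d_{(3)}u)=0$. Compactly supported means $u_{s,t}=u$ outside a fixed compact subset of $M$; if $M$ is noncompact, derivatives of the energy are understood as derivatives of the energy integrated over that compact set. Manifolds are without boundary. *)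

theory Defs
  imports "HOL-Analysis.Analysis"
begin

section \<open>Smooth maps between normed spaces\<close>

text \<open>Only used on open sets, where it is the usual notion of class C-infinity:
  all iterated directional derivatives exist and are differentiable.\<close>

primrec Ck_on :: "nat \<Rightarrow> 'a::real_normed_vector set \<Rightarrow> ('a \<Rightarrow> 'b::real_normed_vector) \<Rightarrow> bool" where
  "Ck_on 0 S f \<longleftrightarrow> continuous_on S f"
| "Ck_on (Suc k) S f \<longleftrightarrow> (\<forall>x\<in>S. f differentiable (at x)) \<and>
     (\<forall>v. Ck_on k S (\<lambda>x. frechet_derivative f (at x) v))"

definition smooth_on :: "'a::real_normed_vector set \<Rightarrow> ('a \<Rightarrow> 'b::real_normed_vector) \<Rightarrow> bool" where
  "smooth_on S f \<longleftrightarrow> (\<forall>k. Ck_on k S f)"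


section \<open>Smooth manifolds and tangent vectors\<close>

text \<open>A manifold without boundary is a (Hausdorff, second countable) type together with a smooth
  atlas; a chart is a pair of its domain and its coordinate map.\<close>

type_synonym ('a, 'm) chart = "'a set \<times> ('a \<Rightarrow> real ^ 'm)"

definition chart_inv :: "('a, 'm) chart \<Rightarrow> real ^ 'm \<Rightarrow> 'a" where
  "chart_inv c = inv_into (fst c) (snd c)"

definition is_chart :: "('a::topological_space, 'm::finite) chart \<Rightarrow> bool" where
  "is_chart c \<longleftrightarrow> open (fst c) \<and> open (snd c ` fst c) \<and>
     homeomorphism (fst c) (snd c ` fst c) (snd c) (chart_inv c)"

definition smooth_atlas ::
    "('a::{t2_space, second_countable_topology}, 'm::finite) chart set \<Rightarrow> bool" where
  "smooth_atlas A \<longleftrightarrow> (\<forall>c\<in>A. is_chart c) \<and> (\<Union>c\<in>A. fst c) = UNIV \<and>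
     (\<forall>c\<in>A. \<forall>d\<in>A. smooth_on (snd c ` (fst c \<inter> fst d)) (snd d \<circ> chart_inv c))"

text \<open>Every point has a preferred chart. The tangent space at \<open>p\<close> is the model space
  \<open>real ^ 'm\<close>, a vector being identified with its components in the preferred chart at \<open>p\<close>.
  Tangent vectors at different points can therefore only be compared after passing to a common
  chart, by means of \<open>change_chart\<close>.\<close>

definition chart_at :: "('a, 'm) chart set \<Rightarrow> 'a \<Rightarrow> ('a, 'm) chart" where
  "chart_at A p = (SOME c. c \<in> A \<and> p \<in> fst c)"

text \<open>Turns the components with respect to \<open>c\<close> of a tangent vector at \<open>p\<close> into those with respect
  to \<open>d\<close>.\<close>

definition change_chart ::
    "('a, 'm::finite) chart \<Rightarrow> ('a, 'm) chart \<Rightarrow> 'a \<Rightarrow> real ^ 'm \<Rightarrow> real ^ 'm" where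
  "change_chart c d p = frechet_derivative (snd d \<circ> chart_inv c) (at (snd c p))"

definition smooth_map ::
    "('a::topological_space, 'm::finite) chart set \<Rightarrow> ('b::topological_space, 'n::finite) chart set
     \<Rightarrow> ('a \<Rightarrow> 'b) \<Rightarrow> bool" where
  "smooth_map A B u \<longleftrightarrow> continuous_on UNIV u \<and>
     (\<forall>c\<in>A. \<forall>d\<in>B. smooth_on (snd c ` (fst c \<inter> u -` fst d)) (snd d \<circ> u \<circ> chart_inv c))"

definition differential ::
    "('a, 'm::finite) chart set \<Rightarrow> ('b, 'n::finite) chart set \<Rightarrow> ('a \<Rightarrow> 'b)
     \<Rightarrow> 'a \<Rightarrow> real ^ 'm \<Rightarrow> real ^ 'n" where
  "differential A B u p =
     frechet_derivative (snd (chart_at B (u p)) \<circ> u \<circ> chart_inv (chart_at A p))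
       (at (snd (chart_at A p) p))"

definition velocity ::
    "('b, 'n::finite) chart set \<Rightarrow> (real \<Rightarrow> 'b) \<Rightarrow> real \<Rightarrow> real ^ 'n" where
  "velocity B \<gamma> t = vector_derivative (\<lambda>r. snd (chart_at B (\<gamma> t)) (\<gamma> r)) (at t)"


section \<open>Riemannian metrics\<close>

definition metric_in_chart ::
    "('a, 'm::finite) chart set \<Rightarrow> ('a \<Rightarrow> real ^ 'm \<Rightarrow> real ^ 'm \<Rightarrow> real) \<Rightarrow> ('a, 'm) chart
     \<Rightarrow> real ^ 'm \<Rightarrow> real ^ 'm \<Rightarrow> real ^ 'm \<Rightarrow> real" where
  "metric_in_chart A g c x v w =
     (let p = chart_inv c x; \<tau> = change_chart c (chart_at A p) p in g p (\<tau> v) (\<tau> w))"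

definition riemannian_manifold ::
    "('a::{t2_space, second_countable_topology}, 'm::finite) chart set
     \<Rightarrow> ('a \<Rightarrow> real ^ 'm \<Rightarrow> real ^ 'm \<Rightarrow> real) \<Rightarrow> bool" where
  "riemannian_manifold A g \<longleftrightarrow> smooth_atlas A \<and>
     (\<forall>p. bilinear (g p) \<and> (\<forall>v w. g p v w = g p w v) \<and> (\<forall>v. v \<noteq> 0 \<longrightarrow> g p v v > 0)) \<and>
     (\<forall>c\<in>A. \<forall>v w. smooth_on (snd c ` fst c) (\<lambda>x. metric_in_chart A g c x v w))"

text \<open>An orthonormal family indexed by \<open>'m\<close> is automatically a basis of the tangent space.\<close>

definition orthonormal_frame ::
    "(real ^ 'm \<Rightarrow> real ^ 'm \<Rightarrow> real) \<Rightarrow> ('m::finite \<Rightarrow> real ^ 'm) \<Rightarrow> bool" where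
  "orthonormal_frame b f \<longleftrightarrow> (\<forall>i j. b (f i) (f j) = (if i = j then 1 else 0))"

text \<open>The Riemannian measure: the Borel measure with density \<open>sqrt (det g\<^sub>i\<^sub>j)\<close> with respect to
  Lebesgue measure in every chart. No orientation is needed.\<close>

definition riemannian_volume ::
    "('a::topological_space, 'm::finite) chart set
     \<Rightarrow> ('a \<Rightarrow> real ^ 'm \<Rightarrow> real ^ 'm \<Rightarrow> real) \<Rightarrow> 'a measure" where
  "riemannian_volume A g = (THE \<mu>. sets \<mu> = sets borel \<and>
     (\<forall>c\<in>A. \<forall>S\<in>sets borel. S \<subseteq> fst c \<longrightarrow>
        emeasure \<mu> S =
          (\<integral>\<^sup>+x. ennreal (sqrt (det ((\<chi> i j. metric_in_chart A g c x (axis i 1) (axis j 1)) :: real^'m^'m)))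
                 * indicator (snd c ` S) x \<partial>lborel)))"


section \<open>Levi-Civita connection, curvature, induced connection\<close>

text \<open>In a chart \<open>d\<close> the Levi-Civita connection is \<open>\<nabla>\<^sub>X Y = DY(X) + \<Gamma>(X, Y)\<close>, where \<open>\<Gamma>\<close> is determined
  by vanishing torsion and compatibility with the metric.\<close>

definition levi_civita ::
    "('b, 'n::finite) chart set \<Rightarrow> ('b \<Rightarrow> real ^ 'n \<Rightarrow> real ^ 'n \<Rightarrow> real) \<Rightarrow> ('b, 'n) chart
     \<Rightarrow> real ^ 'n \<Rightarrow> real ^ 'n \<Rightarrow> real ^ 'n \<Rightarrow> real ^ 'n" where
  "levi_civita B h d y = (THE \<Gamma>. (\<forall>v w. \<Gamma> v w = \<Gamma> w v) \<and>
     (\<forall>v w z. frechet_derivative (\<lambda>y. metric_in_chart B h d y w z) (at y) v =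
        metric_in_chart B h d y (\<Gamma> v w) z + metric_in_chart B h d y w (\<Gamma> v z)))"

definition nabla_in_chart ::
    "('b, 'n::finite) chart set \<Rightarrow> ('b \<Rightarrow> real ^ 'n \<Rightarrow> real ^ 'n \<Rightarrow> real) \<Rightarrow> ('b, 'n) chart
     \<Rightarrow> (real ^ 'n \<Rightarrow> real ^ 'n) \<Rightarrow> (real ^ 'n \<Rightarrow> real ^ 'n) \<Rightarrow> real ^ 'n \<Rightarrow> real ^ 'n" where
  "nabla_in_chart B h d X Y y =
     frechet_derivative Y (at y) (X y) + levi_civita B h d y (X y) (Y y)"

definition lie_bracket ::
    "(real ^ 'n::finite \<Rightarrow> real ^ 'n) \<Rightarrow> (real ^ 'n \<Rightarrow> real ^ 'n) \<Rightarrow> real ^ 'n \<Rightarrow> real ^ 'n" where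
  "lie_bracket X Y y = frechet_derivative Y (at y) (X y) - frechet_derivative X (at y) (Y y)"

definition curvature_in_chart ::
    "('b, 'n::finite) chart set \<Rightarrow> ('b \<Rightarrow> real ^ 'n \<Rightarrow> real ^ 'n \<Rightarrow> real) \<Rightarrow> ('b, 'n) chart
     \<Rightarrow> (real ^ 'n \<Rightarrow> real ^ 'n) \<Rightarrow> (real ^ 'n \<Rightarrow> real ^ 'n) \<Rightarrow> (real ^ 'n \<Rightarrow> real ^ 'n)
     \<Rightarrow> real ^ 'n \<Rightarrow> real ^ 'n" where
  "curvature_in_chart B h d X Y Z y =
     (let N = nabla_in_chart B h d
      in N X (N Y Z) y - N Y (N X Z) y - N (lie_bracket X Y) Z y)"

text \<open>The curvature is tensorial, so its value on tangent vectors at \<open>q\<close> may be computed from any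
  extensions to vector fields; here they are constant in the preferred chart at \<open>q\<close>.\<close>

definition curvature ::
    "('b, 'n::finite) chart set \<Rightarrow> ('b \<Rightarrow> real ^ 'n \<Rightarrow> real ^ 'n \<Rightarrow> real)
     \<Rightarrow> 'b \<Rightarrow> real ^ 'n \<Rightarrow> real ^ 'n \<Rightarrow> real ^ 'n \<Rightarrow> real ^ 'n" where
  "curvature B h q X Y Z =
     (let d = chart_at B q
      in curvature_in_chart B h d (\<lambda>_. X) (\<lambda>_. Y) (\<lambda>_. Z) (snd d q))"

text \<open>The connection on \<open>u\<inverse>TN\<close> induced by the Levi-Civita connection of \<open>N\<close>: with \<open>d\<close> the preferred
  chart at \<open>u p\<close>, the derivative of \<open>V\<close> at \<open>p\<close> in the direction \<open>X\<close> is
  \<open>D(V\<^sub>d)(X) + \<Gamma>(du(X), V)\<close>, \<open>V\<^sub>d\<close> being the components in \<open>d\<close> of the section \<open>V\<close> along \<open>u\<close>.\<close>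

definition induced_nabla ::
    "('a, 'm::finite) chart set \<Rightarrow> ('b, 'n::finite) chart set
     \<Rightarrow> ('b \<Rightarrow> real ^ 'n \<Rightarrow> real ^ 'n \<Rightarrow> real) \<Rightarrow> ('a \<Rightarrow> 'b)
     \<Rightarrow> 'a \<Rightarrow> real ^ 'm \<Rightarrow> ('a \<Rightarrow> real ^ 'n) \<Rightarrow> real ^ 'n" where
  "induced_nabla A B h u p X V =
     (let c = chart_at A p; d = chart_at B (u p);
          V\<^sub>d = (\<lambda>p'. change_chart (chart_at B (u p')) d (u p') (V p'))
      in frechet_derivative (V\<^sub>d \<circ> chart_inv c) (at (snd c p)) X
         + levi_civita B h d (snd d (u p)) (differential A B u p X) (V p))"


section \<open>The energy and its critical points\<close>

text \<open>In the next two definitions \<open>f\<close> is an orthonormal frame at \<open>p\<close>; the result does not depend on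
  which one.\<close>

definition d3 ::
    "('a, 'm::finite) chart set \<Rightarrow> ('b, 'n::finite) chart set
     \<Rightarrow> ('b \<Rightarrow> real ^ 'n \<Rightarrow> real ^ 'n \<Rightarrow> real) \<Rightarrow> ('m \<Rightarrow> real ^ 'm) \<Rightarrow> ('a \<Rightarrow> 'b)
     \<Rightarrow> 'a \<Rightarrow> real ^ 'm \<Rightarrow> real ^ 'n" where
  "d3 A B h f u p X =
     (let du = differential A B u p in
      \<Sum>j\<in>UNIV. \<Sum>k\<in>UNIV.
        (h (u p) (du X) (du (f j)) * h (u p) (du (f j)) (du (f k))) *\<^sub>R du (f k))"

definition d3_norm_sq ::
    "('a, 'm::finite) chart set \<Rightarrow> ('b, 'n::finite) chart set
     \<Rightarrow> ('b \<Rightarrow> real ^ 'n \<Rightarrow> real ^ 'n \<Rightarrow> real) \<Rightarrow> ('m \<Rightarrow> real ^ 'm) \<Rightarrow> ('a \<Rightarrow> 'b) \<Rightarrow> 'a \<Rightarrow> real" where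
  "d3_norm_sq A B h f u p =
     (\<Sum>i\<in>UNIV. h (u p) (d3 A B h f u p (f i)) (differential A B u p (f i)))"

text \<open>The energy over a subset \<open>K\<close> of \<open>M\<close>; the energy itself is the case \<open>K = UNIV\<close>.\<close>

definition Phi3_energy ::
    "('a::topological_space, 'm::finite) chart set \<Rightarrow> ('a \<Rightarrow> real ^ 'm \<Rightarrow> real ^ 'm \<Rightarrow> real)
     \<Rightarrow> ('b, 'n::finite) chart set \<Rightarrow> ('b \<Rightarrow> real ^ 'n \<Rightarrow> real ^ 'n \<Rightarrow> real)
     \<Rightarrow> 'a set \<Rightarrow> ('a \<Rightarrow> 'b) \<Rightarrow> real" where
  "Phi3_energy A g B h K u =
     (LINT p:K|riemannian_volume A g.
        d3_norm_sq A B h (SOME f. orthonormal_frame (g p) f) u p / 6)"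

text \<open>A smooth variation of \<open>u\<close> with parameters in the open neighbourhood \<open>P\<close> of \<open>0\<close>, jointly smooth
  in the parameter and the point, which is fixed outside \<open>K\<close>.\<close>

definition smooth_variation ::
    "('a::topological_space, 'm::finite) chart set \<Rightarrow> ('b::topological_space, 'n::finite) chart set
     \<Rightarrow> 'a set \<Rightarrow> ('a \<Rightarrow> 'b) \<Rightarrow> 'p::real_normed_vector set \<Rightarrow> ('p \<Rightarrow> 'a \<Rightarrow> 'b) \<Rightarrow> bool" where
  "smooth_variation A B K u P U \<longleftrightarrow>
     continuous_on (P \<times> UNIV) (\<lambda>(r, p). U r p) \<and>
     (\<forall>c\<in>A. \<forall>d\<in>B.
        smooth_on {(r, x). r \<in> P \<and> x \<in> snd c ` fst c \<and> U r (chart_inv c x) \<in> fst d}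
                  (\<lambda>(r, x). snd d (U r (chart_inv c x)))) \<and>
     U 0 = u \<and>
     (\<forall>r\<in>P. \<forall>p. p \<notin> K \<longrightarrow> U r p = u p)"

definition Phi3_harmonic ::
    "('a::topological_space, 'm::finite) chart set \<Rightarrow> ('a \<Rightarrow> real ^ 'm \<Rightarrow> real ^ 'm \<Rightarrow> real)
     \<Rightarrow> ('b::topological_space, 'n::finite) chart set \<Rightarrow> ('b \<Rightarrow> real ^ 'n \<Rightarrow> real ^ 'n \<Rightarrow> real)
     \<Rightarrow> ('a \<Rightarrow> 'b) \<Rightarrow> bool" where
  "Phi3_harmonic A g B h u \<longleftrightarrow> smooth_map A B u \<and>
     (\<forall>K \<epsilon> U. compact K \<longrightarrow> \<epsilon> > 0 \<longrightarrow> smooth_variation A B K u {-\<epsilon><..<\<epsilon>} U \<longrightarrow>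
        ((\<lambda>t::real. Phi3_energy A g B h K (U t)) has_real_derivative 0) (at 0))"

end

theory Submission
  imports Defs
begin

text \<open>
The energy density is \<open>F = tr (P\<^sup>3) / 6\<close>, where \<open>P\<^sub>i\<^sub>j = h(du(e\<^sub>i), du(e\<^sub>j))\<close>. For a family of maps
depending on parameters, the connection of \<open>N\<close> is compatible with \<open>h\<close> and torsion free, so that a
parameter derivative of \<open>P\<^sub>i\<^sub>j\<close> is \<open>h(\<nabla>\<^sub>i V, du(e\<^sub>j)) + h(du(e\<^sub>i), \<nabla>\<^sub>j V)\<close> with the variation field
\<open>V\<close>; as \<open>P\<close> is symmetric and the trace is cyclic, the derivative of \<open>F\<close> is
\<open>\<Sum>\<^sub>i h(\<nabla>\<^sub>i V, d\<^sub>3u(e\<^sub>i))\<close>, which is called \<open>pairing\<close> below (\<open>first_variation_density\<close>). Differentiating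
once more, the product rule gives the five terms that are quadratic in \<open>\<nabla>V\<close>, \<open>\<nabla>W\<close>, and a term with
\<open>\<nabla>\<^sub>V \<nabla>\<^sub>i W = \<nabla>\<^sub>i \<nabla>\<^sub>V W + R(V, du(e\<^sub>i)) W\<close> (\<open>second_variation_density\<close>). Here \<open>F\<close> is differentiated
first in the direction of \<open>W\<close> and then in that of \<open>V\<close>; the two derivatives commute, and this order
produces the curvature term \<open>R(V, du(e\<^sub>i)) W\<close> of the theorem rather than \<open>R(W, du(e\<^sub>i)) V\<close>.

What remains besides the stated terms is the integral of the pairing of \<open>du\<close> with the section
\<open>\<xi> = \<nabla>\<^sub>V W\<close> along \<open>u\<close>. It vanishes by the first variation formula if \<open>\<xi>\<close> is the variation field of an
admissible variation. Cut-off functions reduce this to sections supported in the preimage of a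
single chart of \<open>N\<close>, and such a section is the variation field of a straight-line variation in that
chart (\<open>harmonic_weak_equation\<close>).

All local computations are done for maps \<open>y\<close> from an open subset of a Euclidean space into an open
subset of \<open>\<real>\<^sup>n\<close> with a metric: parameters of the variation and coordinates of \<open>M\<close> are treated alike,
and the covariant derivative along \<open>y\<close> in every direction is given by the same formula. The passage to
manifolds rests on the transformation law of the Christoffel symbols (\<open>christoffel_transition\<close>).
Orthonormal frames need not be chosen smoothly, because a frame enters only through the inverse of
the metric (\<open>smooth_on_frame_sum\<close>).

Two analytic facts are needed for the integrals. The Riemannian measure is only characterised by its
values in charts; it exists and is unique because the transformation formula makes the densities of
different charts agree and countably many charts cover the manifold (\<open>riemannian_volume\<close>). The energy may
be differentiated under the integral, since the densities are smooth in the parameters and the point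
together and the integral extends over a compact set of finite measure (\<open>leibniz_compact\<close>).
\<close>

section \<open>Smooth maps\<close>

text \<open>The direction comes first, so that \<open>dirderiv v f\<close> is again a map on the same domain and
  \<open>Ck_on (Suc k)\<close> refers to \<open>Ck_on k\<close> of all these maps.\<close>

definition dirderiv :: "'a::real_normed_vector \<Rightarrow> ('a \<Rightarrow> 'b::real_normed_vector) \<Rightarrow> 'a \<Rightarrow> 'b" where
  "dirderiv v f x = frechet_derivative f (at x) v"

lemma has_derivative_imp_dirderiv:
  "(f has_derivative f') (at x) \<Longrightarrow> dirderiv v f x = f' v"
  using frechet_derivative_at[of f f' x] by (simp add: dirderiv_def)

lemma frechet_derivative_cong_open:
  assumes "open S" "x \<in> S" "\<And>y. y \<in> S \<Longrightarrow> f y = g y"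
  shows "frechet_derivative f (at x) = frechet_derivative g (at x)"
proof -
  have "(f has_derivative f') (at x) \<longleftrightarrow> (g has_derivative f') (at x)" for f'
    using assms has_derivative_transform_within_open[of f f' x UNIV S g]
      has_derivative_transform_within_open[of g f' x UNIV S f] by auto
  then show ?thesis by (simp add: frechet_derivative_def)
qed

lemma dirderiv_cong_open:
  assumes "open S" "x \<in> S" "\<And>y. y \<in> S \<Longrightarrow> f y = g y"
  shows "dirderiv v f x = dirderiv v g x"
  by (simp add: dirderiv_def frechet_derivative_cong_open[OF assms])

lemma Ck_on_Suc_dirderiv:
  "Ck_on (Suc k) S f \<longleftrightarrow> (\<forall>x\<in>S. f differentiable (at x)) \<and> (\<forall>v. Ck_on k S (dirderiv v f))"
  by (simp add: dirderiv_def[abs_def])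

declare Ck_on.simps(2) [simp del]

lemma Ck_on_subset: "Ck_on k S f \<Longrightarrow> T \<subseteq> S \<Longrightarrow> Ck_on k T f"
  by (induction k arbitrary: f) (auto simp: Ck_on_Suc_dirderiv intro: continuous_on_subset)

lemma Ck_on_cong:
  assumes "open S" "\<And>x. x \<in> S \<Longrightarrow> f x = g x" "Ck_on k S f"
  shows "Ck_on k S g"
  using assms(2,3)
proof (induction k arbitrary: f g)
  case 0
  then show ?case using continuous_on_cong by fastforce
next
  case (Suc k)
  have "g differentiable at x" if "x \<in> S" for x
    using Suc.prems that has_derivative_transform_within_open[OF _ assms(1) that, of f _ UNIV g]
    unfolding Ck_on_Suc_dirderiv differentiable_def by metis
  moreover have "Ck_on k S (dirderiv v g)" for v
    by (rule Suc.IH[of "dirderiv v f"])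
      (use Suc.prems dirderiv_cong_open[OF assms(1), of _ f g] in \<open>auto simp: Ck_on_Suc_dirderiv\<close>)
  ultimately show ?case by (auto simp: Ck_on_Suc_dirderiv)
qed

lemma Ck_on_local:
  assumes "\<And>x. x \<in> S \<Longrightarrow> \<exists>T. open T \<and> x \<in> T \<and> Ck_on k T f"
  shows "Ck_on k S f"
  using assms
proof (induction k arbitrary: f)
  case 0
  have "isCont f x" if "x \<in> S" for x
    using 0[OF that] by (auto simp: continuous_on_eq_continuous_at)
  then show ?case by (simp add: continuous_at_imp_continuous_on)
next
  case (Suc k)
  show ?case
    unfolding Ck_on_Suc_dirderiv
  proof (intro conjI ballI allI)
    show "f differentiable at x" if "x \<in> S" for x
      using Suc.prems[OF that] by (auto simp: Ck_on_Suc_dirderiv)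
    show "Ck_on k S (dirderiv v f)" for v
    proof (rule Suc.IH)
      fix x assume "x \<in> S"
      with Suc.prems obtain T where "open T" "x \<in> T" "Ck_on (Suc k) T f" by blast
      then show "\<exists>T. open T \<and> x \<in> T \<and> Ck_on k T (dirderiv v f)"
        by (auto simp: Ck_on_Suc_dirderiv)
    qed
  qed
qed

lemma Ck_on_SucD: "Ck_on (Suc k) S f \<Longrightarrow> Ck_on k S f"
proof (induction k arbitrary: f)
  case 0
  then show ?case
    by (auto simp: Ck_on_Suc_dirderiv
        intro!: continuous_at_imp_continuous_on differentiable_imp_continuous_within)
next
  case (Suc k)
  then show ?case by (simp add: Ck_on_Suc_dirderiv)
qed

lemma Ck_on_const: "Ck_on k S (\<lambda>_::'a::real_normed_vector. c)"
proof (induction k arbitrary: c)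
  case (Suc k)
  have "dirderiv v (\<lambda>_::'a. c) = (\<lambda>_. 0)" for v
    using has_derivative_imp_dirderiv[OF has_derivative_const] by fast
  then show ?case using Suc[of 0] by (simp add: Ck_on_Suc_dirderiv)
qed simp

lemma Ck_on_dirderivI:
  assumes "open S" "\<And>x. x \<in> S \<Longrightarrow> (f has_derivative f' x) (at x)" "\<And>v. Ck_on k S (\<lambda>x. f' x v)"
  shows "Ck_on (Suc k) S f"
  unfolding Ck_on_Suc_dirderiv
proof (intro conjI ballI allI)
  show "f differentiable at x" if "x \<in> S" for x
    using assms(2)[OF that] by (auto simp: differentiable_def)
  show "Ck_on k S (dirderiv v f)" for v
    by (rule Ck_on_cong[OF assms(1) _ assms(3)[of v]])
       (use assms(2) has_derivative_imp_dirderiv in \<open>force\<close>)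
qed

lemma Ck_on_has_derivative:
  assumes "Ck_on (Suc k) S f" "x \<in> S"
  shows "(f has_derivative (\<lambda>v. dirderiv v f x)) (at x)"
  using assms frechet_derivative_works[of f "at x"]
  by (auto simp: Ck_on_Suc_dirderiv) (simp add: dirderiv_def)

lemma Ck_on_linear:
  assumes "open S" "bounded_linear L" "Ck_on k S f"
  shows "Ck_on k S (\<lambda>x. L (f x))"
  using assms(3)
proof (induction k arbitrary: f)
  case 0
  then show ?case using bounded_linear.continuous_on[OF assms(2)] by simp
next
  case (Suc k)
  note df = Ck_on_has_derivative[OF Suc.prems]
  show ?case
    by (rule Ck_on_dirderivI[OF assms(1) bounded_linear.has_derivative[OF assms(2) df]])
      (use Suc in \<open>auto simp: Ck_on_Suc_dirderiv\<close>)
qed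

lemma Ck_on_id: "open S \<Longrightarrow> Ck_on k S (\<lambda>x. x)"
proof (cases k)
  case (Suc j)
  assume "open S"
  then show ?thesis unfolding Suc
    by (rule Ck_on_dirderivI[where f' = "\<lambda>x v. v"]) (auto simp: Ck_on_const)
qed (auto)

lemma Ck_on_add:
  assumes "open S" "Ck_on k S f" "Ck_on k S g"
  shows "Ck_on k S (\<lambda>x. f x + g x)"
  using assms(2,3)
proof (induction k arbitrary: f g)
  case 0
  then show ?case by (simp add: continuous_on_add)
next
  case (Suc k)
  note df = Ck_on_has_derivative[OF Suc.prems(1)] and dg = Ck_on_has_derivative[OF Suc.prems(2)]
  show ?case
    by (rule Ck_on_dirderivI[OF assms(1) has_derivative_add[OF df dg]])
      (use Suc in \<open>auto simp: Ck_on_Suc_dirderiv\<close>)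
qed

lemma Ck_on_bilinear:
  assumes "open S" "bounded_bilinear B" "Ck_on k S f" "Ck_on k S g"
  shows "Ck_on k S (\<lambda>x. B (f x) (g x))"
  using assms(3,4)
proof (induction k arbitrary: f g)
  case 0
  then show ?case using bounded_bilinear.continuous_on[OF assms(2)] by simp
next
  case (Suc k)
  note df = Ck_on_has_derivative[OF Suc.prems(1)] and dg = Ck_on_has_derivative[OF Suc.prems(2)]
  show ?case
  proof (rule Ck_on_dirderivI[OF assms(1) bounded_bilinear.FDERIV[OF assms(2) df dg]])
    show "Ck_on k S (\<lambda>x. B (f x) (dirderiv v g x) + B (dirderiv v f x) (g x))" for v
      using Suc.prems Ck_on_SucD[OF Suc.prems(1)] Ck_on_SucD[OF Suc.prems(2)]
      by (intro Ck_on_add[OF assms(1)] Suc.IH) (auto simp: Ck_on_Suc_dirderiv)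
  qed
qed

lemma Ck_on_sum:
  assumes "open S" "finite I" "\<And>i. i \<in> I \<Longrightarrow> Ck_on k S (f i)"
  shows "Ck_on k S (\<lambda>x. \<Sum>i\<in>I. f i x)"
  using assms(2,3) by (induction I) (auto intro!: Ck_on_const Ck_on_add[OF assms(1)])

text \<open>By the chain rule a directional derivative of the composition is a sum, over a basis of the
  intermediate space, of components of the inner derivative times directional derivatives of the outer
  map at the inner one; these are again compositions, with one derivative less.\<close>

lemma Ck_on_compose:
  fixes f :: "'a::euclidean_space \<Rightarrow> 'b::real_normed_vector"
  assumes "open S" "open T" "Ck_on k T f" "Ck_on k S g" "g ` S \<subseteq> T"
  shows "Ck_on k S (\<lambda>x. f (g x))"
  using assms(3,4)
proof (induction k arbitrary: f)
  case 0
  then show ?case using assms(5) by (simp add: continuous_on_compose2[where t = T])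
next
  case (Suc k)
  note df = Ck_on_has_derivative[OF Suc.prems(1)] and dg = Ck_on_has_derivative[OF Suc.prems(2)]
  let ?f' = "\<lambda>x v. \<Sum>b\<in>Basis. (dirderiv v g x \<bullet> b) *\<^sub>R dirderiv b f (g x)"
  show ?case
  proof (rule Ck_on_dirderivI[OF assms(1), where f' = ?f'])
    show "((\<lambda>x. f (g x)) has_derivative ?f' x) (at x)" if "x \<in> S" for x
    proof -
      have fx: "(f has_derivative (\<lambda>v. dirderiv v f (g x))) (at (g x))"
        using df that assms(5) by blast
      have expand: "dirderiv w f (g x) = (\<Sum>b\<in>Basis. (w \<bullet> b) *\<^sub>R dirderiv b f (g x))" for w
        using linear_sum[OF has_derivative_linear[OF fx], of "\<lambda>b. (w \<bullet> b) *\<^sub>R b" Basis]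
        by (simp only: euclidean_representation linear_scale[OF has_derivative_linear[OF fx]])
      have "((\<lambda>x. f (g x)) has_derivative (\<lambda>v. dirderiv (dirderiv v g x) f (g x))) (at x)"
        using has_derivative_compose[OF dg[OF that] fx] .
      moreover have "(\<lambda>v. dirderiv (dirderiv v g x) f (g x)) = ?f' x"
        by (rule ext) (rule expand)
      ultimately show ?thesis by metis
    qed
    show "Ck_on k S (\<lambda>x. ?f' x v)" for v
      using Suc.prems Suc.IH Ck_on_SucD[OF Suc.prems(2)]
      by (intro Ck_on_sum[OF assms(1) finite_Basis]
            Ck_on_bilinear[OF assms(1) bounded_bilinear_scaleR]
            Ck_on_linear[OF assms(1) bounded_linear_inner_left])
         (auto simp: Ck_on_Suc_dirderiv)
  qed
qed

text \<open>The derivative of the inverse is a polynomial in the inverse and the derivative of the function, so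
  every step of the induction gains one order.\<close>

lemma Ck_on_inverse:
  fixes f :: "'a::real_normed_vector \<Rightarrow> real"
  assumes "open S" "\<And>x. x \<in> S \<Longrightarrow> f x \<noteq> 0" "Ck_on k S f"
  shows "Ck_on k S (\<lambda>x. inverse (f x))"
  using assms(3)
proof (induction k)
  case 0
  then show ?case using assms(2) by (simp add: continuous_on_inverse)
next
  case (Suc k)
  note IH = Suc.IH[OF Ck_on_SucD[OF Suc.prems]]
  show ?case
  proof (rule Ck_on_dirderivI[OF assms(1),
          where f' = "\<lambda>x v. - (inverse (f x) * dirderiv v f x * inverse (f x))"])
    show "((\<lambda>x. inverse (f x)) has_derivative
        (\<lambda>v. - (inverse (f x) * dirderiv v f x * inverse (f x)))) (at x)" if "x \<in> S" for x
      using Deriv.has_derivative_inverse[OF assms(2)[OF that] Ck_on_has_derivative[OF Suc.prems that]] .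
    show "Ck_on k S (\<lambda>x. - (inverse (f x) * dirderiv v f x * inverse (f x)))" for v
      using IH Suc.prems
      by (intro Ck_on_linear[OF assms(1) bounded_linear_minus[OF bounded_linear_ident]]
          Ck_on_bilinear[OF assms(1) bounded_bilinear_mult]) (auto simp: Ck_on_Suc_dirderiv)
  qed
qed

lemma smooth_on_subset: "smooth_on S f \<Longrightarrow> T \<subseteq> S \<Longrightarrow> smooth_on T f"
  by (auto simp: smooth_on_def intro: Ck_on_subset)

lemma smooth_on_cong:
  assumes "open S" "\<And>x. x \<in> S \<Longrightarrow> f x = g x"
  shows "smooth_on S f \<longleftrightarrow> smooth_on S g"
  unfolding smooth_on_def using Ck_on_cong[OF assms(1)] assms(2) by metis

lemma smooth_on_local:
  assumes "\<And>x. x \<in> S \<Longrightarrow> \<exists>T. open T \<and> x \<in> T \<and> smooth_on T f"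
  shows "smooth_on S f"
  unfolding smooth_on_def
proof (intro allI Ck_on_local)
  fix k x assume "x \<in> S"
  then show "\<exists>T. open T \<and> x \<in> T \<and> Ck_on k T f"
    using assms unfolding smooth_on_def by blast
qed

lemma smooth_on_has_derivative:
  "smooth_on S f \<Longrightarrow> x \<in> S \<Longrightarrow> (f has_derivative (\<lambda>v. dirderiv v f x)) (at x)"
  unfolding smooth_on_def using Ck_on_has_derivative by blast

lemma smooth_on_linear_dirderiv:
  "smooth_on S f \<Longrightarrow> x \<in> S \<Longrightarrow> linear (\<lambda>v. dirderiv v f x)"
  using smooth_on_has_derivative has_derivative_linear by blast

lemma smooth_on_dirderiv: "smooth_on S f \<Longrightarrow> smooth_on S (dirderiv v f)"
  unfolding smooth_on_def by (metis Ck_on_Suc_dirderiv)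

lemma smooth_on_continuous_on: "smooth_on S f \<Longrightarrow> continuous_on S f"
  unfolding smooth_on_def by (metis Ck_on.simps(1))

lemma smooth_on_const: "smooth_on S (\<lambda>_. c)"
  by (simp add: smooth_on_def Ck_on_const)

lemma smooth_on_id: "open S \<Longrightarrow> smooth_on S (\<lambda>x. x)"
  by (simp add: smooth_on_def Ck_on_id)

lemma smooth_on_linear:
  "open S \<Longrightarrow> bounded_linear L \<Longrightarrow> smooth_on S f \<Longrightarrow> smooth_on S (\<lambda>x. L (f x))"
  by (simp add: smooth_on_def Ck_on_linear)

lemma smooth_on_add:
  "open S \<Longrightarrow> smooth_on S f \<Longrightarrow> smooth_on S g \<Longrightarrow> smooth_on S (\<lambda>x. f x + g x)"
  by (simp add: smooth_on_def Ck_on_add)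

lemma smooth_on_minus: "open S \<Longrightarrow> smooth_on S f \<Longrightarrow> smooth_on S (\<lambda>x. - f x)"
  using smooth_on_linear[OF _ bounded_linear_minus[OF bounded_linear_ident]] .

lemma smooth_on_diff:
  "open S \<Longrightarrow> smooth_on S f \<Longrightarrow> smooth_on S g \<Longrightarrow> smooth_on S (\<lambda>x. f x - g x)"
  using smooth_on_add[of S f "\<lambda>x. - g x"] by (simp add: smooth_on_minus)

lemma smooth_on_bilinear:
  "open S \<Longrightarrow> bounded_bilinear B \<Longrightarrow> smooth_on S f \<Longrightarrow> smooth_on S g \<Longrightarrow> smooth_on S (\<lambda>x. B (f x) (g x))"
  by (simp add: smooth_on_def Ck_on_bilinear)

lemmas smooth_on_mult = smooth_on_bilinear[OF _ bounded_bilinear_mult]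
lemmas smooth_on_scaleR = smooth_on_bilinear[OF _ bounded_bilinear_scaleR]
lemmas smooth_on_inner_left = smooth_on_linear[OF _ bounded_linear_inner_left]
lemmas smooth_on_vec_nth = smooth_on_linear[OF _ bounded_linear_vec_nth]

lemma smooth_on_sum:
  "open S \<Longrightarrow> finite I \<Longrightarrow> (\<And>i. i \<in> I \<Longrightarrow> smooth_on S (f i)) \<Longrightarrow> smooth_on S (\<lambda>x. \<Sum>i\<in>I. f i x)"
  by (simp add: smooth_on_def Ck_on_sum)

lemma smooth_on_prod:
  fixes f :: "'i \<Rightarrow> 'a::real_normed_vector \<Rightarrow> real"
  assumes "open S" "finite I" "\<And>i. i \<in> I \<Longrightarrow> smooth_on S (f i)"
  shows "smooth_on S (\<lambda>x. \<Prod>i\<in>I. f i x)"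
  using assms(2,3) by (induction I) (auto intro!: smooth_on_const smooth_on_mult[OF assms(1)])

lemma smooth_on_inverse:
  fixes f :: "'a::real_normed_vector \<Rightarrow> real"
  shows "open S \<Longrightarrow> (\<And>x. x \<in> S \<Longrightarrow> f x \<noteq> 0) \<Longrightarrow> smooth_on S f \<Longrightarrow> smooth_on S (\<lambda>x. inverse (f x))"
  by (simp add: smooth_on_def Ck_on_inverse)

lemma smooth_on_compose:
  fixes f :: "'a::euclidean_space \<Rightarrow> 'b::real_normed_vector"
  shows "open S \<Longrightarrow> open T \<Longrightarrow> smooth_on T f \<Longrightarrow> smooth_on S g \<Longrightarrow> g ` S \<subseteq> T \<Longrightarrow> smooth_on S (\<lambda>x. f (g x))"
  unfolding smooth_on_def using Ck_on_compose by blast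

lemma smooth_on_Pair:
  assumes "open S" "smooth_on S f" "smooth_on S g"
  shows "smooth_on S (\<lambda>x. (f x, g x))"
proof -
  have "smooth_on S (\<lambda>x. (f x, 0) + (0, g x))"
    by (intro smooth_on_add[OF assms(1)]
          smooth_on_linear[OF assms(1) bounded_linear_Pair[OF bounded_linear_ident bounded_linear_zero] assms(2)]
          smooth_on_linear[OF assms(1) bounded_linear_Pair[OF bounded_linear_zero bounded_linear_ident] assms(3)])
  then show ?thesis by simp
qed

lemma smooth_on_vecI:
  fixes f :: "'a::real_normed_vector \<Rightarrow> 'b::euclidean_space ^ 'n"
  assumes "open S" "\<And>i. smooth_on S (\<lambda>x. f x $ i)"
  shows "smooth_on S f"
proof -
  have lin: "bounded_linear (axis i :: 'b \<Rightarrow> 'b ^ 'n)" for i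
    unfolding linear_conv_bounded_linear[symmetric]
    by (rule linearI) (auto simp: axis_def vec_eq_iff)
  have "f x = (\<Sum>i\<in>UNIV. axis i (f x $ i))" for x
    by (simp add: vec_eq_iff axis_def)
  then have "f = (\<lambda>x. \<Sum>i\<in>UNIV. axis i (f x $ i))" by auto
  moreover have "smooth_on S (\<lambda>x. \<Sum>i\<in>UNIV. axis i (f x $ i))"
    by (intro smooth_on_sum[OF assms(1)] smooth_on_linear[OF assms(1) lin] assms(2)) simp
  ultimately show ?thesis by metis
qed

lemma dirderiv_compose:
  assumes "smooth_on T f" "g x \<in> T" "smooth_on S g" "x \<in> S"
  shows "dirderiv v (\<lambda>x. f (g x)) x = dirderiv (dirderiv v g x) f (g x)"
  by (rule has_derivative_imp_dirderiv[OF has_derivative_compose[OF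
        smooth_on_has_derivative[OF assms(3,4)] smooth_on_has_derivative[OF assms(1,2)]]])

subsection \<open>Symmetry of second derivatives\<close>

lemma smooth_on_line_derivative:
  fixes f :: "'a::real_normed_vector \<Rightarrow> real"
  assumes "smooth_on S f" "p + s *\<^sub>R z \<in> S"
  shows "((\<lambda>s. f (p + s *\<^sub>R z)) has_real_derivative dirderiv z f (p + s *\<^sub>R z)) (at s)"
proof -
  have "((\<lambda>s. p + s *\<^sub>R z) has_derivative (\<lambda>r. r *\<^sub>R z)) (at s)"
    by (auto intro!: derivative_eq_intros)
  from has_derivative_compose[OF this smooth_on_has_derivative[OF assms]]
  show ?thesis
    using linear_scale[OF smooth_on_linear_dirderiv[OF assms]]
    by (simp add: has_field_derivative_def mult.commute[of _ "dirderiv z f (p + s *\<^sub>R z)"])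
qed

text \<open>The second difference of \<open>\<phi>\<close> over a small parallelogram equals, by the mean value theorem
  applied first in direction \<open>v\<close> and then in direction \<open>w\<close>, a value of \<open>D\<^sub>w D\<^sub>v \<phi>\<close> in the
  parallelogram. The difference itself is symmetric in \<open>v\<close> and \<open>w\<close>.\<close>

lemma second_difference_mvt:
  fixes \<phi> :: "'a::real_normed_vector \<Rightarrow> real"
  assumes "smooth_on S \<phi>" "h > 0"
    and S: "\<And>s t. 0 \<le> s \<Longrightarrow> s \<le> h \<Longrightarrow> 0 \<le> t \<Longrightarrow> t \<le> h \<Longrightarrow> x + s *\<^sub>R v + t *\<^sub>R w \<in> S"
  obtains s t where "0 < s" "s < h" "0 < t" "t < h"
    "\<phi> (x + h *\<^sub>R v + h *\<^sub>R w) - \<phi> (x + h *\<^sub>R v) - \<phi> (x + h *\<^sub>R w) + \<phi> x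
      = h * h * dirderiv w (dirderiv v \<phi>) (x + s *\<^sub>R v + t *\<^sub>R w)"
proof -
  define g where "g = (\<lambda>s. \<phi> ((x + h *\<^sub>R w) + s *\<^sub>R v) - \<phi> (x + s *\<^sub>R v))"
  have "\<exists>s. s > 0 \<and> s < h \<and> g h - g 0 =
      (h - 0) * (dirderiv v \<phi> ((x + h *\<^sub>R w) + s *\<^sub>R v) - dirderiv v \<phi> (x + s *\<^sub>R v))"
  proof (rule MVT2[OF \<open>h > 0\<close>])
    fix s :: real assume "0 \<le> s" "s \<le> h"
    then have "x + h *\<^sub>R w + s *\<^sub>R v \<in> S" "x + s *\<^sub>R v \<in> S"
      using S[of s h] S[of s 0] \<open>h > 0\<close> by (auto simp: algebra_simps)
    then show "(g has_real_derivative (dirderiv v \<phi> ((x + h *\<^sub>R w) + s *\<^sub>R v) - dirderiv v \<phi> (x + s *\<^sub>R v))) (at s)"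
      unfolding g_def by (intro DERIV_diff smooth_on_line_derivative[OF assms(1)])
  qed
  then obtain s where s: "0 < s" "s < h" and gs: "g h - g 0 =
      h * (dirderiv v \<phi> ((x + h *\<^sub>R w) + s *\<^sub>R v) - dirderiv v \<phi> (x + s *\<^sub>R v))" by auto
  have "\<exists>t. t > 0 \<and> t < h \<and> dirderiv v \<phi> ((x + s *\<^sub>R v) + h *\<^sub>R w) - dirderiv v \<phi> ((x + s *\<^sub>R v) + 0 *\<^sub>R w)
      = (h - 0) * dirderiv w (dirderiv v \<phi>) ((x + s *\<^sub>R v) + t *\<^sub>R w)"
    by (rule MVT2[OF \<open>h > 0\<close>], rule smooth_on_line_derivative) (use S[of s] s in \<open>auto intro: smooth_on_dirderiv assms\<close>)
  then obtain t where t: "0 < t" "t < h" "dirderiv v \<phi> ((x + s *\<^sub>R v) + h *\<^sub>R w) - dirderiv v \<phi> (x + s *\<^sub>R v)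
      = h * dirderiv w (dirderiv v \<phi>) ((x + s *\<^sub>R v) + t *\<^sub>R w)" by auto
  have "g h - g 0 = h * h * dirderiv w (dirderiv v \<phi>) (x + s *\<^sub>R v + t *\<^sub>R w)"
    using gs t(3) by (simp add: algebra_simps)
  moreover have "g h - g 0 = \<phi> (x + h *\<^sub>R v + h *\<^sub>R w) - \<phi> (x + h *\<^sub>R v) - \<phi> (x + h *\<^sub>R w) + \<phi> x"
    by (simp add: g_def algebra_simps)
  ultimately show ?thesis using that s t by metis
qed

text \<open>If the two mixed derivatives had different values at \<open>x\<close>, then by continuity all values of the one
  near \<open>x\<close> would differ from all values of the other, although every small second difference is a
  value of both.\<close>

lemma dirderiv_commute_real:
  fixes \<phi> :: "'a::real_normed_vector \<Rightarrow> real"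
  assumes "open S" "smooth_on S \<phi>" "x \<in> S"
  shows "dirderiv v (dirderiv w \<phi>) x = dirderiv w (dirderiv v \<phi>) x"
proof (rule ccontr)
  let ?a = "dirderiv v (dirderiv w \<phi>)" and ?b = "dirderiv w (dirderiv v \<phi>)"
  assume neq: "?a x \<noteq> ?b x"
  define e where "e = \<bar>?a x - ?b x\<bar> / 2"
  have "e > 0" using neq by (simp add: e_def)
  have "isCont ?a x" "isCont ?b x"
    using smooth_on_continuous_on[OF smooth_on_dirderiv[OF smooth_on_dirderiv[OF assms(2)]]] assms
    by (auto simp: continuous_on_eq_continuous_at)
  then obtain d1 d2 where d: "d1 > 0" "d2 > 0" "\<And>y. dist y x < d1 \<Longrightarrow> dist (?a y) (?a x) < e"
     "\<And>y. dist y x < d2 \<Longrightarrow> dist (?b y) (?b x) < e"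
    using \<open>e > 0\<close> unfolding continuous_at_eps_delta by metis
  obtain d3 where d3: "d3 > 0" "ball x d3 \<subseteq> S" using assms openE by blast
  define r where "r = min d1 (min d2 d3)"
  define h where "h = r / (2 * (norm v + norm w + 1))"
  have "r > 0" using d d3 by (simp add: r_def)
  then have "h > 0" by (simp add: h_def add_nonneg_pos)
  have near: "dist (x + s *\<^sub>R v + t *\<^sub>R w) x < r" if "0 \<le> s" "s \<le> h" "0 \<le> t" "t \<le> h" for s t
  proof -
    have "norm (s *\<^sub>R v + t *\<^sub>R w) \<le> s * norm v + t * norm w"
      using norm_triangle_ineq[of "s *\<^sub>R v" "t *\<^sub>R w"] that by simp
    also have "\<dots> \<le> h * norm v + h * norm w"
      using that by (intro add_mono mult_right_mono) auto
    also have "\<dots> < h * (2 * (norm v + norm w + 1))"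
    proof -
      have "h * norm v + h * norm w = h * (norm v + norm w)" by (simp add: algebra_simps)
      also have "\<dots> < h * (2 * (norm v + norm w + 1))"
        using \<open>h > 0\<close> norm_ge_zero[of v] norm_ge_zero[of w]
        by (intro mult_strict_left_mono) (simp_all add: algebra_simps add_nonneg_pos)
      finally show ?thesis .
    qed
    also have "\<dots> = r" unfolding h_def by (simp add: add_nonneg_eq_0_iff)
    finally show ?thesis by (simp add: dist_norm algebra_simps)
  qed
  have inS: "x + s *\<^sub>R v + t *\<^sub>R w \<in> S" if "0 \<le> s" "s \<le> h" "0 \<le> t" "t \<le> h" for s t
    using near[OF that] d3 by (auto simp: r_def dist_commute)
  obtain s t where st: "0 < s" "s < h" "0 < t" "t < h"
    "\<phi> (x + h *\<^sub>R v + h *\<^sub>R w) - \<phi> (x + h *\<^sub>R v) - \<phi> (x + h *\<^sub>R w) + \<phi> x = h * h * ?b (x + s *\<^sub>R v + t *\<^sub>R w)"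
    using second_difference_mvt[OF assms(2) \<open>h > 0\<close> inS] by blast
  have inS': "x + s *\<^sub>R w + t *\<^sub>R v \<in> S" if "0 \<le> s" "s \<le> h" "0 \<le> t" "t \<le> h" for s t
    using inS[of t s] that by (simp add: algebra_simps)
  obtain s' t' where st': "0 < s'" "s' < h" "0 < t'" "t' < h"
    "\<phi> (x + h *\<^sub>R w + h *\<^sub>R v) - \<phi> (x + h *\<^sub>R w) - \<phi> (x + h *\<^sub>R v) + \<phi> x = h * h * ?a (x + s' *\<^sub>R w + t' *\<^sub>R v)"
    using second_difference_mvt[OF assms(2) \<open>h > 0\<close> inS'] by blast
  have "h * h * ?a (x + s' *\<^sub>R w + t' *\<^sub>R v) = h * h * ?b (x + s *\<^sub>R v + t *\<^sub>R w)"
    using st(5) st'(5) by (auto simp: algebra_simps)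
  then have eq: "?a (x + s' *\<^sub>R w + t' *\<^sub>R v) = ?b (x + s *\<^sub>R v + t *\<^sub>R w)"
    using \<open>h > 0\<close> by simp
  have "dist (x + s' *\<^sub>R w + t' *\<^sub>R v) x < d1"
    using near[of t' s'] st' by (simp add: r_def algebra_simps)
  moreover have "dist (x + s *\<^sub>R v + t *\<^sub>R w) x < d2"
    using near[of s t] st by (simp add: r_def algebra_simps)
  ultimately have "dist (?a x) (?b x) < e + e"
    using d(3,4) eq by (smt (verit) dist_commute dist_triangle)
  then show False by (simp add: e_def dist_real_def)
qed

lemma dirderiv_linear:
  assumes "bounded_linear L" "smooth_on S f" "x \<in> S"
  shows "dirderiv v (\<lambda>x. L (f x)) x = L (dirderiv v f x)"
  by (rule has_derivative_imp_dirderiv[OF bounded_linear.has_derivative[OF assms(1)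
        smooth_on_has_derivative[OF assms(2,3)]]])

lemma dirderiv_commute:
  fixes f :: "'a::real_normed_vector \<Rightarrow> 'b::euclidean_space"
  assumes "open S" "smooth_on S f" "x \<in> S"
  shows "dirderiv v (dirderiv w f) x = dirderiv w (dirderiv v f) x"
proof (rule euclidean_eqI)
  fix b :: 'b assume "b \<in> Basis"
  have *: "dirderiv v (dirderiv w f) x \<bullet> b = dirderiv v (dirderiv w (\<lambda>x. f x \<bullet> b)) x" for v w
  proof -
    have "dirderiv v (dirderiv w (\<lambda>x. f x \<bullet> b)) x = dirderiv v (\<lambda>x. dirderiv w f x \<bullet> b) x"
      by (rule dirderiv_cong_open[OF assms(1,3)]) (rule dirderiv_linear[OF bounded_linear_inner_left assms(2)])
    also have "\<dots> = dirderiv v (dirderiv w f) x \<bullet> b"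
      by (rule dirderiv_linear[OF bounded_linear_inner_left smooth_on_dirderiv[OF assms(2)] assms(3)])
    finally show ?thesis by simp
  qed
  show "dirderiv v (dirderiv w f) x \<bullet> b = dirderiv w (dirderiv v f) x \<bullet> b"
    unfolding * by (rule dirderiv_commute_real[OF assms(1) smooth_on_inner_left[OF assms(1,2)] assms(3)])
qed

lemma dirderiv_add:
  assumes "smooth_on S f" "smooth_on S g" "x \<in> S"
  shows "dirderiv v (\<lambda>x. f x + g x) x = dirderiv v f x + dirderiv v g x"
  by (rule has_derivative_imp_dirderiv[OF has_derivative_add[OF
        smooth_on_has_derivative[OF assms(1,3)] smooth_on_has_derivative[OF assms(2,3)]]])

lemma dirderiv_bilinear:
  assumes "bounded_bilinear B" "smooth_on S f" "smooth_on S g" "x \<in> S"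
  shows "dirderiv v (\<lambda>x. B (f x) (g x)) x = B (f x) (dirderiv v g x) + B (dirderiv v f x) (g x)"
  by (rule has_derivative_imp_dirderiv[OF bounded_bilinear.FDERIV[OF assms(1)
        smooth_on_has_derivative[OF assms(2,4)] smooth_on_has_derivative[OF assms(3,4)]]])

lemma dirderiv_sum:
  assumes "\<And>i. i \<in> I \<Longrightarrow> smooth_on S (f i)" "x \<in> S"
  shows "dirderiv v (\<lambda>x. \<Sum>i\<in>I. f i x) x = (\<Sum>i\<in>I. dirderiv v (f i) x)"
  by (rule has_derivative_imp_dirderiv[OF has_derivative_sum])
    (rule smooth_on_has_derivative[OF assms])

lemmas dirderiv_mult = dirderiv_bilinear[OF bounded_bilinear_mult]
lemmas dirderiv_scaleR = dirderiv_bilinear[OF bounded_bilinear_scaleR]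

lemma dirderiv_const: "dirderiv v (\<lambda>_. c) x = 0"
  by (simp add: has_derivative_imp_dirderiv[OF has_derivative_const])

lemma dirderiv_id: "dirderiv v (\<lambda>x. x) x = v"
  by (simp add: has_derivative_imp_dirderiv[OF has_derivative_ident])

subsection \<open>Cut-off functions\<close>

text \<open>The function \<open>exp (-1/x)\<close> for positive \<open>x\<close>, extended by zero, times powers of \<open>1/x\<close>. The powers are
  there because the derivatives of one of these functions are combinations of the others.\<close>

definition flat_exp :: "nat \<Rightarrow> real \<Rightarrow> real" where
  "flat_exp n x = (if x > 0 then (1 / x) ^ n * exp (- (1 / x)) else 0)"

lemma flat_exp_tendsto_0: "(flat_exp n \<longlongrightarrow> 0) (at 0)"
proof -
  have "((\<lambda>x. (inverse x) ^ n / exp (inverse x)) \<longlongrightarrow> (0::real)) (at_right 0)"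
    using filterlim_compose[OF tendsto_power_div_exp_0 filterlim_inverse_at_top_right] .
  then have "(flat_exp n \<longlongrightarrow> 0) (at_right 0)"
    by (rule Lim_transform_eventually)
      (auto simp: eventually_at_right_field flat_exp_def exp_minus divide_inverse intro!: exI[of _ 1])
  moreover have "(flat_exp n \<longlongrightarrow> 0) (at_left 0)"
    by (rule Lim_transform_eventually[OF tendsto_const])
      (auto simp: eventually_at_left_field flat_exp_def intro!: exI[of _ "-1"])
  ultimately show ?thesis by (rule filterlim_split_at[rotated])
qed

text \<open>At the origin the difference quotient of each function is the next one, which tends to zero.\<close>

lemma flat_exp_has_derivative:
  "(flat_exp n has_real_derivative (flat_exp (n + 2) x - n * flat_exp (n + 1) x)) (at x)"
proof -
  consider "x > 0" | "x < 0" | "x = 0" by linarith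
  then show ?thesis
  proof cases
    case 1
    have "((\<lambda>x. (1 / x) ^ n * exp (- (1 / x))) has_real_derivative
        (flat_exp (n + 2) x - n * flat_exp (n + 1) x)) (at x)"
    proof -
      have inv: "((\<lambda>x. 1 / x) has_real_derivative - ((1 / x) ^ 2)) (at x)"
        using 1 by (auto intro!: derivative_eq_intros simp: field_simps power2_eq_square)
      have pow: "((\<lambda>x. (1 / x) ^ n) has_real_derivative n * (- ((1 / x) ^ 2) * (1 / x) ^ (n - Suc 0))) (at x)"
        using DERIV_power[OF inv, of n] by simp
      have ex: "((\<lambda>x. exp (- (1 / x))) has_real_derivative exp (- (1 / x)) * - (- ((1 / x) ^ 2))) (at x)"
        by (rule DERIV_fun_exp[OF DERIV_minus[OF inv]])
      show ?thesis
        by (rule DERIV_cong[OF DERIV_mult[OF pow ex]])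
          (use 1 in \<open>cases n; simp add: flat_exp_def power2_eq_square algebra_simps\<close>)
    qed
    then show ?thesis
      by (rule has_field_derivative_transform_within_open[where S = "{0<..}"])
        (use 1 in \<open>auto simp: flat_exp_def\<close>)
  next
    case 2
    have "((\<lambda>_. 0) has_real_derivative (flat_exp (n + 2) x - n * flat_exp (n + 1) x)) (at x)"
      using 2 by (auto simp: flat_exp_def)
    then show ?thesis
      by (rule has_field_derivative_transform_within_open[where S = "{..<0}"])
        (use 2 in \<open>auto simp: flat_exp_def\<close>)
  next
    case 3
    have "(\<lambda>h. (flat_exp n (0 + h) - flat_exp n 0) / h) = flat_exp (n + 1)"
      by (auto simp: flat_exp_def fun_eq_iff)
    then show ?thesis
      unfolding 3 DERIV_def using flat_exp_tendsto_0[of "n + 1"] by (simp add: flat_exp_def)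
  qed
qed

lemma Ck_on_flat_exp: "Ck_on k UNIV (flat_exp n)"
proof (induction k arbitrary: n)
  case 0
  show ?case
    using DERIV_isCont[OF flat_exp_has_derivative] by (simp add: continuous_at_imp_continuous_on)
next
  case (Suc k)
  show ?case
  proof (rule Ck_on_dirderivI[OF open_UNIV])
    show "(flat_exp n has_derivative (\<lambda>h. h * (flat_exp (n + 2) x - n * flat_exp (n + 1) x))) (at x)" for x
      using flat_exp_has_derivative[of n x] by (simp add: has_field_derivative_def mult_commute_abs)
    have "Ck_on k UNIV (\<lambda>x. v * (flat_exp (n + 2) x + (- real n) * flat_exp (n + 1) x))" for v
      by (intro Ck_on_bilinear[OF open_UNIV bounded_bilinear_mult] Ck_on_add Ck_on_const Suc open_UNIV)
    then show "Ck_on k UNIV (\<lambda>x. v * (flat_exp (n + 2) x - n * flat_exp (n + 1) x))" for v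
      by simp
  qed
qed

text \<open>With \<open>q\<close> the squared distance in units of \<open>\<rho>\<close>, the quotient of \<open>f (2 - q)\<close> by
  \<open>f (2 - q) + f (q - 1)\<close> is 1 for \<open>q \<le> 1\<close> and 0 for \<open>q \<ge> 2\<close>; the denominator has no zeros because
  \<open>2 - q\<close> and \<open>q - 1\<close> are never both nonpositive.\<close>

lemma smooth_bump_exists:
  fixes a :: "'a::euclidean_space"
  assumes "\<rho> > 0"
  obtains \<phi> :: "'a \<Rightarrow> real" where "smooth_on UNIV \<phi>" "\<And>x. dist a x \<le> \<rho> \<Longrightarrow> \<phi> x = 1"
    "\<And>x. dist a x \<ge> 2 * \<rho> \<Longrightarrow> \<phi> x = 0"
proof -
  define f where "f = flat_exp 0"
  define q where "q = (\<lambda>x. ((a - x) \<bullet> (a - x)) / \<rho>\<^sup>2)"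
  have f: "smooth_on UNIV f" by (simp add: f_def smooth_on_def Ck_on_flat_exp)
  have f0: "f t = 0 \<longleftrightarrow> t \<le> 0" and fpos: "f t \<ge> 0" for t by (auto simp: f_def flat_exp_def)
  have nz: "f (2 - t) + f (t - 1) \<noteq> 0" for t
    using f0[of "2 - t"] f0[of "t - 1"] fpos[of "2 - t"] fpos[of "t - 1"] by linarith
  define \<phi> where "\<phi> = (\<lambda>x. f (2 - q x) * inverse (f (2 - q x) + f (q x - 1)))"
  have dm: "smooth_on UNIV (\<lambda>x. a - x)"
    by (intro smooth_on_diff smooth_on_id smooth_on_const open_UNIV)
  have q: "smooth_on UNIV q"
    unfolding q_def divide_inverse
    by (intro smooth_on_mult smooth_on_bilinear[OF _ bounded_bilinear_inner] smooth_on_const dm open_UNIV)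
  have "smooth_on UNIV (\<lambda>x. f (2 - q x))" "smooth_on UNIV (\<lambda>x. f (q x - 1))"
    by (rule smooth_on_compose[OF _ _ f]; intro smooth_on_diff smooth_on_const q open_UNIV subset_UNIV)+
  then have "smooth_on UNIV \<phi>"
    unfolding \<phi>_def by (intro smooth_on_mult smooth_on_inverse smooth_on_add open_UNIV nz)
  moreover have qd: "q x = (dist a x / \<rho>)\<^sup>2" for x
    by (simp add: q_def dist_norm power_divide power2_norm_eq_inner)
  have "\<phi> x = 1" if "dist a x \<le> \<rho>" for x
  proof -
    have "q x \<le> 1" using that assms by (simp add: qd power_le_one)
    then have "f (q x - 1) = 0" "f (2 - q x) \<noteq> 0" using f0 by auto
    then show ?thesis by (simp add: \<phi>_def)
  qed
  moreover have "\<phi> x = 0" if "dist a x \<ge> 2 * \<rho>" for x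
  proof -
    have "2 \<le> dist a x / \<rho>" using that assms by (simp add: field_simps)
    then have "2\<^sup>2 \<le> q x" unfolding qd by (rule power_mono) simp
    then have "f (2 - q x) = 0" using f0 by auto
    then show ?thesis by (simp add: \<phi>_def)
  qed
  ultimately show ?thesis using that by blast
qed

subsection \<open>Matrices and fields of bilinear maps\<close>

lemma smooth_on_det:
  fixes A :: "'a::real_normed_vector \<Rightarrow> real ^ 'n ^ 'n"
  assumes "open S" "\<And>i j. smooth_on S (\<lambda>x. A x $ i $ j)"
  shows "smooth_on S (\<lambda>x. det (A x))"
  unfolding det_def
  by (intro smooth_on_sum smooth_on_mult smooth_on_const smooth_on_prod assms) (simp_all add: finite_permutations)

text \<open>Cramer's rule exhibits the solution of a linear system as a rational function of its entries.\<close>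

lemma smooth_on_solve:
  fixes A :: "'a::real_normed_vector \<Rightarrow> real ^ 'n ^ 'n"
  assumes "open S" "\<And>i j. smooth_on S (\<lambda>x. A x $ i $ j)" "\<And>i. smooth_on S (\<lambda>x. b x $ i)"
    and nz: "\<And>x. x \<in> S \<Longrightarrow> det (A x) \<noteq> 0" and "\<And>x. x \<in> S \<Longrightarrow> A x *v z x = b x"
  shows "smooth_on S z"
proof -
  have "z x = (\<chi> k. det (\<chi> i j. if j = k then b x $ i else A x $ i $ j) * inverse (det (A x)))"
    if "x \<in> S" for x
    using cramer[OF nz[OF that], of "z x" "b x"] assms(5)[OF that] by (simp add: divide_inverse)
  moreover have "smooth_on S (\<lambda>x. (\<chi> k. det (\<chi> i j. if j = k then b x $ i else A x $ i $ j) * inverse (det (A x))))"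
  proof (rule smooth_on_vecI[OF assms(1)], simp, intro smooth_on_mult smooth_on_inverse smooth_on_det assms)
    show "smooth_on S (\<lambda>x. (\<chi> i j. if j = k then b x $ i else A x $ i $ j) $ i $ j)" for i j k
      using assms(2,3) by (cases "j = k") auto
  qed auto
  ultimately show ?thesis using smooth_on_cong[OF assms(1), of z] by simp
qed

lemma bilinear_expand:
  fixes B :: "'e::euclidean_space \<Rightarrow> 'f::euclidean_space \<Rightarrow> 'c::real_vector"
  assumes "bilinear B"
  shows "B v w = (\<Sum>b\<in>Basis. \<Sum>c\<in>Basis. ((v \<bullet> b) * (w \<bullet> c)) *\<^sub>R B b c)"
proof -
  have 1: "linear (\<lambda>v. B v w)" and 2: "linear (\<lambda>w. B v w)" for v w
    using assms by (auto simp: bilinear_def)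
  have "B v w = (\<Sum>b\<in>Basis. (v \<bullet> b) *\<^sub>R B b w)"
    using linear_sum[OF 1, of "\<lambda>b. (v \<bullet> b) *\<^sub>R b" Basis]
    by (simp only: euclidean_representation linear_scale[OF 1])
  moreover have "B b w = (\<Sum>c\<in>Basis. (w \<bullet> c) *\<^sub>R B b c)" for b
    using linear_sum[OF 2, of b "\<lambda>b. (w \<bullet> b) *\<^sub>R b" Basis]
    by (simp only: euclidean_representation linear_scale[OF 2])
  ultimately show ?thesis by (simp add: scaleR_sum_right)
qed

text \<open>A smooth field of bilinear maps obeys the product rule, with one extra term for the
  dependence on the base point.\<close>

lemma smooth_on_bilinear_field:
  fixes B :: "'y::euclidean_space \<Rightarrow> 'e::euclidean_space \<Rightarrow> 'f::euclidean_space \<Rightarrow> 'c::real_normed_vector"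
    and y :: "'x::real_normed_vector \<Rightarrow> 'y"
  assumes "open S" "open T" "\<And>p. p \<in> T \<Longrightarrow> bilinear (B p)" "\<And>v w. smooth_on T (\<lambda>p. B p v w)"
    "smooth_on S y" "y ` S \<subseteq> T" "smooth_on S a" "smooth_on S b"
  shows "smooth_on S (\<lambda>x. B (y x) (a x) (b x))"
proof -
  have "smooth_on S (\<lambda>x. \<Sum>i\<in>Basis. \<Sum>j\<in>Basis. ((a x \<bullet> i) * (b x \<bullet> j)) *\<^sub>R B (y x) i j)"
    by (intro smooth_on_sum smooth_on_scaleR smooth_on_mult smooth_on_inner_left assms
        smooth_on_compose[OF assms(1,2,4,5,6)]) simp_all
  then show ?thesis
    by (subst smooth_on_cong[OF assms(1) bilinear_expand[OF assms(3)]]) (use assms(6) in auto)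
qed

lemma dirderiv_bilinear_field:
  fixes B :: "'y::euclidean_space \<Rightarrow> 'e::euclidean_space \<Rightarrow> 'f::euclidean_space \<Rightarrow> 'c::real_normed_vector"
    and y :: "'x::real_normed_vector \<Rightarrow> 'y"
  assumes "open S" "open T" "\<And>p. p \<in> T \<Longrightarrow> bilinear (B p)" "\<And>v w. smooth_on T (\<lambda>p. B p v w)"
    "smooth_on S y" "y ` S \<subseteq> T" "smooth_on S a" "smooth_on S b" "x \<in> S"
  shows "dirderiv v (\<lambda>x. B (y x) (a x) (b x)) x =
    dirderiv (dirderiv v y x) (\<lambda>p. B p (a x) (b x)) (y x) + B (y x) (dirderiv v a x) (b x)
    + B (y x) (a x) (dirderiv v b x)"
proof -
  note sm = smooth_on_mult[OF assms(1)] smooth_on_scaleR[OF assms(1)] smooth_on_inner_left[OF assms(1)]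
    assms smooth_on_compose[OF assms(1,2,4,5,6)]
  have yx: "y x \<in> T" using assms by auto
  have "dirderiv v (\<lambda>x. B (y x) (a x) (b x)) x =
      dirderiv v (\<lambda>x. \<Sum>i\<in>Basis. \<Sum>j\<in>Basis. ((a x \<bullet> i) * (b x \<bullet> j)) *\<^sub>R B (y x) i j) x"
    by (rule dirderiv_cong_open[OF assms(1,9)], rule bilinear_expand, rule assms(3)) (use assms(6) in auto)
  also have "\<dots> = (\<Sum>i\<in>Basis. \<Sum>j\<in>Basis. dirderiv v (\<lambda>x. ((a x \<bullet> i) * (b x \<bullet> j)) *\<^sub>R B (y x) i j) x)"
    by (subst dirderiv_sum[where S = S], (intro smooth_on_sum sm finite_Basis)+)
      (intro sum.cong refl dirderiv_sum[where S = S] sm)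
  also have "\<dots> = (\<Sum>i\<in>Basis. \<Sum>j\<in>Basis.
      ((a x \<bullet> i) * (b x \<bullet> j)) *\<^sub>R dirderiv (dirderiv v y x) (\<lambda>p. B p i j) (y x)
      + ((dirderiv v a x \<bullet> i) * (b x \<bullet> j)) *\<^sub>R B (y x) i j
      + ((a x \<bullet> i) * (dirderiv v b x \<bullet> j)) *\<^sub>R B (y x) i j)"
  proof (intro sum.cong refl)
    fix i j
    have "dirderiv v (\<lambda>x. (a x \<bullet> i) * (b x \<bullet> j)) x
        = (a x \<bullet> i) * (dirderiv v b x \<bullet> j) + (dirderiv v a x \<bullet> i) * (b x \<bullet> j)"
      by (subst dirderiv_mult[where S = S]; (intro sm)?)
        (simp add: dirderiv_linear[OF bounded_linear_inner_left assms(7,9)]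
          dirderiv_linear[OF bounded_linear_inner_left assms(8,9)])
    moreover have "dirderiv v (\<lambda>x. B (y x) i j) x = dirderiv (dirderiv v y x) (\<lambda>p. B p i j) (y x)"
      by (rule dirderiv_compose[OF assms(4) yx assms(5,9)])
    ultimately show "dirderiv v (\<lambda>x. ((a x \<bullet> i) * (b x \<bullet> j)) *\<^sub>R B (y x) i j) x =
      ((a x \<bullet> i) * (b x \<bullet> j)) *\<^sub>R dirderiv (dirderiv v y x) (\<lambda>p. B p i j) (y x)
      + ((dirderiv v a x \<bullet> i) * (b x \<bullet> j)) *\<^sub>R B (y x) i j
      + ((a x \<bullet> i) * (dirderiv v b x \<bullet> j)) *\<^sub>R B (y x) i j"
      by (subst dirderiv_scaleR[where S = S]; (intro sm)?) (simp add: algebra_simps)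
  qed
  also have "\<dots> = (\<Sum>i\<in>Basis. \<Sum>j\<in>Basis.
      ((a x \<bullet> i) * (b x \<bullet> j)) *\<^sub>R dirderiv (dirderiv v y x) (\<lambda>p. B p i j) (y x))
      + B (y x) (dirderiv v a x) (b x) + B (y x) (a x) (dirderiv v b x)"
    by (simp add: sum.distrib bilinear_expand[OF assms(3)[OF yx], of "dirderiv v a x"]
       bilinear_expand[OF assms(3)[OF yx], of "a x"])
  also have "(\<Sum>i\<in>Basis. \<Sum>j\<in>Basis.
      ((a x \<bullet> i) * (b x \<bullet> j)) *\<^sub>R dirderiv (dirderiv v y x) (\<lambda>p. B p i j) (y x))
      = dirderiv (dirderiv v y x) (\<lambda>p. B p (a x) (b x)) (y x)"
  proof -
    have "dirderiv (dirderiv v y x) (\<lambda>p. B p (a x) (b x)) (y x) =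
       dirderiv (dirderiv v y x) (\<lambda>p. \<Sum>i\<in>Basis. \<Sum>j\<in>Basis. ((a x \<bullet> i) * (b x \<bullet> j)) *\<^sub>R B p i j) (y x)"
      by (rule dirderiv_cong_open[OF assms(2) yx]) (rule bilinear_expand[OF assms(3)])
    also have "\<dots> = (\<Sum>i\<in>Basis. \<Sum>j\<in>Basis.
      ((a x \<bullet> i) * (b x \<bullet> j)) *\<^sub>R dirderiv (dirderiv v y x) (\<lambda>p. B p i j) (y x))"
      by (intro trans[OF dirderiv_sum[where S = T]] sum.cong refl yx smooth_on_sum assms(2,4)
           dirderiv_linear[OF bounded_linear_scaleR_right assms(4)]
           smooth_on_linear[OF _ bounded_linear_scaleR_right]) simp_all
    finally show ?thesis by simp
  qed
  finally show ?thesis .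
qed

text \<open>The same for a field of linear maps, with the real numbers as a dummy second argument.\<close>

lemma
  fixes L :: "'y::euclidean_space \<Rightarrow> 'e::euclidean_space \<Rightarrow> 'c::real_normed_vector"
    and y :: "'x::real_normed_vector \<Rightarrow> 'y"
  assumes "open S" "open T" "\<And>p. p \<in> T \<Longrightarrow> linear (L p)" "\<And>v. smooth_on T (\<lambda>p. L p v)"
    "smooth_on S y" "y ` S \<subseteq> T" "smooth_on S a"
  shows smooth_on_linear_field: "smooth_on S (\<lambda>x. L (y x) (a x))"
    and dirderiv_linear_field: "x \<in> S \<Longrightarrow> dirderiv v (\<lambda>x. L (y x) (a x)) x =
      dirderiv (dirderiv v y x) (\<lambda>p. L p (a x)) (y x) + L (y x) (dirderiv v a x)"
proof -
  let ?B = "\<lambda>p v (r::real). r *\<^sub>R L p v"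
  have bil: "bilinear (?B p)" if "p \<in> T" for p
    using assms(3)[OF that]
    by (auto simp: bilinear_def linear_iff algebra_simps)
  have sm: "smooth_on T (\<lambda>p. ?B p v r)" for v r
    by (intro smooth_on_linear[OF assms(2) bounded_linear_scaleR_right] assms)
  show "smooth_on S (\<lambda>x. L (y x) (a x))"
    using smooth_on_bilinear_field[OF assms(1,2) bil sm assms(5,6,7) smooth_on_const[of S 1]] by simp
  show "x \<in> S \<Longrightarrow> dirderiv v (\<lambda>x. L (y x) (a x)) x =
      dirderiv (dirderiv v y x) (\<lambda>p. L p (a x)) (y x) + L (y x) (dirderiv v a x)"
    using dirderiv_bilinear_field[OF assms(1,2) bil sm assms(5,6,7) smooth_on_const[of S 1], of x v]
    by (simp add: dirderiv_const)
qed

section \<open>The Levi-Civita connection of a metric on an open set\<close>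

text \<open>The characterisation of the Levi-Civita connection by symmetry and compatibility with the metric,
  for a metric given in coordinates.\<close>

definition christoffel :: "(real ^ 'n::finite \<Rightarrow> real ^ 'n \<Rightarrow> real ^ 'n \<Rightarrow> real) \<Rightarrow> real ^ 'n \<Rightarrow>
    real ^ 'n \<Rightarrow> real ^ 'n \<Rightarrow> real ^ 'n" where
  "christoffel H y = (THE \<Gamma>. (\<forall>v w. \<Gamma> v w = \<Gamma> w v) \<and>
     (\<forall>v w z. dirderiv v (\<lambda>y. H y w z) y = H y (\<Gamma> v w) z + H y w (\<Gamma> v z)))"

text \<open>The derivative in direction \<open>v\<close> of a vector field \<open>a\<close> along the map \<open>y\<close>. The domain of \<open>y\<close> may
  contain coordinates of a manifold and parameters of a variation.\<close>

definition covariant :: "(real ^ 'n::finite \<Rightarrow> real ^ 'n \<Rightarrow> real ^ 'n \<Rightarrow> real) \<Rightarrow>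
    ('x::real_normed_vector \<Rightarrow> real ^ 'n) \<Rightarrow> 'x \<Rightarrow> ('x \<Rightarrow> real ^ 'n) \<Rightarrow> 'x \<Rightarrow> real ^ 'n" where
  "covariant H y v a x = dirderiv v a x + christoffel H (y x) (dirderiv v y x) (a x)"

text \<open>The curvature tensor, evaluated on constant vector fields; their brackets vanish.\<close>

definition riemann :: "(real ^ 'n::finite \<Rightarrow> real ^ 'n \<Rightarrow> real ^ 'n \<Rightarrow> real) \<Rightarrow> real ^ 'n \<Rightarrow>
    real ^ 'n \<Rightarrow> real ^ 'n \<Rightarrow> real ^ 'n \<Rightarrow> real ^ 'n" where
  "riemann H y v w z = dirderiv v (\<lambda>p. christoffel H p w z) y - dirderiv w (\<lambda>p. christoffel H p v z) y
     + christoffel H y v (christoffel H y w z) - christoffel H y w (christoffel H y v z)"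

lemma linear_axis_expand:
  fixes f :: "real ^ 'n \<Rightarrow> 'c::real_vector"
  assumes "linear f"
  shows "f z = (\<Sum>i\<in>UNIV. z $ i *\<^sub>R f (axis i 1))"
proof -
  have "z = (\<Sum>i\<in>UNIV. z $ i *\<^sub>R axis i 1)"
    using basis_expansion[of z] by (simp add: scalar_mult_eq_scaleR)
  then have "f z = f (\<Sum>i\<in>UNIV. z $ i *\<^sub>R axis i 1)" by simp
  then show ?thesis by (simp only: linear_sum[OF assms] linear_scale[OF assms])
qed

locale riemannian_domain =
  fixes Y :: "(real ^ 'n::finite) set" and H :: "real ^ 'n \<Rightarrow> real ^ 'n \<Rightarrow> real ^ 'n \<Rightarrow> real"
  assumes open_domain: "open Y"
    and metric_bilinear: "y \<in> Y \<Longrightarrow> bilinear (H y)"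
    and metric_sym: "y \<in> Y \<Longrightarrow> H y v w = H y w v"
    and metric_pos: "y \<in> Y \<Longrightarrow> v \<noteq> 0 \<Longrightarrow> H y v v > 0"
    and metric_smooth: "smooth_on Y (\<lambda>y. H y v w)"
begin

lemmas metric_simps = bilinear_ladd[OF metric_bilinear] bilinear_radd[OF metric_bilinear]
  bilinear_lmul[OF metric_bilinear] bilinear_rmul[OF metric_bilinear]
  bilinear_lsub[OF metric_bilinear] bilinear_rsub[OF metric_bilinear]
  bilinear_lzero[OF metric_bilinear] bilinear_rzero[OF metric_bilinear]

lemma metric_linear: "y \<in> Y \<Longrightarrow> linear (H y v)" "y \<in> Y \<Longrightarrow> linear (\<lambda>v. H y v w)"
  using metric_bilinear by (auto simp: bilinear_def)

lemma metric_eqI: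
  assumes "y \<in> Y" "\<And>z. H y v z = H y w z"
  shows "v = w"
proof (rule ccontr)
  assume "v \<noteq> w"
  then have "H y (v - w) (v - w) > 0" using metric_pos assms by simp
  then show False using assms(2)[of "v - w"] by (simp add: metric_simps[OF assms(1)])
qed

definition koszul :: "real ^ 'n \<Rightarrow> real ^ 'n \<Rightarrow> real ^ 'n \<Rightarrow> real ^ 'n \<Rightarrow> real" where
  "koszul y v w z = (dirderiv v (\<lambda>y. H y w z) y + dirderiv w (\<lambda>y. H y v z) y
     - dirderiv z (\<lambda>y. H y v w) y) / 2"

definition gram :: "real ^ 'n \<Rightarrow> real ^ 'n ^ 'n" where
  "gram y = (\<chi> i j. H y (axis i 1) (axis j 1))"

lemma gram_mult: "y \<in> Y \<Longrightarrow> (gram y *v v) $ i = H y (axis i 1) v"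
  using linear_axis_expand[OF metric_linear(1), of y "axis i 1" v]
  by (simp add: gram_def matrix_vector_mult_def mult.commute)

lemma det_gram_nonzero: "y \<in> Y \<Longrightarrow> det (gram y) \<noteq> 0"
proof -
  assume y: "y \<in> Y"
  have "v = 0" if "gram y *v v = 0" for v
  proof (rule metric_eqI[OF y])
    fix z
    have "H y v z = (\<Sum>i\<in>UNIV. z $ i * H y v (axis i 1))"
      using linear_axis_expand[OF metric_linear(1)[OF y], of v z] by simp
    also have "\<dots> = 0"
      using that gram_mult[OF y, of v] by (simp add: metric_sym[OF y, of v])
    finally show "H y v z = H y 0 z" by (simp add: metric_simps[OF y])
  qed
  then have "invertible (gram y)"
    by (simp add: invertible_left_inverse matrix_left_invertible_ker)
  then show ?thesis by (simp add: invertible_det_nz)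
qed

lemma dirderiv_metric_bilinear:
  assumes "y \<in> Y"
  shows "bilinear (\<lambda>w z. dirderiv v (\<lambda>y. H y w z) y)"
proof -
  have add: "dirderiv v (\<lambda>y. H y (w + w') z) y = dirderiv v (\<lambda>y. H y w z) y + dirderiv v (\<lambda>y. H y w' z) y" for w w' z
    by (rule trans[OF dirderiv_cong_open[OF open_domain assms metric_simps(1)]
          dirderiv_add[OF metric_smooth metric_smooth assms]])
  have scale: "dirderiv v (\<lambda>y. H y (c *\<^sub>R w) z) y = c *\<^sub>R dirderiv v (\<lambda>y. H y w z) y" for w c z
    by (rule trans[OF dirderiv_cong_open[OF open_domain assms metric_simps(3)]
          dirderiv_linear[OF bounded_linear_scaleR_right metric_smooth assms]])
  have sym: "dirderiv v (\<lambda>y. H y w z) y = dirderiv v (\<lambda>y. H y z w) y" for w z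
    by (rule dirderiv_cong_open[OF open_domain assms metric_sym])
  show ?thesis
    unfolding bilinear_def
  proof (intro conjI allI)
    show lin: "linear (\<lambda>w. dirderiv v (\<lambda>y. H y w z) y)" for z
      by (intro linearI add scale)
    show "linear (\<lambda>z. dirderiv v (\<lambda>y. H y w z) y)" for w
      using lin[of w] by (simp only: sym[of _ w])
  qed
qed

lemma koszul_linear:
  assumes "y \<in> Y"
  shows "linear (koszul y v w)" "linear (\<lambda>w. koszul y v w z)" "koszul y v w z = koszul y w v z"
proof -
  note 1 = smooth_on_linear_dirderiv[OF metric_smooth assms]
  note 2 = dirderiv_metric_bilinear[OF assms]
  note l = linear_add[OF 1] linear_scale[OF 1] bilinear_ladd[OF 2] bilinear_radd[OF 2]
    bilinear_lmul[OF 2] bilinear_rmul[OF 2]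
  show "linear (koszul y v w)" "linear (\<lambda>w. koszul y v w z)"
    unfolding koszul_def by (intro linearI; simp add: l algebra_simps add_divide_distrib diff_divide_distrib)+
  have "dirderiv z (\<lambda>y. H y v w) y = dirderiv z (\<lambda>y. H y w v) y"
    by (rule dirderiv_cong_open[OF open_domain assms metric_sym])
  then show "koszul y v w z = koszul y w v z"
    by (simp add: koszul_def)
qed

text \<open>Add the compatibility equations for two of the three cyclic arrangements of \<open>v\<close>, \<open>w\<close>, \<open>z\<close> and
  subtract the third: by symmetry all products cancel except twice the one in question.\<close>

lemma koszul_unique:
  assumes "y \<in> Y" "\<And>v w. \<Gamma> v w = \<Gamma> w v"
    "\<And>v w z. dirderiv v (\<lambda>y. H y w z) y = H y (\<Gamma> v w) z + H y w (\<Gamma> v z)"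
  shows "H y (\<Gamma> v w) z = koszul y v w z"
proof -
  have "H y (\<Gamma> w v) z = H y (\<Gamma> v w) z" "H y (\<Gamma> z v) w = H y w (\<Gamma> v z)" "H y v (\<Gamma> z w) = H y v (\<Gamma> w z)"
    using assms(2) metric_sym[OF assms(1)] by metis+
  then have "dirderiv v (\<lambda>y. H y w z) y + dirderiv w (\<lambda>y. H y v z) y - dirderiv z (\<lambda>y. H y v w) y
      = 2 * H y (\<Gamma> v w) z"
    using assms(3)[of v w z] assms(3)[of w v z] assms(3)[of z v w] by linarith
  then show ?thesis by (simp add: koszul_def)
qed

lemma koszul_solution_exists:
  assumes "y \<in> Y"
  shows "\<exists>\<Gamma>. (\<forall>v w z. H y (\<Gamma> v w) z = koszul y v w z)"
proof -
  have "\<exists>x. \<forall>z. H y x z = koszul y v w z" for v w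
  proof -
    obtain x where x: "gram y *v x = (\<chi> i. koszul y v w (axis i 1))"
      using cramer[OF det_gram_nonzero[OF assms]] by blast
    have "H y x z = koszul y v w z" for z
    proof -
      note * = linear_axis_expand[where 'c = real, of _ z]
      show ?thesis
        using gram_mult[OF assms, of x] *[OF metric_linear(1)[OF assms]] *[OF koszul_linear(1)[OF assms]]
        by (simp add: x metric_sym[OF assms, of "axis _ _" x, symmetric])
    qed
    then show ?thesis by blast
  qed
  then have "\<forall>z. H y (SOME x. \<forall>z. H y x z = koszul y v w z) z = koszul y v w z" for v w
    by (rule someI_ex)
  then show ?thesis
    by (intro exI[of _ "\<lambda>v w. SOME x. \<forall>z. H y x z = koszul y v w z"]) blast
qed

lemma
  assumes "y \<in> Y"
  shows christoffel_koszul: "H y (christoffel H y v w) z = koszul y v w z"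
    and christoffel_sym: "christoffel H y v w = christoffel H y w v"
    and christoffel_metric: "dirderiv v (\<lambda>y. H y w z) y = H y (christoffel H y v w) z + H y w (christoffel H y v z)"
proof -
  let ?P = "\<lambda>\<Gamma>. (\<forall>v w. \<Gamma> v w = \<Gamma> w v) \<and>
     (\<forall>v w z. dirderiv v (\<lambda>y. H y w z) y = H y (\<Gamma> v w) z + H y w (\<Gamma> v z))"
  obtain \<Gamma> where \<Gamma>: "\<And>v w z. H y (\<Gamma> v w) z = koszul y v w z"
    using koszul_solution_exists[OF assms] by blast
  have sym: "\<Gamma> v w = \<Gamma> w v" for v w
    by (rule metric_eqI[OF assms]) (simp only: \<Gamma> koszul_linear(3)[OF assms, of v w])
  have comp: "dirderiv v (\<lambda>y. H y w z) y = H y (\<Gamma> v w) z + H y w (\<Gamma> v z)" for v w z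
  proof -
    have *: "dirderiv v (\<lambda>y. H y w z) y = dirderiv v (\<lambda>y. H y z w) y" for v w z
      by (rule dirderiv_cong_open[OF open_domain assms metric_sym])
    have "2 * koszul y v w z + 2 * koszul y v z w = 2 * dirderiv v (\<lambda>y. H y w z) y"
      unfolding koszul_def *[of v z w] *[of z w v] *[of w z v] by (simp add: field_simps)
    then show ?thesis
      unfolding metric_sym[OF assms, of w "\<Gamma> v z"] \<Gamma> by linarith
  qed
  have "?P \<Gamma>" by (intro conjI allI sym comp)
  moreover have "\<Gamma>' = \<Gamma>" if "?P \<Gamma>'" for \<Gamma>'
  proof (intro ext)
    fix v w
    show "\<Gamma>' v w = \<Gamma> v w"
      by (rule metric_eqI[OF assms]) (use that koszul_unique[OF assms, of \<Gamma>'] \<Gamma> in auto)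
  qed
  ultimately have eq: "christoffel H y = \<Gamma>"
    unfolding christoffel_def by (intro the_equality) blast+
  show "H y (christoffel H y v w) z = koszul y v w z"
    "christoffel H y v w = christoffel H y w v"
    "dirderiv v (\<lambda>y. H y w z) y = H y (christoffel H y v w) z + H y w (christoffel H y v z)"
    unfolding eq by (rule \<Gamma> sym comp)+
qed

lemma christoffel_bilinear:
  assumes "y \<in> Y"
  shows "bilinear (christoffel H y)"
proof -
  have "linear (christoffel H y v)" for v
    by (intro linearI metric_eqI[OF assms])
      (simp_all add: metric_simps[OF assms] christoffel_koszul[OF assms]
        linear_add[OF koszul_linear(2)[OF assms]] linear_scale[OF koszul_linear(2)[OF assms]])
  moreover have "(\<lambda>v. christoffel H y v w) = christoffel H y w" for w
    using christoffel_sym[OF assms] by auto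
  ultimately show ?thesis by (simp add: bilinear_def)
qed

lemmas christoffel_simps = bilinear_ladd[OF christoffel_bilinear] bilinear_radd[OF christoffel_bilinear]
  bilinear_lmul[OF christoffel_bilinear] bilinear_rmul[OF christoffel_bilinear]

lemma gram_smooth: "smooth_on Y (\<lambda>y. gram y $ i $ j)"
  by (simp add: gram_def metric_smooth)

lemma christoffel_smooth: "smooth_on Y (\<lambda>y. christoffel H y v w)"
proof (rule smooth_on_solve[OF open_domain gram_smooth _ det_gram_nonzero])
  have "smooth_on Y (\<lambda>y. koszul y v w z)" for z
    unfolding koszul_def divide_inverse
    by (rule smooth_on_mult[OF open_domain smooth_on_diff[OF open_domain smooth_on_add[OF open_domain]] smooth_on_const];
        rule smooth_on_dirderiv[OF metric_smooth])
  then show "smooth_on Y (\<lambda>y. (\<chi> i. koszul y v w (axis i 1)) $ i)" for i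
    by simp
  show "gram y *v christoffel H y v w = (\<chi> i. koszul y v w (axis i 1))" if "y \<in> Y" for y
    unfolding vec_eq_iff gram_mult[OF that] metric_sym[OF that, of "axis _ _"] christoffel_koszul[OF that]
    by simp
qed

lemma metric_field_smooth:
  "open S \<Longrightarrow> smooth_on S y \<Longrightarrow> y ` S \<subseteq> Y \<Longrightarrow> smooth_on S a \<Longrightarrow> smooth_on S b \<Longrightarrow>
    smooth_on S (\<lambda>x. H (y x) (a x) (b x))"
  by (rule smooth_on_bilinear_field[OF _ open_domain metric_bilinear metric_smooth])

lemma christoffel_field_smooth:
  "open S \<Longrightarrow> smooth_on S y \<Longrightarrow> y ` S \<subseteq> Y \<Longrightarrow> smooth_on S a \<Longrightarrow> smooth_on S b \<Longrightarrow>
    smooth_on S (\<lambda>x. christoffel H (y x) (a x) (b x))"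
  by (rule smooth_on_bilinear_field[OF _ open_domain christoffel_bilinear christoffel_smooth])

subsection \<open>Covariant derivatives along a map\<close>

context
  fixes X :: "'x::real_normed_vector set" and y :: "'x \<Rightarrow> real ^ 'n"
  assumes X: "open X" and y: "smooth_on X y" "y ` X \<subseteq> Y"
begin

lemma covariant_smooth: "smooth_on X a \<Longrightarrow> smooth_on X (covariant H y v a)"
  unfolding covariant_def[abs_def]
  by (intro smooth_on_add X smooth_on_dirderiv christoffel_field_smooth y)

lemma covariant_add:
  assumes "smooth_on X a" "smooth_on X b" "x \<in> X"
  shows "covariant H y v (\<lambda>x. a x + b x) x = covariant H y v a x + covariant H y v b x"
proof -
  have "y x \<in> Y" using assms y by auto
  then show ?thesis
    by (simp add: covariant_def dirderiv_add[OF assms] christoffel_simps)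
qed

text \<open>The derivative of the metric at the base point is expressed by Christoffel symbols, which turn the
  derivatives of the two fields into covariant ones.\<close>

lemma covariant_metric:
  assumes "smooth_on X a" "smooth_on X b" "x \<in> X"
  shows "dirderiv v (\<lambda>x. H (y x) (a x) (b x)) x =
    H (y x) (covariant H y v a x) (b x) + H (y x) (a x) (covariant H y v b x)"
proof -
  have yx: "y x \<in> Y" using assms y by auto
  show ?thesis
    by (simp add: dirderiv_bilinear_field[OF X open_domain metric_bilinear metric_smooth y assms]
        christoffel_metric[OF yx] covariant_def metric_simps[OF yx])
qed

text \<open>This is the absence of torsion: second derivatives of \<open>y\<close> commute, and the Christoffel symbols are
  symmetric.\<close>

lemma covariant_commute:
  assumes "x \<in> X"
  shows "covariant H y v (dirderiv w y) x = covariant H y w (dirderiv v y) x"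
proof -
  have yx: "y x \<in> Y" using assms y by auto
  show ?thesis
    by (simp add: covariant_def dirderiv_commute[OF X y(1) assms, of v w]
        christoffel_sym[OF yx, of "dirderiv v y x"])
qed

text \<open>Expanding the left hand side, all terms that contain derivatives of \<open>a\<close> or second derivatives of \<open>y\<close>
  are symmetric in \<open>v\<close> and \<open>w\<close>.\<close>

lemma covariant_curvature:
  assumes "smooth_on X a" "x \<in> X"
  shows "covariant H y v (covariant H y w a) x - covariant H y w (covariant H y v a) x
    = riemann H (y x) (dirderiv v y x) (dirderiv w y x) (a x)"
proof -
  have yx: "y x \<in> Y" using assms y by auto
  let ?G = "christoffel H (y x)"
  have *: "covariant H y v (covariant H y w a) x =
      dirderiv v (dirderiv w a) x
      + dirderiv (dirderiv v y x) (\<lambda>p. christoffel H p (dirderiv w y x) (a x)) (y x)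
      + ?G (dirderiv v (dirderiv w y) x) (a x) + ?G (dirderiv w y x) (dirderiv v a x)
      + ?G (dirderiv v y x) (dirderiv w a x) + ?G (dirderiv v y x) (?G (dirderiv w y x) (a x))" for v w
  proof -
    have "dirderiv v (covariant H y w a) x = dirderiv v (dirderiv w a) x +
       dirderiv v (\<lambda>x. christoffel H (y x) (dirderiv w y x) (a x)) x"
      unfolding covariant_def[abs_def]
      by (rule dirderiv_add[OF _ _ assms(2)])
       (intro smooth_on_dirderiv christoffel_field_smooth X y assms)+
    also have "dirderiv v (\<lambda>x. christoffel H (y x) (dirderiv w y x) (a x)) x
      = dirderiv (dirderiv v y x) (\<lambda>p. christoffel H p (dirderiv w y x) (a x)) (y x)
      + ?G (dirderiv v (dirderiv w y) x) (a x) + ?G (dirderiv w y x) (dirderiv v a x)"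
      by (rule dirderiv_bilinear_field[OF X open_domain christoffel_bilinear christoffel_smooth y
         smooth_on_dirderiv[OF y(1)] assms])
    finally show ?thesis
      by (simp add: covariant_def[of H y v "covariant H y w a"])
        (simp add: covariant_def christoffel_simps[OF yx])
  qed
  show ?thesis
    unfolding * riemann_def
    by (simp add: dirderiv_commute[OF X assms(1,2), of v w] dirderiv_commute[OF X y(1) assms(2), of v w])
qed

end

end

subsection \<open>Change of coordinates\<close>

locale isometric_transition =
  dom: riemannian_domain Y H + cod: riemannian_domain Y' H'
  for Y :: "(real ^ 'n::finite) set" and H and Y' :: "(real ^ 'n) set" and H' +
  fixes \<psi> :: "real ^ 'n \<Rightarrow> real ^ 'n"
  assumes trans_smooth: "smooth_on Y \<psi>" and trans_into: "\<psi> ` Y \<subseteq> Y'"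
    and trans_surj: "y \<in> Y \<Longrightarrow> surj (\<lambda>v. dirderiv v \<psi> y)"
    and trans_isometric: "y \<in> Y \<Longrightarrow> H y v w = H' (\<psi> y) (dirderiv v \<psi> y) (dirderiv w \<psi> y)"
begin

text \<open>The covariant derivative of \<open>D\<^sub>b \<psi>\<close> in direction \<open>a\<close> along \<open>\<psi>\<close> is symmetric in \<open>a\<close> and \<open>b\<close>
  and obeys the product rule for the pulled back metric, which is \<open>H\<close>. Hence its products with the
  vectors \<open>D\<^sub>z \<psi>\<close> are given by the Koszul formula of \<open>H\<close>, and these vectors span.\<close>

lemma christoffel_transition:
  assumes "y \<in> Y"
  shows "covariant H' \<psi> a (dirderiv b \<psi>) y = dirderiv (christoffel H y a b) \<psi> y"
proof -
  note ctx = dom.open_domain trans_smooth trans_into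
  have y': "\<psi> y \<in> Y'" using assms trans_into by auto
  let ?S = "\<lambda>a b. covariant H' \<psi> a (dirderiv b \<psi>) y" and ?H = "H' (\<psi> y)"
  have sym: "?S a b = ?S b a" for a b
    by (rule cod.covariant_commute[OF ctx assms])
  have der: "dirderiv a (\<lambda>y. H y b z) y = H' (\<psi> y) (?S a b) (dirderiv z \<psi> y) + H' (\<psi> y) (dirderiv b \<psi> y) (?S a z)" for a b z
    using cod.covariant_metric[OF ctx smooth_on_dirderiv[OF trans_smooth] smooth_on_dirderiv[OF trans_smooth] assms, of a b z]
      trans[OF dirderiv_cong_open[OF dom.open_domain assms, of "\<lambda>y. H y b z"
        "\<lambda>y. H' (\<psi> y) (dirderiv b \<psi> y) (dirderiv z \<psi> y)"]] trans_isometric by blast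
  have "H' (\<psi> y) (?S a b) (dirderiv z \<psi> y) = dom.koszul y a b z" for a b z
  proof -
    have "?H (?S b a) (dirderiv z \<psi> y) = ?H (?S a b) (dirderiv z \<psi> y)"
      "?H (?S z a) (dirderiv b \<psi> y) = ?H (dirderiv b \<psi> y) (?S a z)"
      "?H (dirderiv a \<psi> y) (?S z b) = ?H (dirderiv a \<psi> y) (?S b z)"
      by (simp_all only: sym[of b a] sym[of z a] sym[of z b] cod.metric_sym[OF y', of "?S a z"])
    then have "dirderiv a (\<lambda>y. H y b z) y + dirderiv b (\<lambda>y. H y a z) y - dirderiv z (\<lambda>y. H y a b) y
        = 2 * ?H (?S a b) (dirderiv z \<psi> y)"
      using der[of a b z] der[of b a z] der[of z a b] by linarith
    then show ?thesis by (simp add: dom.koszul_def)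
  qed
  also have "dom.koszul y a b z = H' (\<psi> y) (dirderiv (christoffel H y a b) \<psi> y) (dirderiv z \<psi> y)" for a b z
    using dom.christoffel_koszul[OF assms, of a b z] trans_isometric[OF assms, of "christoffel H y a b" z] by simp
  finally have eq: "H' (\<psi> y) (?S a b) (dirderiv z \<psi> y)
    = H' (\<psi> y) (dirderiv (christoffel H y a b) \<psi> y) (dirderiv z \<psi> y)" for a b z .
  show ?thesis
  proof (rule cod.metric_eqI[OF y'])
    fix z'
    obtain z where "z' = dirderiv z \<psi> y" using surjD[OF trans_surj[OF assms]] by blast
    with eq show "H' (\<psi> y) (?S a b) z' = H' (\<psi> y) (dirderiv (christoffel H y a b) \<psi> y) z'" by simp
  qed
qed

lemma covariant_transition:
  assumes "open X" "smooth_on X y" "y ` X \<subseteq> Y" "smooth_on X a" "x \<in> X"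
  shows "covariant H' (\<lambda>x. \<psi> (y x)) v (\<lambda>x. dirderiv (a x) \<psi> (y x)) x = dirderiv (covariant H y v a x) \<psi> (y x)"
proof -
  have yx: "y x \<in> Y" using assms by auto
  note lin = smooth_on_linear_dirderiv[OF trans_smooth]
  have "dirderiv v (\<lambda>x. dirderiv (a x) \<psi> (y x)) x =
     dirderiv (dirderiv v y x) (dirderiv (a x) \<psi>) (y x) + dirderiv (dirderiv v a x) \<psi> (y x)"
    using dirderiv_linear_field[OF assms(1) dom.open_domain lin smooth_on_dirderiv[OF trans_smooth] assms(2,3,4,5), of v] .
  moreover have "dirderiv v (\<lambda>x. \<psi> (y x)) x = dirderiv (dirderiv v y x) \<psi> (y x)"
    by (rule dirderiv_compose[OF trans_smooth yx assms(2,5)])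
  ultimately show ?thesis
    using christoffel_transition[OF yx, of "dirderiv v y x" "a x"]
    by (simp add: covariant_def linear_add[OF lin[OF yx]] algebra_simps)
qed

end

section \<open>Variations of the energy density in coordinates\<close>

lemma sum3_rotate:
  "(\<Sum>i\<in>A. \<Sum>j\<in>A. \<Sum>k\<in>A. g i j k) = (\<Sum>i\<in>A. \<Sum>j\<in>A. \<Sum>k\<in>A. g j k i)"
proof -
  have "(\<Sum>i\<in>A. \<Sum>j\<in>A. \<Sum>k\<in>A. g i j k) = (\<Sum>i\<in>A. \<Sum>k\<in>A. \<Sum>j\<in>A. g i j k)"
    by (intro sum.cong refl sum.swap)
  also have "\<dots> = (\<Sum>k\<in>A. \<Sum>i\<in>A. \<Sum>j\<in>A. g i j k)"
    by (rule sum.swap)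
  finally show ?thesis .
qed

lemma dirderiv_sum3_mult:
  fixes p q r :: "'i \<Rightarrow> 'j \<Rightarrow> 'k \<Rightarrow> 'a::real_normed_vector \<Rightarrow> real"
  assumes "open S" "x \<in> S" "\<And>i j k. smooth_on S (p i j k)" "\<And>i j k. smooth_on S (q i j k)"
    "\<And>i j k. smooth_on S (r i j k)" "finite I" "finite J" "finite K"
  shows "dirderiv v (\<lambda>x. \<Sum>i\<in>I. \<Sum>j\<in>J. \<Sum>k\<in>K. p i j k x * q i j k x * r i j k x) x =
    (\<Sum>i\<in>I. \<Sum>j\<in>J. \<Sum>k\<in>K. dirderiv v (p i j k) x * q i j k x * r i j k x
      + p i j k x * dirderiv v (q i j k) x * r i j k x + p i j k x * q i j k x * dirderiv v (r i j k) x)"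
proof -
  note sm = smooth_on_sum[OF assms(1)] smooth_on_mult[OF assms(1)] assms
  have 1: "dirderiv v (\<lambda>x. p i j k x * q i j k x * r i j k x) x =
      dirderiv v (p i j k) x * q i j k x * r i j k x
      + p i j k x * dirderiv v (q i j k) x * r i j k x + p i j k x * q i j k x * dirderiv v (r i j k) x" for i j k
    using dirderiv_mult[OF smooth_on_mult[OF assms(1) assms(3,4)] assms(5,2), of v i j k i j k i j k]
      dirderiv_mult[OF assms(3,4,2), of v i j k i j k] by (simp add: algebra_simps)
  show ?thesis
    unfolding 1[symmetric]
    by (intro trans[OF dirderiv_sum[where S = S]] sum.cong refl sm)
qed

context riemannian_domain
begin

context
  fixes X :: "'x::real_normed_vector set" and y :: "'x \<Rightarrow> real ^ 'n" and f :: "'i::finite \<Rightarrow> 'x"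
  assumes X: "open X" and y: "smooth_on X y" "y ` X \<subseteq> Y"
begin

private abbreviation "P i j x \<equiv> H (y x) (dirderiv (f i) y x) (dirderiv (f j) y x)"
private abbreviation "A v i k x \<equiv> H (y x) (covariant H y (f i) (dirderiv v y) x) (dirderiv (f k) y x)"

private lemma smooths: "smooth_on X (P i j)" "smooth_on X (A v i j)"
  by (rule metric_field_smooth[OF X y]; rule covariant_smooth[OF X y] smooth_on_dirderiv;
      (rule smooth_on_dirderiv)?; rule y)+

private lemma inY: "x \<in> X \<Longrightarrow> y x \<in> Y"
  using y by auto

private lemma dirderiv_pullback: "x \<in> X \<Longrightarrow> dirderiv v (P i j) x = A v i j x + A v j i x"
  by (subst covariant_metric[OF X y]; (intro smooth_on_dirderiv y)?)
    (simp_all add: covariant_commute[OF X y, of _ v] metric_sym[OF inY])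

text \<open>The three factors contribute the same amount because the sum is cyclic, and each of them twice
  because \<open>P\<close> is symmetric; the resulting factor 6 cancels the one in the definition of the energy.\<close>

lemma first_variation_density:
  assumes "x \<in> X"
  shows "dirderiv v (\<lambda>x. \<Sum>i\<in>UNIV. \<Sum>j\<in>UNIV. \<Sum>k\<in>UNIV. P i j x * P j k x * P k i x) x
    = 6 * (\<Sum>i\<in>UNIV. \<Sum>j\<in>UNIV. \<Sum>k\<in>UNIV. A v i k x * P k j x * P i j x)"
proof -
  have sym: "P i j x = P j i x" for i j by (rule metric_sym[OF inY[OF assms]])
  define p where "p i j = P i j x" for i j
  define a where "a i j = A v i j x" for i j
  have ps: "p i j = p j i" for i j using sym by (simp add: p_def)
  let ?S = "\<lambda>g. \<Sum>i\<in>UNIV. \<Sum>j\<in>UNIV. \<Sum>k\<in>UNIV. (g i j k :: real)"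
  have "dirderiv v (\<lambda>x. ?S (\<lambda>i j k. P i j x * P j k x * P k i x)) x
    = ?S (\<lambda>i j k. (a i j + a j i) * p j k * p k i + p i j * (a j k + a k j) * p k i + p i j * p j k * (a k i + a i k))"
    using dirderiv_sum3_mult[OF X assms, of "\<lambda>i j k. P i j" "\<lambda>i j k. P j k" "\<lambda>i j k. P k i" UNIV UNIV UNIV v]
    by (simp add: smooths dirderiv_pullback[OF assms] p_def a_def)
  also have "\<dots> = ?S (\<lambda>i j k. a i j * p j k * p k i) + ?S (\<lambda>i j k. a j i * p j k * p k i)
      + (?S (\<lambda>i j k. p i j * a j k * p k i) + ?S (\<lambda>i j k. p i j * a k j * p k i))
      + (?S (\<lambda>i j k. p i j * p j k * a k i) + ?S (\<lambda>i j k. p i j * p j k * a i k))"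
    by (simp add: sum.distrib algebra_simps)
  also have "?S (\<lambda>i j k. p i j * a j k * p k i) = ?S (\<lambda>i j k. a i j * p j k * p k i)"
    by (subst (2) sum3_rotate) (simp add: mult_ac)
  also have "?S (\<lambda>i j k. p i j * p j k * a k i) = ?S (\<lambda>i j k. p i j * a j k * p k i)"
    by (subst (2) sum3_rotate) (simp add: mult_ac)
  also have "?S (\<lambda>i j k. p i j * a j k * p k i) = ?S (\<lambda>i j k. a i j * p j k * p k i)"
    by (subst (2) sum3_rotate) (simp add: mult_ac)
  also have "?S (\<lambda>i j k. p i j * a k j * p k i) = ?S (\<lambda>i j k. a j i * p j k * p k i)"
    by (subst (2) sum3_rotate) (simp add: mult_ac)
  also have "?S (\<lambda>i j k. p i j * p j k * a i k) = ?S (\<lambda>i j k. p i j * a k j * p k i)"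
    by (subst (2) sum3_rotate) (simp add: mult_ac)
  also have "?S (\<lambda>i j k. p i j * a k j * p k i) = ?S (\<lambda>i j k. a j i * p j k * p k i)"
    by (subst (2) sum3_rotate) (simp add: mult_ac)
  also have "?S (\<lambda>i j k. a j i * p j k * p k i) = ?S (\<lambda>i j k. a i j * p j k * p k i)"
    by (subst sum.swap) (simp add: ps mult_ac)
  also have "?S (\<lambda>i j k. a i j * p j k * p k i) = ?S (\<lambda>i j k. a i k * p k j * p i j)"
    by (intro sum.cong refl trans[OF sum.swap]) (simp add: ps)
  finally show ?thesis by (simp add: p_def a_def)
qed

text \<open>The terms that do not contain second covariant derivatives come out with the roles of the
  two directions exchanged; relabelling the summation indices restores their order.\<close>

lemma second_variation_density:
  fixes v w :: 'x
  assumes x: "x \<in> X"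
  defines "V \<equiv> \<lambda>i. covariant H y (f i) (dirderiv v y) x"
    and "W \<equiv> \<lambda>i. covariant H y (f i) (dirderiv w y) x"
    and "e \<equiv> \<lambda>i. dirderiv (f i) y x"
    and "h \<equiv> H (y x)"
  shows "dirderiv v (\<lambda>x. \<Sum>i\<in>UNIV. \<Sum>j\<in>UNIV. \<Sum>k\<in>UNIV. A w i k x * P k j x * P i j x) x =
      (\<Sum>i\<in>UNIV. \<Sum>j\<in>UNIV. \<Sum>k\<in>UNIV.
         h (riemann H (y x) (dirderiv v y x) (e i) (dirderiv w y x)) (e k) * h (e k) (e j) * h (e i) (e j))
    + (\<Sum>i\<in>UNIV. \<Sum>j\<in>UNIV. \<Sum>k\<in>UNIV.
         h (covariant H y (f i) (covariant H y v (dirderiv w y)) x) (e k) * h (e k) (e j) * h (e i) (e j))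
    + (\<Sum>i\<in>UNIV. \<Sum>j\<in>UNIV. \<Sum>k\<in>UNIV. h (V i) (W k) * h (e k) (e j) * h (e i) (e j))
    + (\<Sum>i\<in>UNIV. \<Sum>j\<in>UNIV. \<Sum>k\<in>UNIV. h (V i) (e k) * h (W k) (e j) * h (e i) (e j))
    + (\<Sum>i\<in>UNIV. \<Sum>j\<in>UNIV. \<Sum>k\<in>UNIV. h (V i) (e k) * h (e k) (W j) * h (e i) (e j))
    + (\<Sum>i\<in>UNIV. \<Sum>j\<in>UNIV. \<Sum>k\<in>UNIV. h (V i) (e k) * h (e k) (e j) * h (W i) (e j))
    + (\<Sum>i\<in>UNIV. \<Sum>j\<in>UNIV. \<Sum>k\<in>UNIV. h (V i) (e k) * h (e k) (e j) * h (e i) (W j))"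
proof -
  let ?S = "\<lambda>g. \<Sum>i\<in>UNIV. \<Sum>j\<in>UNIV. \<Sum>k\<in>UNIV. (g i j k :: real)"
  let ?R = "\<lambda>i. riemann H (y x) (dirderiv v y x) (e i) (dirderiv w y x)"
  let ?L = "\<lambda>i. covariant H y (f i) (covariant H y v (dirderiv w y)) x"
  have hs: "h p q = h q p" for p q unfolding h_def by (rule metric_sym[OF inY[OF x]])
  have dA: "dirderiv v (A w i k) x = h (?R i) (e k) + h (?L i) (e k) + h (W i) (V k)" for i k
  proof -
    have "dirderiv v (A w i k) x = h (covariant H y v (covariant H y (f i) (dirderiv w y)) x) (e k) + h (W i) (V k)"
      unfolding h_def e_def V_def W_def
      by (subst covariant_metric[OF X y _ _ x]; (intro covariant_smooth X y smooth_on_dirderiv)?)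
        (simp add: covariant_commute[OF X y x, of v])
    also have "covariant H y v (covariant H y (f i) (dirderiv w y)) x = ?L i + ?R i"
      using covariant_curvature[OF X y smooth_on_dirderiv[OF y(1)] x, of v "f i" w]
      by (simp add: e_def algebra_simps)
    finally show ?thesis by (simp add: h_def metric_simps[OF inY[OF x]])
  qed
  have Px: "P i j x = h (e i) (e j)" and AV: "A v i j x = h (V i) (e j)" and AW: "A w i j x = h (W i) (e j)" for i j
    by (simp_all add: h_def e_def V_def W_def)
  have "dirderiv v (\<lambda>x. ?S (\<lambda>i j k. A w i k x * P k j x * P i j x)) x
    = ?S (\<lambda>i j k. (h (?R i) (e k) + h (?L i) (e k) + h (W i) (V k)) * h (e k) (e j) * h (e i) (e j)
        + h (W i) (e k) * (h (V k) (e j) + h (V j) (e k)) * h (e i) (e j)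
        + h (W i) (e k) * h (e k) (e j) * (h (V i) (e j) + h (V j) (e i)))"
    using dirderiv_sum3_mult[OF X x, of "\<lambda>i j k. A w i k" "\<lambda>i j k. P k j" "\<lambda>i j k. P i j" UNIV UNIV UNIV v]
    by (simp only: smooths dirderiv_pullback[OF x] dA Px AV AW finite_UNIV finite)
  also have "\<dots> = ?S (\<lambda>i j k. h (?R i) (e k) * h (e k) (e j) * h (e i) (e j))
      + ?S (\<lambda>i j k. h (?L i) (e k) * h (e k) (e j) * h (e i) (e j))
      + ?S (\<lambda>i j k. h (W i) (V k) * h (e k) (e j) * h (e i) (e j))
      + ?S (\<lambda>i j k. h (W i) (e k) * h (e k) (e j) * h (V j) (e i))
      + ?S (\<lambda>i j k. h (W i) (e k) * h (V j) (e k) * h (e i) (e j))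
      + ?S (\<lambda>i j k. h (W i) (e k) * h (e k) (e j) * h (V i) (e j))
      + ?S (\<lambda>i j k. h (W i) (e k) * h (V k) (e j) * h (e i) (e j))"
    by (simp only: sum.distrib distrib_left distrib_right add.assoc add.left_commute add.commute)
  also have "?S (\<lambda>i j k. h (W i) (V k) * h (e k) (e j) * h (e i) (e j))
      = ?S (\<lambda>i j k. h (V i) (W k) * h (e k) (e j) * h (e i) (e j))"
    by (subst sum3_rotate, subst sum.swap, rule sum.cong[OF refl], rule sum.cong[OF refl], rule sum.cong[OF refl])
      (simp add: hs mult_ac)
  also have "?S (\<lambda>i j k. h (W i) (e k) * h (e k) (e j) * h (V j) (e i))
      = ?S (\<lambda>i j k. h (V i) (e k) * h (W k) (e j) * h (e i) (e j))"
    by (subst (2) sum3_rotate) (simp add: hs mult_ac)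
  also have "?S (\<lambda>i j k. h (W i) (e k) * h (V j) (e k) * h (e i) (e j))
      = ?S (\<lambda>i j k. h (V i) (e k) * h (e k) (W j) * h (e i) (e j))"
    by (subst sum.swap) (simp add: hs mult_ac)
  also have "?S (\<lambda>i j k. h (W i) (e k) * h (e k) (e j) * h (V i) (e j))
      = ?S (\<lambda>i j k. h (V i) (e k) * h (e k) (e j) * h (W i) (e j))"
    by (intro sum.cong refl trans[OF sum.swap]) (simp add: hs mult_ac)
  also have "?S (\<lambda>i j k. h (W i) (e k) * h (V k) (e j) * h (e i) (e j))
      = ?S (\<lambda>i j k. h (V i) (e k) * h (e k) (e j) * h (e i) (W j))"
    by (subst sum3_rotate) (simp add: hs mult_ac)
  finally show ?thesis .
qed

end

end

section \<open>Charts\<close>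

lemma covariant_cong_open:
  assumes "open S" "x \<in> S" "\<And>x. x \<in> S \<Longrightarrow> y x = y' x" "\<And>x. x \<in> S \<Longrightarrow> a x = a' x"
  shows "covariant H y v a x = covariant H y' v a' x"
  using dirderiv_cong_open[OF assms(1,2,3)] dirderiv_cong_open[OF assms(1,2,4)] assms
  by (simp add: covariant_def)

lemma covariant_compose:
  assumes "smooth_on T y" "smooth_on T a" "smooth_on S \<theta>" "x \<in> S" "\<theta> x \<in> T"
  shows "covariant H (\<lambda>x. y (\<theta> x)) v (\<lambda>x. a (\<theta> x)) x = covariant H y (dirderiv v \<theta> x) a (\<theta> x)"
  by (simp add: covariant_def dirderiv_compose[OF assms(1,5,3,4)] dirderiv_compose[OF assms(2,5,3,4)])

locale manifold =
  fixes B :: "('b::{t2_space, second_countable_topology}, 'n::finite) chart set"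
  assumes atlas: "smooth_atlas B"
begin

lemma is_chart: "c \<in> B \<Longrightarrow> is_chart c"
  using atlas by (simp add: smooth_atlas_def)

lemma open_chart: "c \<in> B \<Longrightarrow> open (fst c)" "c \<in> B \<Longrightarrow> open (snd c ` fst c)"
  using is_chart by (auto simp: is_chart_def)

lemma chart_inv_chart: "c \<in> B \<Longrightarrow> p \<in> fst c \<Longrightarrow> chart_inv c (snd c p) = p"
  using is_chart by (auto simp: is_chart_def homeomorphism_def)

lemma chart_chart_inv:
  "c \<in> B \<Longrightarrow> x \<in> snd c ` fst c \<Longrightarrow> snd c (chart_inv c x) = x"
  "c \<in> B \<Longrightarrow> x \<in> snd c ` fst c \<Longrightarrow> chart_inv c x \<in> fst c"
  by (auto simp: chart_inv_chart)

lemma continuous_chart: "c \<in> B \<Longrightarrow> continuous_on (fst c) (snd c)"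
  "c \<in> B \<Longrightarrow> continuous_on (snd c ` fst c) (chart_inv c)"
  using is_chart by (auto simp: is_chart_def homeomorphism_def)

lemma inj_on_chart: "c \<in> B \<Longrightarrow> inj_on (snd c) (fst c)"
  by (metis chart_inv_chart inj_onI)

lemma chart_at: "chart_at B p \<in> B" "p \<in> fst (chart_at B p)"
proof -
  have "p \<in> (\<Union>c\<in>B. fst c)" using atlas by (simp add: smooth_atlas_def)
  then have "\<exists>c. c \<in> B \<and> p \<in> fst c" by blast
  then have "chart_at B p \<in> B \<and> p \<in> fst (chart_at B p)"
    unfolding chart_at_def by (rule someI_ex)
  then show "chart_at B p \<in> B" "p \<in> fst (chart_at B p)" by auto
qed

lemma chart_image_eq:
  assumes "c \<in> B" "W \<subseteq> fst c"
  shows "snd c ` W = {x \<in> snd c ` fst c. chart_inv c x \<in> W}"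
  using assms by (force simp: chart_inv_chart)

lemma open_chart_image:
  assumes "c \<in> B" "open W" "W \<subseteq> fst c"
  shows "open (snd c ` W)"
proof -
  have "snd c ` W = (snd c ` fst c) \<inter> chart_inv c -` W"
    unfolding chart_image_eq[OF assms(1,3)] by auto
  then show ?thesis
    using continuous_open_preimage[OF continuous_chart(2)[OF assms(1)] open_chart(2)[OF assms(1)] assms(2)]
    by simp
qed

lemma open_overlap: "c \<in> B \<Longrightarrow> d \<in> B \<Longrightarrow> open (snd c ` (fst c \<inter> fst d))"
  by (intro open_chart_image open_Int open_chart) auto

lemma transition_smooth:
  "c \<in> B \<Longrightarrow> d \<in> B \<Longrightarrow> smooth_on (snd c ` (fst c \<inter> fst d)) (\<lambda>x. snd d (chart_inv c x))"
  using atlas by (auto simp: smooth_atlas_def comp_def)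

lemma change_chart_dirderiv:
  "change_chart c d p v = dirderiv v (\<lambda>x. snd d (chart_inv c x)) (snd c p)"
  by (simp add: change_chart_def dirderiv_def comp_def)

lemma linear_change_chart:
  assumes "c \<in> B" "d \<in> B" "p \<in> fst c" "p \<in> fst d"
  shows "linear (change_chart c d p)"
  using smooth_on_linear_dirderiv[OF transition_smooth[OF assms(1,2)], of "snd c p"] assms
  by (simp add: change_chart_dirderiv[abs_def])

lemma change_chart_compose:
  assumes "c \<in> B" "d \<in> B" "e \<in> B" "p \<in> fst c" "p \<in> fst d" "p \<in> fst e"
  shows "change_chart d e p (change_chart c d p v) = change_chart c e p v"
proof -
  let ?W = "fst c \<inter> fst d \<inter> fst e"
  have W: "open (snd c ` ?W)" "snd c p \<in> snd c ` ?W"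
    using assms by (auto intro!: open_chart_image open_chart)
  have "dirderiv v (\<lambda>x. snd e (chart_inv c x)) (snd c p)
      = dirderiv v (\<lambda>x. snd e (chart_inv d (snd d (chart_inv c x)))) (snd c p)"
    by (rule dirderiv_cong_open[OF W]) (use assms in \<open>auto simp: chart_inv_chart\<close>)
  also have "\<dots> = dirderiv (dirderiv v (\<lambda>x. snd d (chart_inv c x)) (snd c p))
      (\<lambda>x. snd e (chart_inv d x)) (snd d (chart_inv c (snd c p)))"
    by (rule dirderiv_compose[OF transition_smooth[OF assms(2,3)] _ transition_smooth[OF assms(1,2)]])
      (use assms in \<open>auto simp: chart_inv_chart\<close>)
  finally show ?thesis
    using assms by (simp add: change_chart_dirderiv chart_inv_chart)
qed

lemma change_chart_id:
  assumes "c \<in> B" "p \<in> fst c"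
  shows "change_chart c c p v = v"
proof -
  have "dirderiv v (\<lambda>x. snd c (chart_inv c x)) (snd c p) = dirderiv v (\<lambda>x. x) (snd c p)"
    by (rule dirderiv_cong_open[OF open_chart(2)[OF assms(1)]]) (use assms in \<open>auto simp: chart_inv_chart\<close>)
  then show ?thesis by (simp add: change_chart_dirderiv dirderiv_id)
qed

lemma change_chart_inverse:
  assumes "c \<in> B" "d \<in> B" "p \<in> fst c" "p \<in> fst d"
  shows "change_chart d c p (change_chart c d p v) = v"
  using change_chart_compose[OF assms(1,2,1,3,4,3)] change_chart_id[OF assms(1,3)] by simp

text \<open>Tangent vectors at \<open>p\<close> are stored by their components in the preferred chart at \<open>p\<close>. Since that chart
  jumps from point to point, smoothness and derivatives of vector fields only make sense for the
  components in a fixed chart \<open>d\<close>.\<close>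

abbreviation in_chart :: "('b, 'n) chart \<Rightarrow> 'b \<Rightarrow> real ^ 'n \<Rightarrow> real ^ 'n" where
  "in_chart d p \<equiv> change_chart (chart_at B p) d p"

lemma in_chart_change:
  assumes "d \<in> B" "d' \<in> B" "p \<in> fst d" "p \<in> fst d'"
  shows "change_chart d d' p (in_chart d p v) = in_chart d' p v"
  by (rule change_chart_compose) (use assms chart_at in auto)

lemma in_chart_inverse:
  assumes "d \<in> B" "p \<in> fst d"
  shows "in_chart d p (change_chart d (chart_at B p) p v) = v"
  by (rule change_chart_inverse) (use assms chart_at in auto)

lemma in_chart_linear: "d \<in> B \<Longrightarrow> p \<in> fst d \<Longrightarrow> linear (in_chart d p)"
  by (rule linear_change_chart) (use chart_at in auto)

lemma in_chart_preferred: "in_chart (chart_at B p) p v = v"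
  by (rule change_chart_id[OF chart_at])

subsection \<open>Maps from open subsets of normed spaces into a manifold\<close>

text \<open>The domain is an open set of coordinates, of parameters, or of both together; so one notion covers
  maps between manifolds in a chart of the source, curves, and whole variations.\<close>

definition smooth_into :: "'x::real_normed_vector set \<Rightarrow> ('x \<Rightarrow> 'b) \<Rightarrow> bool" where
  "smooth_into S U \<longleftrightarrow> open S \<and> continuous_on S U \<and>
     (\<forall>d\<in>B. smooth_on {x \<in> S. U x \<in> fst d} (\<lambda>x. snd d (U x)))"

text \<open>The derivative of \<open>U\<close> in direction \<open>v\<close>, as a tangent vector at \<open>U x\<close>.\<close>

definition tangent :: "('x::real_normed_vector \<Rightarrow> 'b) \<Rightarrow> 'x \<Rightarrow> 'x \<Rightarrow> real ^ 'n" where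
  "tangent U v x = dirderiv v (\<lambda>x'. snd (chart_at B (U x)) (U x')) x"

definition smooth_along :: "'x::real_normed_vector set \<Rightarrow> ('x \<Rightarrow> 'b) \<Rightarrow> ('x \<Rightarrow> real ^ 'n) \<Rightarrow> bool" where
  "smooth_along S U a \<longleftrightarrow> (\<forall>d\<in>B. smooth_on {x \<in> S. U x \<in> fst d} (\<lambda>x. in_chart d (U x) (a x)))"

context
  fixes S :: "'x::real_normed_vector set" and U :: "'x \<Rightarrow> 'b"
  assumes U: "smooth_into S U"
begin

lemma open_smooth_into: "open S"
  using U by (simp add: smooth_into_def)

lemma open_preimage: "open W \<Longrightarrow> open {x \<in> S. U x \<in> W}"
  using continuous_open_preimage[of S U W] U by (simp add: smooth_into_def vimage_def Int_def conj_commute)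

lemma open_chart_preimage: "d \<in> B \<Longrightarrow> open {x \<in> S. U x \<in> fst d}"
  by (intro open_preimage open_chart)

lemma smooth_into_chart: "d \<in> B \<Longrightarrow> smooth_on {x \<in> S. U x \<in> fst d} (\<lambda>x. snd d (U x))"
  using U by (simp add: smooth_into_def)

lemma dirderiv_change_chart:
  assumes "d \<in> B" "d' \<in> B" "x \<in> S" "U x \<in> fst d" "U x \<in> fst d'"
  shows "dirderiv v (\<lambda>x. snd d' (U x)) x = change_chart d d' (U x) (dirderiv v (\<lambda>x. snd d (U x)) x)"
proof -
  let ?X = "{x \<in> S. U x \<in> fst d \<inter> fst d'}"
  have X: "open ?X" "x \<in> ?X"
    using assms open_preimage[OF open_Int[OF open_chart(1)[OF assms(1)] open_chart(1)[OF assms(2)]]] by auto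
  have "dirderiv v (\<lambda>x. snd d' (U x)) x = dirderiv v (\<lambda>x. snd d' (chart_inv d (snd d (U x)))) x"
    by (rule dirderiv_cong_open[OF X]) (use assms in \<open>auto simp: chart_inv_chart\<close>)
  also have "\<dots> = dirderiv (dirderiv v (\<lambda>x. snd d (U x)) x) (\<lambda>z. snd d' (chart_inv d z)) (snd d (U x))"
    by (rule dirderiv_compose[OF transition_smooth[OF assms(1,2)] _ smooth_into_chart[OF assms(1)]])
      (use assms in auto)
  finally show ?thesis by (simp add: change_chart_dirderiv)
qed

lemma tangent_in_chart:
  assumes "d \<in> B" "x \<in> S" "U x \<in> fst d"
  shows "in_chart d (U x) (tangent U v x) = dirderiv v (\<lambda>x. snd d (U x)) x"
  unfolding tangent_def by (rule dirderiv_change_chart[symmetric]) (use assms chart_at in auto)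

lemma smooth_along_tangent: "smooth_along S U (tangent U v)"
  unfolding smooth_along_def
proof
  fix d assume d: "d \<in> B"
  show "smooth_on {x \<in> S. U x \<in> fst d} (\<lambda>x. in_chart d (U x) (tangent U v x))"
    by (subst smooth_on_cong[OF open_chart_preimage[OF d] tangent_in_chart[OF d]])
      (use smooth_on_dirderiv[OF smooth_into_chart[OF d]] in auto)
qed

end

lemma smooth_into_compose:
  fixes \<theta> :: "'x::euclidean_space \<Rightarrow> 'y::euclidean_space"
  assumes "smooth_into T U" "open S" "smooth_on S \<theta>" "\<theta> ` S \<subseteq> T"
  shows "smooth_into S (\<lambda>x. U (\<theta> x))"
  unfolding smooth_into_def
proof (intro conjI ballI assms)
  have T: "continuous_on T U" using assms by (simp add: smooth_into_def)
  show cont: "continuous_on S (\<lambda>x. U (\<theta> x))"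
    by (rule continuous_on_compose2[OF T smooth_on_continuous_on[OF assms(3)] assms(4)])
  fix d assume d: "d \<in> B"
  have o: "open {x \<in> S. U (\<theta> x) \<in> fst d}"
    using continuous_open_preimage[OF cont assms(2) open_chart(1)[OF d]]
    by (simp add: vimage_def Int_def conj_commute)
  show "smooth_on {x \<in> S. U (\<theta> x) \<in> fst d} (\<lambda>x. snd d (U (\<theta> x)))"
    by (rule smooth_on_compose[OF o open_chart_preimage[OF assms(1) d] smooth_into_chart[OF assms(1) d]])
      (use assms in \<open>auto intro: smooth_on_subset[OF assms(3)]\<close>)
qed

lemma tangent_compose:
  assumes "smooth_into T U" "smooth_on S \<theta>" "x \<in> S" "\<theta> x \<in> T"
  shows "tangent (\<lambda>x. U (\<theta> x)) v x = tangent U (dirderiv v \<theta> x) (\<theta> x)"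
  unfolding tangent_def
  by (rule dirderiv_compose[OF smooth_into_chart[OF assms(1) chart_at(1)] _ assms(2,3)])
    (use assms chart_at in auto)

lemma smooth_along_compose:
  fixes \<theta> :: "'x::euclidean_space \<Rightarrow> 'y::euclidean_space"
  assumes "smooth_into T U" "smooth_along T U a" "open S" "smooth_on S \<theta>" "\<theta> ` S \<subseteq> T"
  shows "smooth_along S (\<lambda>x. U (\<theta> x)) (\<lambda>x. a (\<theta> x))"
  unfolding smooth_along_def
proof
  fix d assume d: "d \<in> B"
  have "smooth_on {x \<in> T. U x \<in> fst d} (\<lambda>x. in_chart d (U x) (a x))"
    using assms(2) d by (simp add: smooth_along_def)
  then show "smooth_on {x \<in> S. U (\<theta> x) \<in> fst d} (\<lambda>x. in_chart d (U (\<theta> x)) (a (\<theta> x)))"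
    by (rule smooth_on_compose[OF open_chart_preimage[OF smooth_into_compose[OF assms(1,3,4,5)] d]
          open_chart_preimage[OF assms(1) d]])
      (use assms in \<open>auto intro: smooth_on_subset[OF assms(4)]\<close>)
qed

end

section \<open>Riemannian metrics and covariant derivatives along maps\<close>

locale riemannian = manifold B
  for B :: "('b::{t2_space, second_countable_topology}, 'n::finite) chart set" +
  fixes h :: "'b \<Rightarrow> real ^ 'n \<Rightarrow> real ^ 'n \<Rightarrow> real"
  assumes riemannian: "riemannian_manifold B h"
begin

lemma metric_point: "bilinear (h p)" "h p v w = h p w v" "v \<noteq> 0 \<Longrightarrow> h p v v > 0"
  using riemannian unfolding riemannian_manifold_def by metis+

abbreviation "met d \<equiv> metric_in_chart B h d"

lemma metric_in_chart_pull:
  assumes "d \<in> B" "p \<in> fst d"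
  shows "met d (snd d p) v w = h p (change_chart d (chart_at B p) p v) (change_chart d (chart_at B p) p w)"
  using assms by (simp add: metric_in_chart_def chart_inv_chart Let_def)

lemma metric_in_chart_eq:
  assumes "d \<in> B" "p \<in> fst d"
  shows "met d (snd d p) (in_chart d p v) (in_chart d p w) = h p v w"
proof -
  have "change_chart d (chart_at B p) p (in_chart d p v) = v" for v
    by (rule change_chart_inverse) (use assms chart_at in auto)
  then show ?thesis by (simp add: metric_in_chart_pull[OF assms])
qed

lemma riemannian_domain_chart:
  assumes "d \<in> B" "open Y" "Y \<subseteq> snd d ` fst d"
  shows "riemannian_domain Y (met d)"
proof
  show "open Y" by fact
next
  fix y assume "y \<in> Y"
  then obtain p where p: "p \<in> fst d" "y = snd d p" using assms by auto
  let ?t = "change_chart d (chart_at B p) p"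
  have lin: "linear ?t" by (rule linear_change_chart) (use assms p chart_at in auto)
  have eq: "met d y = (\<lambda>v w. h p (?t v) (?t w))"
    unfolding p by (intro ext metric_in_chart_pull[OF assms(1) p(1)])
  show "bilinear (met d y)"
    unfolding eq bilinear_def using metric_point(1)[of p] lin
    by (auto simp: bilinear_def intro: linear_compose[unfolded comp_def])
  show "met d y v w = met d y w v" for v w
    unfolding eq by (rule metric_point(2))
  have "in_chart d p (?t v) = v" for v by (rule in_chart_inverse[OF assms(1) p(1)])
  then have "?t v \<noteq> 0" if "v \<noteq> 0" for v
    using that linear_0[OF in_chart_linear[OF assms(1) p(1)]] by metis
  then show "v \<noteq> 0 \<Longrightarrow> met d y v v > 0" for v
    unfolding eq by (intro metric_point(3))
next
  show "smooth_on Y (\<lambda>y. met d y v w)" for v w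
    using riemannian assms smooth_on_subset unfolding riemannian_manifold_def by blast
qed

lemma isometric_transition_charts:
  assumes "c \<in> B" "d \<in> B"
  shows "isometric_transition (snd c ` (fst c \<inter> fst d)) (met c) (snd d ` (fst c \<inter> fst d)) (met d)
     (\<lambda>x. snd d (chart_inv c x))"
proof -
  have o: "open (snd c ` (fst c \<inter> fst d))" "open (snd d ` (fst c \<inter> fst d))"
    using open_overlap[OF assms] open_overlap[OF assms(2,1)] by (auto simp: Int_commute)
  interpret d1: riemannian_domain "snd c ` (fst c \<inter> fst d)" "met c"
    by (rule riemannian_domain_chart[OF assms(1) o(1)]) auto
  interpret d2: riemannian_domain "snd d ` (fst c \<inter> fst d)" "met d"
    by (rule riemannian_domain_chart[OF assms(2) o(2)]) auto
  show ?thesis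
  proof
    show "smooth_on (snd c ` (fst c \<inter> fst d)) (\<lambda>x. snd d (chart_inv c x))"
      by (rule transition_smooth[OF assms])
    show "(\<lambda>x. snd d (chart_inv c x)) ` snd c ` (fst c \<inter> fst d) \<subseteq> snd d ` (fst c \<inter> fst d)"
      using assms by (auto simp: chart_inv_chart)
  next
    fix y assume "y \<in> snd c ` (fst c \<inter> fst d)"
    then obtain p where p: "p \<in> fst c" "p \<in> fst d" "y = snd c p" by auto
    have inv: "chart_inv c y = p" using p assms by (simp add: chart_inv_chart)
    have eq: "dirderiv v (\<lambda>x. snd d (chart_inv c x)) y = change_chart c d p v" for v
      by (simp add: change_chart_dirderiv p)
    show "surj (\<lambda>v. dirderiv v (\<lambda>x. snd d (chart_inv c x)) y)"
      unfolding eq using change_chart_inverse[OF assms(2,1) p(2,1)] by (metis surjI)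
    show "met c y v w = met d (snd d (chart_inv c y))
        (dirderiv v (\<lambda>x. snd d (chart_inv c x)) y) (dirderiv w (\<lambda>x. snd d (chart_inv c x)) y)" for v w
      unfolding eq inv unfolding p(3) metric_in_chart_pull[OF assms(1) p(1)] metric_in_chart_pull[OF assms(2) p(2)]
      using change_chart_compose[OF assms chart_at(1) p(1,2) chart_at(2)] by simp
  qed
qed

text \<open>The covariant derivative of a vector field along \<open>U\<close>, computed in the preferred chart at \<open>U x\<close>.\<close>

definition cov :: "('x::real_normed_vector \<Rightarrow> 'b) \<Rightarrow> 'x \<Rightarrow> ('x \<Rightarrow> real ^ 'n) \<Rightarrow> 'x \<Rightarrow> real ^ 'n" where
  "cov U v a x = (let d = chart_at B (U x) in
     covariant (met d) (\<lambda>x. snd d (U x)) v (\<lambda>x. in_chart d (U x) (a x)) x)"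

context
  fixes S :: "'x::real_normed_vector set" and U :: "'x \<Rightarrow> 'b"
  assumes U: "smooth_into S U"
begin

text \<open>Any other chart gives the same vector, because chart transitions are isometries between the
  coordinate expressions of the metric.\<close>

lemma cov_in_chart:
  assumes a: "smooth_along S U a" and d: "d \<in> B" and x: "x \<in> S" "U x \<in> fst d"
  shows "in_chart d (U x) (cov U v a x) =
    covariant (met d) (\<lambda>x. snd d (U x)) v (\<lambda>x. in_chart d (U x) (a x)) x"
proof -
  let ?c = "chart_at B (U x)"
  have c: "?c \<in> B" "U x \<in> fst ?c" by (rule chart_at)+
  interpret isometric_transition "snd ?c ` (fst ?c \<inter> fst d)" "met ?c" "snd d ` (fst ?c \<inter> fst d)" "met d"
    "\<lambda>z. snd d (chart_inv ?c z)"
    by (rule isometric_transition_charts[OF c(1) d])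
  let ?X = "{x \<in> S. U x \<in> fst ?c \<inter> fst d}"
  have X: "open ?X" "x \<in> ?X"
    using x c open_preimage[OF U open_Int[OF open_chart(1)[OF c(1)] open_chart(1)[OF d]]] by auto
  have "covariant (met d) (\<lambda>x. snd d (U x)) v (\<lambda>x. in_chart d (U x) (a x)) x =
    covariant (met d) (\<lambda>x. snd d (chart_inv ?c (snd ?c (U x)))) v
      (\<lambda>x. dirderiv (in_chart ?c (U x) (a x)) (\<lambda>z. snd d (chart_inv ?c z)) (snd ?c (U x))) x"
    by (rule covariant_cong_open[OF X])
      (use c d in_chart_change[OF c(1) d] in \<open>auto simp: chart_inv_chart change_chart_dirderiv\<close>)
  also have "\<dots> = dirderiv (covariant (met ?c) (\<lambda>x. snd ?c (U x)) v (\<lambda>x. in_chart ?c (U x) (a x)) x)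
      (\<lambda>z. snd d (chart_inv ?c z)) (snd ?c (U x))"
    by (rule covariant_transition[OF X(1) _ _ _ X(2)])
      (use a c in \<open>auto simp: smooth_along_def intro!: smooth_on_subset[OF smooth_into_chart[OF U c(1)]]
         intro: smooth_on_subset\<close>)
  finally show ?thesis
    by (simp add: cov_def Let_def change_chart_dirderiv)
qed

lemma smooth_along_cov:
  assumes "smooth_along S U a"
  shows "smooth_along S U (cov U v a)"
  unfolding smooth_along_def
proof
  fix d assume d: "d \<in> B"
  interpret riemannian_domain "snd d ` fst d" "met d"
    by (rule riemannian_domain_chart[OF d open_chart(2)[OF d] order_refl])
  have "smooth_on {x \<in> S. U x \<in> fst d} (covariant (met d) (\<lambda>x. snd d (U x)) v (\<lambda>x. in_chart d (U x) (a x)))"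
    by (rule covariant_smooth[OF open_chart_preimage[OF U d] smooth_into_chart[OF U d]])
      (use assms d in \<open>auto simp: smooth_along_def\<close>)
  then show "smooth_on {x \<in> S. U x \<in> fst d} (\<lambda>x. in_chart d (U x) (cov U v a x))"
    by (subst smooth_on_cong[OF open_chart_preimage[OF U d] cov_in_chart[OF assms d]]) auto
qed

end

text \<open>The chain rule: it serves to change charts of the source, and to restrict to slices of the product of
  parameters and coordinates.\<close>

lemma cov_compose:
  assumes "smooth_into T U" "smooth_along T U a" "smooth_on S \<theta>" "x \<in> S" "\<theta> x \<in> T"
  shows "cov (\<lambda>x. U (\<theta> x)) v (\<lambda>x. a (\<theta> x)) x = cov U (dirderiv v \<theta> x) a (\<theta> x)"
  unfolding cov_def Let_def
  by (rule covariant_compose[OF smooth_into_chart[OF assms(1) chart_at(1)] _ assms(3,4)])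
    (use assms chart_at in \<open>auto simp: smooth_along_def\<close>)

lemma cov_cong_open:
  assumes "open S" "x \<in> S" "\<And>x. x \<in> S \<Longrightarrow> U x = U' x" "\<And>x. x \<in> S \<Longrightarrow> a x = a' x"
  shows "cov U v a x = cov U' v a' x"
  using assms(3)[OF assms(2)] unfolding cov_def Let_def
  by simp (rule covariant_cong_open[OF assms(1,2)]; simp add: assms)

lemma cov_add:
  assumes "smooth_into S U" "smooth_along S U a" "smooth_along S U b" "x \<in> S"
  shows "cov U v (\<lambda>x. a x + b x) x = cov U v a x + cov U v b x"
proof -
  let ?d = "chart_at B (U x)"
  have d: "?d \<in> B" "U x \<in> fst ?d" by (rule chart_at)+
  let ?X = "{x \<in> S. U x \<in> fst ?d}"
  interpret riemannian_domain "snd ?d ` fst ?d" "met ?d"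
    by (rule riemannian_domain_chart[OF d(1) open_chart(2)[OF d(1)] order_refl])
  note X = open_chart_preimage[OF assms(1) d(1)]
  have "covariant (met ?d) (\<lambda>x. snd ?d (U x)) v (\<lambda>x. in_chart ?d (U x) (a x + b x)) x =
    covariant (met ?d) (\<lambda>x. snd ?d (U x)) v (\<lambda>x. in_chart ?d (U x) (a x) + in_chart ?d (U x) (b x)) x"
    by (rule covariant_cong_open[OF X]) (use assms d linear_add[OF in_chart_linear[OF d(1)]] in auto)
  also have "\<dots> = covariant (met ?d) (\<lambda>x. snd ?d (U x)) v (\<lambda>x. in_chart ?d (U x) (a x)) x
    + covariant (met ?d) (\<lambda>x. snd ?d (U x)) v (\<lambda>x. in_chart ?d (U x) (b x)) x"
    by (rule covariant_add[OF X smooth_into_chart[OF assms(1) d(1)]])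
      (use assms d in \<open>auto simp: smooth_along_def\<close>)
  finally show ?thesis by (simp add: cov_def Let_def)
qed

end

section \<open>Frame sums\<close>

text \<open>Frame sums are traces of products of matrices, so that a change of frame conjugates the factors.\<close>

lemma sum3_trace:
  "(\<Sum>i\<in>UNIV. \<Sum>j\<in>UNIV. \<Sum>k\<in>UNIV. a i k * b k j * c i j) =
    trace ((\<chi> i k. a i k) ** (\<chi> k j. b k j) ** transpose (\<chi> i j. c i j) :: real ^ 'm ^ 'm)"
  by (simp add: trace_def matrix_matrix_mult_def transpose_def sum_distrib_right)

lemma trace_frame:
  fixes E X Y Z :: "real ^ 'm ^ 'm"
  shows "trace ((E ** X ** transpose E) ** (E ** Y ** transpose E) ** (E ** Z ** transpose E)) =
    trace ((transpose E ** E) ** X ** (transpose E ** E) ** Y ** (transpose E ** E) ** Z)"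
  (is "?l = _")
proof -
  have "?l = trace ((E ** X ** (transpose E ** E) ** Y ** (transpose E ** E) ** Z) ** transpose E)"
    by (simp add: matrix_mul_assoc)
  also have "\<dots> = trace (transpose E ** (E ** X ** (transpose E ** E) ** Y ** (transpose E ** E) ** Z))"
    by (rule trace_mul_sym)
  finally show ?thesis by (simp add: matrix_mul_assoc)
qed

lemma bilinear_frame_matrix:
  fixes b :: "real ^ 'm \<Rightarrow> real ^ 'm \<Rightarrow> real"
  assumes "bilinear b"
  shows "(\<chi> i k. b (f i) (f k)) = (\<chi> i. f i) ** (\<chi> i j. b (axis i 1) (axis j 1)) ** transpose (\<chi> i. f i)"
proof -
  have *: "b v w = (\<Sum>j\<in>UNIV. (\<Sum>i\<in>UNIV. v $ i * b (axis i 1) (axis j 1)) * w $ j)" for v w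
  proof -
    have "b v w = (\<Sum>j\<in>UNIV. w $ j * b v (axis j 1))"
      using linear_axis_expand[of "b v" w] assms by (simp add: bilinear_def)
    moreover have "b v z = (\<Sum>i\<in>UNIV. v $ i * b (axis i 1) z)" for z
      using linear_axis_expand[of "\<lambda>v. b v z" v] assms by (simp add: bilinear_def)
    ultimately show ?thesis by (simp add: mult.commute)
  qed
  show ?thesis
    unfolding vec_eq_iff
  proof (intro allI)
    fix i k
    show "(\<chi> i k. b (f i) (f k)) $ i $ k =
        ((\<chi> i. f i) ** (\<chi> i j. b (axis i 1) (axis j 1)) ** transpose (\<chi> i. f i)) $ i $ k"
      using *[of "f i" "f k"] by (simp add: matrix_matrix_mult_def transpose_def)
  qed
qed

lemma smooth_on_matrix_mult:
  fixes F G :: "'z::real_normed_vector \<Rightarrow> real ^ 'm ^ 'm"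
  assumes "open S" "\<And>i j. smooth_on S (\<lambda>z. F z $ i $ j)" "\<And>i j. smooth_on S (\<lambda>z. G z $ i $ j)"
  shows "smooth_on S (\<lambda>z. (F z ** G z) $ i $ j)"
  unfolding matrix_matrix_mult_def
  by (simp, intro smooth_on_sum smooth_on_mult assms) simp

abbreviation bilinear_matrix :: "(real ^ 'm \<Rightarrow> real ^ 'm \<Rightarrow> real) \<Rightarrow> real ^ 'm ^ 'm" where
  "bilinear_matrix b \<equiv> (\<chi> i j. b (axis i 1) (axis j 1))"

text \<open>If the rows of \<open>E\<close> are the frame and \<open>G\<close> is the matrix of the metric, then \<open>E G E\<^sup>T = 1\<close>, so
  \<open>E\<^sup>T E\<close> is the inverse of \<open>G\<close>.\<close>

lemma orthonormal_frame_inverse: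
  fixes f :: "'m::finite \<Rightarrow> real ^ 'm"
  assumes "bilinear G" "orthonormal_frame G f"
  shows "bilinear_matrix G ** (transpose (\<chi> i. f i) ** (\<chi> i. f i)) = mat 1"
proof -
  have "(\<chi> i. f i) ** (bilinear_matrix G ** transpose (\<chi> i. f i)) = mat 1"
    using bilinear_frame_matrix[OF assms(1), of f] assms(2)
    by (simp add: orthonormal_frame_def matrix_mul_assoc[symmetric] mat_def)
  then have "(bilinear_matrix G ** transpose (\<chi> i. f i)) ** (\<chi> i. f i) = mat 1"
    by (rule matrix_left_right_inverse[THEN iffD1])
  then show ?thesis by (simp add: matrix_mul_assoc)
qed

text \<open>A frame itself need not depend smoothly on the point, but the matrix of the inverse metric,
  which is all that enters a frame sum, does.\<close>

lemma frame_sum_trace: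
  fixes f :: "'m::finite \<Rightarrow> real ^ 'm"
  assumes "bilinear b1" "bilinear b2" "bilinear b3"
  shows "(\<Sum>i\<in>UNIV. \<Sum>j\<in>UNIV. \<Sum>k\<in>UNIV. b1 (f i) (f k) * b2 (f k) (f j) * b3 (f i) (f j)) =
    (let \<gamma> = transpose (\<chi> i. f i) ** (\<chi> i. f i) in
      trace (\<gamma> ** bilinear_matrix b1 ** \<gamma> ** bilinear_matrix b2 ** \<gamma> ** transpose (bilinear_matrix b3)))"
  unfolding sum3_trace bilinear_frame_matrix[OF assms(1), of f] bilinear_frame_matrix[OF assms(2), of f]
    bilinear_frame_matrix[OF assms(3), of f] Let_def trace_frame[symmetric]
  by (simp add: matrix_transpose_mul matrix_mul_assoc)

lemma frame_sum_independent:
  fixes f f' :: "'m::finite \<Rightarrow> real ^ 'm" and b1 b2 b3 :: "real ^ 'm \<Rightarrow> real ^ 'm \<Rightarrow> real"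
  assumes "bilinear b1" "bilinear b2" "bilinear b3" "bilinear G" "orthonormal_frame G f" "orthonormal_frame G f'"
  shows "(\<Sum>i\<in>UNIV. \<Sum>j\<in>UNIV. \<Sum>k\<in>UNIV. b1 (f i) (f k) * b2 (f k) (f j) * b3 (f i) (f j)) =
    (\<Sum>i\<in>UNIV. \<Sum>j\<in>UNIV. \<Sum>k\<in>UNIV. b1 (f' i) (f' k) * b2 (f' k) (f' j) * b3 (f' i) (f' j))"
proof -
  let ?\<gamma> = "transpose (\<chi> i. f i) ** (\<chi> i. f i)" and ?\<gamma>' = "transpose (\<chi> i. f' i) ** (\<chi> i. f' i)"
  have 1: "bilinear_matrix G ** ?\<gamma> = mat 1" and 2: "bilinear_matrix G ** ?\<gamma>' = mat 1"
    by (rule orthonormal_frame_inverse; fact)+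
  have 3: "?\<gamma>' ** bilinear_matrix G = mat 1" using 2 by (rule matrix_left_right_inverse[THEN iffD1])
  have "?\<gamma> = (?\<gamma>' ** bilinear_matrix G) ** ?\<gamma>" unfolding 3 by simp
  also have "\<dots> = ?\<gamma>'" unfolding matrix_mul_assoc[symmetric] 1[unfolded matrix_mul_assoc[symmetric]] by simp
  finally show ?thesis
    unfolding frame_sum_trace[OF assms(1-3)] Let_def by simp
qed

lemma smooth_on_frame_sum:
  fixes f :: "'z::real_normed_vector \<Rightarrow> 'm::finite \<Rightarrow> real ^ 'm"
    and b1 b2 b3 G :: "'z \<Rightarrow> real ^ 'm \<Rightarrow> real ^ 'm \<Rightarrow> real"
  assumes S: "open S"
    and bil: "\<And>z. z \<in> S \<Longrightarrow> bilinear (b1 z)" "\<And>z. z \<in> S \<Longrightarrow> bilinear (b2 z)" "\<And>z. z \<in> S \<Longrightarrow> bilinear (b3 z)"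
      "\<And>z. z \<in> S \<Longrightarrow> bilinear (G z)"
    and sm: "\<And>v w. smooth_on S (\<lambda>z. b1 z v w)" "\<And>v w. smooth_on S (\<lambda>z. b2 z v w)"
      "\<And>v w. smooth_on S (\<lambda>z. b3 z v w)" "\<And>v w. smooth_on S (\<lambda>z. G z v w)"
    and f: "\<And>z. z \<in> S \<Longrightarrow> orthonormal_frame (G z) (f z)"
  shows "smooth_on S (\<lambda>z. \<Sum>i\<in>UNIV. \<Sum>j\<in>UNIV. \<Sum>k\<in>UNIV.
    b1 z (f z i) (f z k) * b2 z (f z k) (f z j) * b3 z (f z i) (f z j))"
proof -
  define \<gamma> where "\<gamma> z = transpose (\<chi> i. f z i) ** (\<chi> i. f z i)" for z
  have inv: "bilinear_matrix (G z) ** \<gamma> z = mat 1" if "z \<in> S" for z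
    unfolding \<gamma>_def by (rule orthonormal_frame_inverse[OF bil(4) f]; fact)
  have "smooth_on S (\<lambda>z. \<gamma> z *v axis j 1)" for j
  proof (rule smooth_on_solve[OF S, where A = "\<lambda>z. bilinear_matrix (G z)" and b = "\<lambda>z. axis j 1"])
    show "det (bilinear_matrix (G z)) \<noteq> 0" if "z \<in> S" for z
      using inv[OF that] by (metis det_I det_mul mult_zero_left zero_neq_one)
    show "bilinear_matrix (G z) *v (\<gamma> z *v axis j 1) = axis j 1" if "z \<in> S" for z
      by (simp add: matrix_vector_mul_assoc inv[OF that])
  qed (simp_all add: sm smooth_on_const)
  then have \<gamma>: "smooth_on S (\<lambda>z. \<gamma> z $ i $ j)" for i j
    using smooth_on_vec_nth[OF S, of "\<lambda>z. \<gamma> z *v axis j 1" i]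
    by (simp add: matrix_vector_mult_basis column_def)
  have "smooth_on S (\<lambda>z. trace (\<gamma> z ** bilinear_matrix (b1 z) ** \<gamma> z ** bilinear_matrix (b2 z) ** \<gamma> z
      ** transpose (bilinear_matrix (b3 z))))"
    unfolding trace_def
    by (intro smooth_on_sum smooth_on_matrix_mult S finite_UNIV \<gamma>) (simp_all add: sm transpose_def)
  then show ?thesis
    by (subst smooth_on_cong[OF S frame_sum_trace[OF bil(1-3)]]) (simp_all add: \<gamma>_def Let_def)
qed

section \<open>Maps between two Riemannian manifolds\<close>

locale riemannian_pair = M: riemannian A g + N: riemannian B h
  for A :: "('a::{t2_space, second_countable_topology}, 'm::finite) chart set" and g
    and B :: "('b::{t2_space, second_countable_topology}, 'n::finite) chart set" and h
begin

text \<open>A family of maps in a chart of the source, as a function of a pair of a parameter and a coordinate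
  vector.\<close>

abbreviation "in_source c U \<equiv> (\<lambda>z. U (fst z) (chart_inv c (snd z)))"

definition smooth_family :: "'r::euclidean_space set \<Rightarrow> ('r \<Rightarrow> 'a \<Rightarrow> 'b) \<Rightarrow> bool" where
  "smooth_family P U \<longleftrightarrow> open P \<and> (\<forall>c\<in>A. N.smooth_into (P \<times> snd c ` fst c) (in_source c U))"

definition smooth_section :: "('a \<Rightarrow> 'b) \<Rightarrow> ('a \<Rightarrow> real ^ 'n) \<Rightarrow> bool" where
  "smooth_section u W \<longleftrightarrow>
     (\<forall>c\<in>A. N.smooth_along (snd c ` fst c) (\<lambda>x. u (chart_inv c x)) (\<lambda>x. W (chart_inv c x)))"

definition smooth_fun :: "'r::euclidean_space set \<Rightarrow> ('r \<Rightarrow> 'a \<Rightarrow> real) \<Rightarrow> bool" where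
  "smooth_fun P F \<longleftrightarrow> open P \<and> (\<forall>c\<in>A. smooth_on (P \<times> snd c ` fst c) (in_source c F))"

text \<open>A family of linear maps from the tangent spaces of \<open>M\<close> to those of \<open>N\<close> over the points of \<open>U\<close>,
  smooth in the sense that constant coordinate vectors of \<open>M\<close> are sent to smooth components in \<open>N\<close>.\<close>

definition smooth_hom :: "'r::euclidean_space set \<Rightarrow> ('r \<Rightarrow> 'a \<Rightarrow> 'b) \<Rightarrow>
    ('r \<Rightarrow> 'a \<Rightarrow> real ^ 'm \<Rightarrow> real ^ 'n) \<Rightarrow> bool" where
  "smooth_hom P U L \<longleftrightarrow> (\<forall>r\<in>P. \<forall>p. linear (L r p)) \<and>
     (\<forall>c\<in>A. \<forall>d\<in>B. \<forall>v. smooth_on {z \<in> P \<times> snd c ` fst c. in_source c U z \<in> fst d}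
        (\<lambda>z. N.in_chart d (in_source c U z)
           (in_source c L z (change_chart c (chart_at A (chart_inv c (snd z))) (chart_inv c (snd z)) v))))"

lemma smooth_familyD:
  "smooth_family P U \<Longrightarrow> c \<in> A \<Longrightarrow> N.smooth_into (P \<times> snd c ` fst c) (in_source c U)"
  by (simp add: smooth_family_def)

lemma smooth_variation_family:
  fixes P :: "'r::euclidean_space set"
  assumes "smooth_variation A B K u P U" "open P"
  shows "smooth_family P U"
  unfolding smooth_family_def
proof (intro conjI ballI assms)
  fix c assume c: "c \<in> A"
  have "continuous_on (P \<times> snd c ` fst c) ((\<lambda>(r, p). U r p) \<circ> (\<lambda>z. (fst z, chart_inv c (snd z))))"
  proof (rule continuous_on_compose)
    show "continuous_on (P \<times> snd c ` fst c) (\<lambda>z. (fst z, chart_inv c (snd z)))"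
      by (intro continuous_intros continuous_on_compose2[OF M.continuous_chart(2)[OF c]]) auto
    show "continuous_on ((\<lambda>z. (fst z, chart_inv c (snd z))) ` (P \<times> snd c ` fst c)) (\<lambda>(r, p). U r p)"
      using assms(1) unfolding smooth_variation_def
      by (auto elim!: continuous_on_subset)
  qed
  moreover have "smooth_on {z \<in> P \<times> snd c ` fst c. in_source c U z \<in> fst d} (\<lambda>z. snd d (in_source c U z))"
    if "d \<in> B" for d
  proof -
    have "smooth_on {(r, x). r \<in> P \<and> x \<in> snd c ` fst c \<and> U r (chart_inv c x) \<in> fst d}
                  (\<lambda>(r, x). snd d (U r (chart_inv c x)))"
      using assms(1) c that unfolding smooth_variation_def by blast
    moreover have "{(r, x). r \<in> P \<and> x \<in> snd c ` fst c \<and> U r (chart_inv c x) \<in> fst d}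
        = {z \<in> P \<times> snd c ` fst c. in_source c U z \<in> fst d}" by auto
    ultimately show ?thesis by (simp add: case_prod_beta')
  qed
  ultimately show "N.smooth_into (P \<times> snd c ` fst c) (in_source c U)"
    unfolding N.smooth_into_def using assms(2) M.open_chart(2)[OF c]
    by (auto intro: open_Times simp: comp_def case_prod_beta')
qed

lemma smooth_map_into:
  assumes "smooth_map A B u" "c \<in> A"
  shows "N.smooth_into (snd c ` fst c) (\<lambda>x. u (chart_inv c x))"
  unfolding N.smooth_into_def
proof (intro conjI ballI M.open_chart assms)
  show "continuous_on (snd c ` fst c) (\<lambda>x. u (chart_inv c x))"
    using assms by (auto simp: smooth_map_def intro!: continuous_on_compose2[OF _ M.continuous_chart(2)])
  fix d assume "d \<in> B"
  then have "smooth_on (snd c ` (fst c \<inter> u -` fst d)) (\<lambda>x. snd d (u (chart_inv c x)))"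
    using assms by (auto simp: smooth_map_def comp_def)
  moreover have "snd c ` (fst c \<inter> u -` fst d) = {x \<in> snd c ` fst c. u (chart_inv c x) \<in> fst d}"
    unfolding M.chart_image_eq[OF assms(2) Int_lower1] using M.chart_chart_inv(2)[OF assms(2)] by auto
  ultimately show "smooth_on {x \<in> snd c ` fst c. u (chart_inv c x) \<in> fst d} (\<lambda>x. snd d (u (chart_inv c x)))"
    by simp
qed

lemma smooth_slice: "open S \<Longrightarrow> smooth_on S (\<lambda>x. (r, x))"
  by (intro smooth_on_Pair smooth_on_const smooth_on_id)

lemma smooth_on_snd: "open S \<Longrightarrow> smooth_on S (\<lambda>x. snd x)"
  by (intro smooth_on_linear[OF _ bounded_linear_snd] smooth_on_id)

lemma smooth_family_const:
  assumes "smooth_map A B u" "open P"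
  shows "smooth_family P (\<lambda>_. u)"
  unfolding smooth_family_def
proof (intro conjI ballI assms)
  fix c assume c: "c \<in> A"
  have o: "open (P \<times> snd c ` fst c)" using assms(2) M.open_chart(2)[OF c] by (rule open_Times)
  show "N.smooth_into (P \<times> snd c ` fst c) (\<lambda>z. u (chart_inv c (snd z)))"
    by (rule N.smooth_into_compose[OF smooth_map_into[OF assms(1) c] o smooth_on_snd[OF o]]) auto
qed

lemma smooth_family_at:
  assumes "smooth_family P U" "r \<in> P" "c \<in> A"
  shows "N.smooth_into (snd c ` fst c) (\<lambda>x. U r (chart_inv c x))"
  using N.smooth_into_compose[OF smooth_familyD[OF assms(1,3)] M.open_chart(2)[OF assms(3)]
      smooth_slice[OF M.open_chart(2)[OF assms(3)]], of r] assms(2) by auto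

lemma dirderiv_slice: "dirderiv v (\<lambda>x. (r, x)) x = (0, v)"
  by (rule has_derivative_imp_dirderiv) (auto intro!: derivative_eq_intros)

text \<open>The differential is defined by the preferred chart of the source; the chain rule allows any chart.\<close>

lemma differential_in_source:
  assumes "N.smooth_into (snd c ` fst c) (\<lambda>x. u (chart_inv c x))" "c \<in> A" "p \<in> fst c"
  shows "differential A B u p v = N.tangent (\<lambda>x. u (chart_inv c x)) (M.in_chart c p v) (snd c p)"
proof -
  let ?c = "chart_at A p"
  have c: "?c \<in> A" "p \<in> fst ?c" by (rule M.chart_at)+
  let ?S = "snd ?c ` (fst ?c \<inter> fst c)"
  note S = M.open_overlap[OF c(1) assms(2)]
  have p: "snd ?c p \<in> ?S" using c assms by auto
  have "differential A B u p v = dirderiv v (\<lambda>x. snd (chart_at B (u p)) (u (chart_inv ?c x))) (snd ?c p)"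
    by (simp add: differential_def dirderiv_def comp_def)
  also have "\<dots> = dirderiv v (\<lambda>x. snd (chart_at B (u p)) (u (chart_inv c (snd c (chart_inv ?c x))))) (snd ?c p)"
    by (rule dirderiv_cong_open[OF S p]) (use c assms in \<open>auto simp: M.chart_inv_chart\<close>)
  also have "\<dots> = N.tangent (\<lambda>x. u (chart_inv c (snd c (chart_inv ?c x)))) v (snd ?c p)"
    using assms c by (simp add: N.tangent_def M.chart_inv_chart)
  also have "\<dots> = N.tangent (\<lambda>x. u (chart_inv c x)) (dirderiv v (\<lambda>x. snd c (chart_inv ?c x)) (snd ?c p)) (snd c (chart_inv ?c (snd ?c p)))"
    by (rule N.tangent_compose[OF assms(1) M.transition_smooth[OF c(1) assms(2)] p])
      (use c assms in \<open>auto simp: M.chart_inv_chart\<close>)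
  finally show ?thesis using c by (simp add: change_chart_def dirderiv_def comp_def M.chart_inv_chart)
qed

lemma differential_family:
  assumes "smooth_family P U" "r \<in> P" "c \<in> A" "p \<in> fst c"
  shows "differential A B (U r) p v = N.tangent (in_source c U) (0, M.in_chart c p v) (r, snd c p)"
  using N.tangent_compose[OF smooth_familyD[OF assms(1,3)] smooth_slice[OF M.open_chart(2)[OF assms(3)]],
      of "snd c p" r "M.in_chart c p v"] assms
    differential_in_source[OF smooth_family_at[OF assms(1-3)] assms(3,4)]
  by (simp add: dirderiv_slice)

text \<open>In the preferred chart this is a comparison of definitions; other charts follow by the chain rule.\<close>

lemma induced_nabla_in_source:
  assumes u: "N.smooth_into (snd c ` fst c) (\<lambda>x. u (chart_inv c x))"
    and W: "N.smooth_along (snd c ` fst c) (\<lambda>x. u (chart_inv c x)) (\<lambda>x. W (chart_inv c x))"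
    and c': "c \<in> A" "p \<in> fst c"
  shows "induced_nabla A B h u p v W =
    N.cov (\<lambda>x. u (chart_inv c x)) (M.in_chart c p v) (\<lambda>x. W (chart_inv c x)) (snd c p)"
proof -
  let ?c = "chart_at A p"
  have c: "?c \<in> A" "p \<in> fst ?c" by (rule M.chart_at)+
  let ?S = "snd ?c ` (fst ?c \<inter> fst c)"
  note S = M.open_overlap[OF c(1) c'(1)]
  have p: "snd ?c p \<in> ?S" using c c' by auto
  have "induced_nabla A B h u p v W = N.cov (\<lambda>x. u (chart_inv ?c x)) v (\<lambda>x. W (chart_inv ?c x)) (snd ?c p)"
    using c by (simp add: induced_nabla_def N.cov_def Let_def covariant_def M.chart_inv_chart differential_def
        N.in_chart_preferred christoffel_def levi_civita_def dirderiv_def comp_def)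
  also have "\<dots> = N.cov (\<lambda>x. u (chart_inv c (snd c (chart_inv ?c x)))) v
      (\<lambda>x. W (chart_inv c (snd c (chart_inv ?c x)))) (snd ?c p)"
    by (rule N.cov_cong_open[OF S p]) (use c c' in \<open>auto simp: M.chart_inv_chart\<close>)
  also have "\<dots> = N.cov (\<lambda>x. u (chart_inv c x)) (dirderiv v (\<lambda>x. snd c (chart_inv ?c x)) (snd ?c p))
      (\<lambda>x. W (chart_inv c x)) (snd c (chart_inv ?c (snd ?c p)))"
    by (rule N.cov_compose[OF u W M.transition_smooth[OF c(1) c'(1)] p])
      (use c c' in \<open>auto simp: M.chart_inv_chart\<close>)
  finally show ?thesis using c by (simp add: change_chart_def dirderiv_def comp_def M.chart_inv_chart)
qed

lemma smooth_hom_differential: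
  assumes U: "smooth_family P U"
  shows "smooth_hom P U (\<lambda>r. differential A B (U r))"
  unfolding smooth_hom_def
proof (intro conjI ballI allI)
  fix r p assume r: "r \<in> P"
  let ?c = "chart_at A p"
  have c: "?c \<in> A" "p \<in> fst ?c" by (rule M.chart_at)+
  note Ur = smooth_family_at[OF U r c(1)]
  have "linear (\<lambda>v. N.tangent (\<lambda>x. U r (chart_inv ?c x)) v (snd ?c p))"
    unfolding N.tangent_def
    by (rule smooth_on_linear_dirderiv[OF N.smooth_into_chart[OF Ur N.chart_at(1)]])
      (use c N.chart_at(2) in auto)
  moreover have "differential A B (U r) p = (\<lambda>v. N.tangent (\<lambda>x. U r (chart_inv ?c x)) v (snd ?c p))"
    using differential_in_source[OF Ur c] by (intro ext) (simp add: M.in_chart_preferred)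
  ultimately show "linear (differential A B (U r) p)" by simp
next
  fix c d v assume c: "c \<in> A" and d: "d \<in> B"
  note Uc = smooth_familyD[OF U c]
  show "smooth_on {z \<in> P \<times> snd c ` fst c. in_source c U z \<in> fst d}
        (\<lambda>z. N.in_chart d (in_source c U z)
           (differential A B (U (fst z)) (chart_inv c (snd z))
             (change_chart c (chart_at A (chart_inv c (snd z))) (chart_inv c (snd z)) v)))"
    (is "smooth_on ?Z ?f")
  proof (subst smooth_on_cong[OF N.open_chart_preimage[OF Uc d]])
    fix z assume z: "z \<in> ?Z"
    then have z1: "fst z \<in> P" "chart_inv c (snd z) \<in> fst c" and z2: "(fst z, snd c (chart_inv c (snd z))) = z"
      using c by (auto simp: M.chart_inv_chart)
    show "?f z = dirderiv (0, v) (\<lambda>z. snd d (in_source c U z)) z"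
      unfolding differential_family[OF U z1(1) c z1(2)] z2 M.in_chart_inverse[OF c z1(2)]
      by (rule N.tangent_in_chart[OF Uc d]) (use z in auto)
  next
    show "smooth_on ?Z (dirderiv (0, v) (\<lambda>z. snd d (in_source c U z)))"
      by (intro smooth_on_dirderiv N.smooth_into_chart[OF Uc d])
  qed
qed

lemma smooth_hom_nabla:
  fixes P :: "'r::euclidean_space set"
  assumes u: "smooth_map A B u" and W: "smooth_section u W" and P: "open P"
  shows "smooth_hom P (\<lambda>_. u) (\<lambda>_ p v. induced_nabla A B h u p v W)"
  unfolding smooth_hom_def
proof (intro conjI ballI allI)
  fix r :: 'r and p
  let ?c = "chart_at A p" and ?d = "chart_at B (u p)"
  have c: "?c \<in> A" "p \<in> fst ?c" by (rule M.chart_at)+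
  have d: "?d \<in> B" "u p \<in> fst ?d" by (rule N.chart_at)+
  note uc = smooth_map_into[OF u c(1)]
  have Wc: "N.smooth_along (snd ?c ` fst ?c) (\<lambda>x. u (chart_inv ?c x)) (\<lambda>x. W (chart_inv ?c x))"
    using W c(1) by (simp add: smooth_section_def)
  interpret riemannian_domain "snd ?d ` fst ?d" "N.met ?d"
    by (rule N.riemannian_domain_chart[OF d(1) N.open_chart(2)[OF d(1)] order_refl])
  let ?x = "snd ?c p" and ?S = "{x \<in> snd ?c ` fst ?c. u (chart_inv ?c x) \<in> fst ?d}"
  have x: "?x \<in> ?S" and ux: "u (chart_inv ?c ?x) = u p" using c d by (auto simp: M.chart_inv_chart)
  have l1: "linear (\<lambda>v. dirderiv v (\<lambda>x. snd ?d (u (chart_inv ?c x))) ?x)"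
    by (rule smooth_on_linear_dirderiv[OF N.smooth_into_chart[OF uc d(1)] x])
  have l2: "linear (\<lambda>v. dirderiv v (\<lambda>x. N.in_chart ?d (u (chart_inv ?c x)) (W (chart_inv ?c x))) ?x)"
    by (rule smooth_on_linear_dirderiv[OF _ x]) (use Wc d in \<open>auto simp: N.smooth_along_def\<close>)
  have ud: "snd ?d (u p) \<in> snd ?d ` fst ?d" using d by auto
  have "linear (\<lambda>v. N.cov (\<lambda>x. u (chart_inv ?c x)) v (\<lambda>x. W (chart_inv ?c x)) ?x)"
    unfolding N.cov_def Let_def covariant_def ux
    by (intro linearI) (simp_all add: linear_add[OF l1] linear_add[OF l2] linear_scale[OF l1] linear_scale[OF l2]
        christoffel_simps[OF ud] algebra_simps)
  then show "linear (\<lambda>v. induced_nabla A B h u p v W)"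
    using induced_nabla_in_source[OF uc Wc c] by (simp add: M.in_chart_preferred)
next
  fix c d v assume c: "c \<in> A" and d: "d \<in> B"
  note uc = smooth_map_into[OF u c]
  have Wc: "N.smooth_along (snd c ` fst c) (\<lambda>x. u (chart_inv c x)) (\<lambda>x. W (chart_inv c x))"
    using W c by (simp add: smooth_section_def)
  have covc: "N.smooth_along (snd c ` fst c) (\<lambda>x. u (chart_inv c x))
      (N.cov (\<lambda>x. u (chart_inv c x)) v (\<lambda>x. W (chart_inv c x)))"
    by (rule N.smooth_along_cov[OF uc Wc])
  have o: "open (P \<times> snd c ` fst c)" using P M.open_chart(2)[OF c] by (rule open_Times)
  have "N.smooth_along (P \<times> snd c ` fst c) (\<lambda>z. u (chart_inv c (snd z)))
      (\<lambda>z. N.cov (\<lambda>x. u (chart_inv c x)) v (\<lambda>x. W (chart_inv c x)) (snd z))"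
    by (rule N.smooth_along_compose[OF uc covc o smooth_on_snd[OF o]]) auto
  then have sm: "smooth_on {z \<in> P \<times> snd c ` fst c. u (chart_inv c (snd z)) \<in> fst d}
      (\<lambda>z. N.in_chart d (u (chart_inv c (snd z))) (N.cov (\<lambda>x. u (chart_inv c x)) v (\<lambda>x. W (chart_inv c x)) (snd z)))"
    using d by (simp add: N.smooth_along_def)
  show "smooth_on {z \<in> P \<times> snd c ` fst c. u (chart_inv c (snd z)) \<in> fst d}
        (\<lambda>z. N.in_chart d (u (chart_inv c (snd z)))
           (induced_nabla A B h u (chart_inv c (snd z))
             (change_chart c (chart_at A (chart_inv c (snd z))) (chart_inv c (snd z)) v) W))"
    (is "smooth_on ?Z ?f")
  proof (subst smooth_on_cong[OF N.open_chart_preimage[OF smooth_familyD[OF smooth_family_const[OF u P] c] d]])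
    fix z assume z: "z \<in> ?Z"
    then have z1: "chart_inv c (snd z) \<in> fst c" and z2: "snd c (chart_inv c (snd z)) = snd z"
      using c by (auto simp: M.chart_inv_chart)
    show "?f z = N.in_chart d (u (chart_inv c (snd z)))
        (N.cov (\<lambda>x. u (chart_inv c x)) v (\<lambda>x. W (chart_inv c x)) (snd z))"
      unfolding induced_nabla_in_source[OF uc Wc c z1] M.in_chart_inverse[OF c z1] z2 ..
  qed (use sm in auto)
qed

text \<open>The energy density and the quadratic terms of the second variation all have this form, with
  differentials or covariant derivatives of sections for the \<open>L\<close>.\<close>

definition frame_sum where
  "frame_sum e U L1 L2 L3 L4 L5 L6 r p = (\<Sum>i\<in>UNIV. \<Sum>j\<in>UNIV. \<Sum>k\<in>UNIV.
     h (U r p) (L1 r p (e p i)) (L2 r p (e p k)) * h (U r p) (L3 r p (e p k)) (L4 r p (e p j))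
     * h (U r p) (L5 r p (e p i)) (L6 r p (e p j)))"

text \<open>The question is local, and in charts the vectors of the frame are replaced by coordinate vectors at
  the cost of the inverse metric.\<close>

lemma smooth_fun_frame_sum:
  fixes P :: "'r::euclidean_space set"
  assumes U: "smooth_family P U" and e: "\<And>p. orthonormal_frame (g p) (e p)"
    and L: "smooth_hom P U L1" "smooth_hom P U L2" "smooth_hom P U L3" "smooth_hom P U L4"
      "smooth_hom P U L5" "smooth_hom P U L6"
  shows "smooth_fun P (frame_sum e U L1 L2 L3 L4 L5 L6)"
  unfolding smooth_fun_def
proof (intro conjI ballI)
  show "open P" using U by (simp add: smooth_family_def)
  fix c assume c: "c \<in> A"
  note Uc = smooth_familyD[OF U c]
  let ?O = "P \<times> snd c ` fst c"
  show "smooth_on ?O (in_source c (frame_sum e U L1 L2 L3 L4 L5 L6))"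
  proof (rule smooth_on_local)
    fix z0 assume z0: "z0 \<in> ?O"
    let ?d = "chart_at B (in_source c U z0)"
    let ?S = "{z \<in> ?O. in_source c U z \<in> fst ?d}"
    have d: "?d \<in> B" "z0 \<in> ?S" using N.chart_at z0 by auto
    note S = N.open_chart_preimage[OF Uc d(1)]
    let ?p = "\<lambda>z. chart_inv c (snd z)"
    let ?t = "\<lambda>z. change_chart c (chart_at A (?p z)) (?p z)"
    define y where "y = (\<lambda>z. snd ?d (in_source c U z))"
    define f where "f = (\<lambda>(z :: 'r \<times> (real ^ 'm)) i. M.in_chart c (?p z) (e (?p z) i))"
    define l where "l = (\<lambda>L z v. N.in_chart ?d (in_source c U z) (in_source c L z (?t z v)))"
    interpret N: riemannian_domain "snd ?d ` fst ?d" "N.met ?d"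
      by (rule N.riemannian_domain_chart[OF d(1) N.open_chart(2)[OF d(1)] order_refl])
    interpret M: riemannian_domain "snd c ` fst c" "M.met c"
      by (rule M.riemannian_domain_chart[OF c M.open_chart(2)[OF c] order_refl])
    have y: "smooth_on ?S y" "y ` ?S \<subseteq> snd ?d ` fst ?d"
      unfolding y_def using N.smooth_into_chart[OF Uc d(1)] by auto
    have pz: "?p z \<in> fst c" "snd c (?p z) = snd z" "fst z \<in> P" "snd z \<in> snd c ` fst c" if "z \<in> ?S" for z
      using that c by (auto simp: M.chart_inv_chart)
    have tlin: "linear (?t z)" if "z \<in> ?S" for z
      using M.linear_change_chart[OF c M.chart_at(1) pz(1)[OF that] M.chart_at(2)] .
    have lin: "linear (l L z)" if "smooth_hom P U L" "z \<in> ?S" for L z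
    proof -
      have 1: "linear (in_source c L z)" using that(1) pz(3)[OF that(2)] by (auto simp: smooth_hom_def)
      have 2: "linear (N.in_chart ?d (in_source c U z))"
        by (rule N.in_chart_linear[OF d(1)]) (use that in auto)
      show ?thesis
        unfolding l_def using linear_compose[OF linear_compose[OF tlin[OF that(2)] 1] 2] by (simp add: comp_def)
    qed
    have lsm: "smooth_on ?S (\<lambda>z. l L z v)" if "smooth_hom P U L" for L v
      using that c d(1) unfolding smooth_hom_def l_def by blast
    let ?b = "\<lambda>L L' z v w. N.met ?d (y z) (l L z v) (l L' z w)"
    have bil: "bilinear (?b L L' z)" if "smooth_hom P U L" "smooth_hom P U L'" "z \<in> ?S" for L L' z
    proof -
      have yz: "y z \<in> snd ?d ` fst ?d" using y(2) that(3) by blast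
      show ?thesis
        unfolding bilinear_def
        using linear_compose[OF lin[OF that(2,3)] N.metric_linear(1)[OF yz]]
          linear_compose[OF lin[OF that(1,3)] N.metric_linear(2)[OF yz]] by (simp add: comp_def)
    qed
    have bsm: "smooth_on ?S (\<lambda>z. ?b L L' z v w)" if "smooth_hom P U L" "smooth_hom P U L'" for L L' v w
      by (rule N.metric_field_smooth[OF S y lsm[OF that(1)] lsm[OF that(2)]])
    have "smooth_on ?S (\<lambda>z. \<Sum>i\<in>UNIV. \<Sum>j\<in>UNIV. \<Sum>k\<in>UNIV.
        ?b L1 L2 z (f z i) (f z k) * ?b L3 L4 z (f z k) (f z j) * ?b L5 L6 z (f z i) (f z j))"
    proof (rule smooth_on_frame_sum[OF S, where G = "\<lambda>z. M.met c (snd z)"])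
      show "bilinear (M.met c (snd z))" if "z \<in> ?S" for z
        using M.metric_bilinear pz(4)[OF that] by blast
      show "smooth_on ?S (\<lambda>z. M.met c (snd z) v w)" for v w
        by (rule smooth_on_compose[OF S M.open_domain M.metric_smooth smooth_on_snd[OF S]]) auto
      show "orthonormal_frame (M.met c (snd z)) (f z)" if "z \<in> ?S" for z
        using e[of "?p z"] M.metric_in_chart_eq[OF c pz(1)[OF that]] pz(2)[OF that]
        by (simp add: orthonormal_frame_def f_def)
    qed (intro bil bsm L; assumption)+
    moreover have "in_source c (frame_sum e U L1 L2 L3 L4 L5 L6) z = (\<Sum>i\<in>UNIV. \<Sum>j\<in>UNIV. \<Sum>k\<in>UNIV.
        ?b L1 L2 z (f z i) (f z k) * ?b L3 L4 z (f z k) (f z j) * ?b L5 L6 z (f z i) (f z j))"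
      if z: "z \<in> ?S" for z
    proof -
      have "?t z (f z i) = e (?p z) i" for i
        unfolding f_def by (rule M.change_chart_inverse) (use c pz(1)[OF z] M.chart_at in auto)
      then have "?b L L' z (f z i) (f z k) = h (in_source c U z) (in_source c L z (e (?p z) i)) (in_source c L' z (e (?p z) k))"
        for L L' i k
        unfolding l_def y_def using N.metric_in_chart_eq[OF d(1), of "in_source c U z"] z by auto
      then show ?thesis by (simp add: frame_sum_def)
    qed
    ultimately have "smooth_on ?S (in_source c (frame_sum e U L1 L2 L3 L4 L5 L6))"
      by (subst smooth_on_cong[OF S])
    then show "\<exists>T. open T \<and> z0 \<in> T \<and> smooth_on T (in_source c (frame_sum e U L1 L2 L3 L4 L5 L6))"
      using S d(2) by blast
  qed
qed

end

section \<open>Change of variables for an arbitrary finite index type\<close>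

text \<open>The transformation formula is proved first for coordinates with a well-ordered index type.
  Tagging a finite type with a constructor gives an index type of the same size that can be
  well-ordered without imposing an order on the original one.\<close>

datatype 'a tagged = Tag (untag: 'a)

instance tagged :: (finite) finite
proof
  have eq: "UNIV = range (Tag :: 'a \<Rightarrow> 'a tagged)" by (rule sym, rule surjI[of Tag untag]) simp
  show "finite (UNIV :: 'a tagged set)" unfolding eq by (rule finite_imageI) simp
qed

definition index_rank :: "'a::finite \<Rightarrow> nat" where
  "index_rank = (SOME f. inj f)"

lemma inj_index_rank: "inj (index_rank :: 'a::finite \<Rightarrow> nat)"
proof -
  have "\<exists>f :: 'a \<Rightarrow> nat. inj f"
    using finite_imp_inj_to_nat_seg[of "UNIV :: 'a set"] by auto
  then show ?thesis unfolding index_rank_def by (rule someI_ex)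
qed

instantiation tagged :: (finite) wellorder
begin

definition less_eq_tagged :: "'a tagged \<Rightarrow> 'a tagged \<Rightarrow> bool" where
  "less_eq_tagged a b \<longleftrightarrow> index_rank (untag a) \<le> index_rank (untag b)"

definition less_tagged :: "'a tagged \<Rightarrow> 'a tagged \<Rightarrow> bool" where
  "less_tagged a b \<longleftrightarrow> index_rank (untag a) < index_rank (untag b)"

instance
proof
  fix a b c :: "'a tagged"
  show "a = b" if "a \<le> b" "b \<le> a"
  proof (rule tagged.expand, rule injD[OF inj_index_rank])
    show "index_rank (untag a) = index_rank (untag b)"
      using that unfolding less_eq_tagged_def by (rule order_antisym)
  qed
next
  fix P :: "'a tagged \<Rightarrow> bool" and a
  assume step: "\<And>x. (\<And>y. y < x \<Longrightarrow> P y) \<Longrightarrow> P x"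
  show "P a"
  proof (induction a rule: measure_induct_rule[of "\<lambda>a. index_rank (untag a)"])
    case (less x)
    show ?case by (rule step, rule less.IH) (simp only: less_tagged_def)
  qed
next
  fix a b c :: "'a tagged"
  show "a < b \<longleftrightarrow> a \<le> b \<and> \<not> b \<le> a" "a \<le> a" "a \<le> b \<or> b \<le> a"
    unfolding less_eq_tagged_def less_tagged_def by linarith+
  show "a \<le> c" if "a \<le> b" "b \<le> c"
    using that unfolding less_eq_tagged_def by (rule order_trans)
qed
end

definition retag :: "real ^ 'm::finite \<Rightarrow> real ^ 'm tagged" where
  "retag v = (\<chi> i. v $ untag i)"

definition detag :: "real ^ 'm tagged \<Rightarrow> real ^ 'm::finite" where
  "detag v = (\<chi> i. v $ Tag i)"

lemma detag_retag [simp]: "detag (retag v) = v" and retag_detag [simp]: "retag (detag w) = w"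
  by (simp_all add: retag_def detag_def vec_eq_iff)

lemma bij_untag: "bij untag"
  by (rule o_bij[of Tag]) auto

lemma bounded_linear_retag: "bounded_linear retag" and bounded_linear_detag: "bounded_linear detag"
  unfolding linear_conv_bounded_linear[symmetric]
  by (rule linearI; simp add: retag_def detag_def vec_eq_iff)+

lemma continuous_on_retag: "continuous_on X retag" and continuous_on_detag: "continuous_on Z detag"
  by (rule linear_continuous_on, rule bounded_linear_retag bounded_linear_detag)+

text \<open>The bijection of the index sets conjugates permutations and preserves their signs.\<close>

lemma det_reindex:
  fixes f :: "'k::finite \<Rightarrow> 'm::finite" and A :: "real ^ 'm ^ 'm"
  assumes "bij f"
  shows "det (\<chi> i j. A $ f i $ f j) = det A"
proof -
  let ?q = "\<lambda>\<pi> x. if x \<in> UNIV then f (\<pi> (inv_into UNIV f x)) else x"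
  have "det A = (\<Sum>\<pi> | \<pi> permutes (UNIV :: 'k set). of_int (sign (?q \<pi>)) * (\<Prod>i\<in>UNIV. A $ i $ ?q \<pi> i))"
    unfolding det_def using sum.reindex_bij_betw[OF bij_betw_permutations[OF assms], symmetric] .
  also have "\<dots> = (\<Sum>\<pi> | \<pi> permutes (UNIV :: 'k set). of_int (sign \<pi>) * (\<Prod>i\<in>UNIV. A $ f i $ f (\<pi> i)))"
  proof (rule sum.cong[OF refl])
    fix \<pi> assume "\<pi> \<in> {\<pi>. \<pi> permutes (UNIV :: 'k set)}"
    then have "sign (map_permutation UNIV f \<pi>) = sign \<pi>"
      by (intro sign_map_permutation bij_is_inj[OF assms]) simp_all
    moreover have "map_permutation UNIV f \<pi> = ?q \<pi>"
      by (simp add: map_permutation_def restrict_id_def comp_def bij_is_surj[OF assms])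
    moreover have "(\<Prod>i\<in>UNIV. A $ i $ ?q \<pi> i) = (\<Prod>i\<in>UNIV. A $ f i $ f (\<pi> i))"
      using prod.reindex_bij_betw[OF assms, of "\<lambda>i. A $ i $ ?q \<pi> i", symmetric]
      by (simp add: inv_f_f[OF bij_is_inj[OF assms]])
    ultimately show "of_int (sign (?q \<pi>)) * (\<Prod>i\<in>UNIV. A $ i $ ?q \<pi> i) =
        of_int (sign \<pi>) * (\<Prod>i\<in>UNIV. A $ f i $ f (\<pi> i))" by simp
  qed
  finally show ?thesis by (simp add: det_def)
qed

lemma det_matrix_retag:
  fixes L :: "real ^ 'm::finite \<Rightarrow> real ^ 'm"
  shows "det (matrix (\<lambda>w. retag (L (detag w)))) = det (matrix L)"
proof -
  have "detag (axis j 1) = axis (untag j) 1" for j :: "'m tagged"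
    by (auto simp: detag_def axis_def vec_eq_iff)
  then have "matrix (\<lambda>w. retag (L (detag w))) = (\<chi> i j. matrix L $ untag i $ untag j)"
    by (simp add: matrix_def retag_def)
  then show ?thesis by (simp add: det_reindex[OF bij_untag])
qed

lemma retag_measurable [measurable]: "retag \<in> borel_measurable borel" "detag \<in> borel_measurable borel"
  by (rule borel_measurable_continuous_onI, rule continuous_on_retag continuous_on_detag)+

text \<open>Relabelling the coordinates maps boxes to boxes with the same side lengths.\<close>

lemma lborel_retag: "distr lborel borel retag = (lborel :: (real ^ 'm::finite tagged) measure)"
proof (rule lborel_eqI[symmetric])
  fix l u :: "real ^ 'm tagged"
  assume le: "\<And>b. b \<in> Basis \<Longrightarrow> l \<bullet> b \<le> u \<bullet> b"
  have le': "l $ i \<le> u $ i" for i using le[of "axis i 1"] by (simp add: inner_axis axis_in_Basis_iff)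
  have vim: "retag -` box l u = box (detag l) (detag u)"
  proof (rule set_eqI)
    fix v
    have "(\<forall>i. l $ i < v $ untag i \<and> v $ untag i < u $ i) \<longleftrightarrow> (\<forall>i. l $ Tag i < v $ i \<and> v $ i < u $ Tag i)"
    proof (intro iffI allI)
      fix i
      show "l $ Tag i < v $ i \<and> v $ i < u $ Tag i" if "\<forall>i. l $ i < v $ untag i \<and> v $ untag i < u $ i"
        using that[rule_format, of "Tag i"] by simp
    next
      fix i
      show "l $ i < v $ untag i \<and> v $ untag i < u $ i" if "\<forall>i. l $ Tag i < v $ i \<and> v $ i < u $ Tag i"
        using that[rule_format, of "untag i"] by simp
    qed
    then show "v \<in> retag -` box l u \<longleftrightarrow> v \<in> box (detag l) (detag u)"
      by (simp add: mem_box_cart retag_def detag_def)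
  qed
  have prod_eq: "(\<Prod>b\<in>Basis. (v :: real ^ 'k::finite) \<bullet> b) = (\<Prod>i\<in>UNIV. v $ i)" for v
  proof -
    have inj: "inj (\<lambda>i. axis i 1 :: real ^ 'k)" by (auto simp: inj_on_def axis_eq_axis)
    have B: "(Basis :: (real ^ 'k) set) = (\<lambda>i. axis i 1) ` UNIV" by (auto simp: Basis_vec_def)
    show ?thesis unfolding B by (subst prod.reindex[OF inj]) (simp add: inner_axis)
  qed
  have "emeasure (distr lborel borel retag) (box l u) = emeasure lborel (box (detag l) (detag u))"
    by (subst emeasure_distr) (simp_all add: vim)
  also have "\<dots> = (\<Prod>b\<in>Basis. (detag u - detag l) \<bullet> b)"
    by (subst emeasure_lborel_box) (auto simp: Basis_vec_def inner_axis detag_def le')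
  also have "(\<Prod>b\<in>Basis. (detag u - detag l) \<bullet> b) = (\<Prod>i\<in>UNIV. (u - l) $ Tag i)"
    by (subst prod_eq) (simp add: detag_def)
  also have "\<dots> = (\<Prod>i\<in>UNIV. (u - l) $ i)"
    by (rule prod.reindex_bij_betw) (rule o_bij[of untag], auto)
  also have "\<dots> = (\<Prod>b\<in>Basis. (u - l) \<bullet> b)"
    by (rule prod_eq[symmetric])
  finally show "emeasure (distr lborel borel retag) (box l u) = (\<Prod>b\<in>Basis. (u - l) \<bullet> b)" .
qed simp

lemma borel_image_of_inverse:
  fixes \<psi> :: "'a::topological_space \<Rightarrow> 'b::topological_space"
  assumes "open (\<psi> ` S)" "continuous_on (\<psi> ` S) \<phi>" "\<And>x. x \<in> S \<Longrightarrow> \<phi> (\<psi> x) = x"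
    and T: "T \<in> sets borel" "T \<subseteq> S"
  shows "\<psi> ` T \<in> sets borel"
proof -
  have "\<phi> -` T \<inter> space (restrict_space borel (\<psi> ` S)) \<in> sets (restrict_space borel (\<psi> ` S))"
    by (rule measurable_sets[OF borel_measurable_continuous_on_restrict[OF assms(2)] T(1)])
  moreover have "\<phi> -` T \<inter> space (restrict_space borel (\<psi> ` S)) = \<psi> ` T"
    using assms by (auto simp: space_restrict_space)
  ultimately show ?thesis
    using assms(1) by (auto simp: sets_restrict_space_iff)
qed

text \<open>Exhausting \<open>S\<close> by compact sets, it suffices to consider pieces on which the Jacobian is bounded;
  there both sides are finite and the transformation formula for integrals applies.\<close>

lemma emeasure_image_wellorder:
  fixes \<psi> :: "real ^ 'm::{finite,wellorder} \<Rightarrow> real ^ 'm::_"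
  assumes S: "open S" and der: "\<And>x. x \<in> S \<Longrightarrow> (\<psi> has_derivative \<psi>' x) (at x)"
    and cont: "continuous_on S (\<lambda>x. det (matrix (\<psi>' x)))"
    and inv: "open (\<psi> ` S)" "continuous_on (\<psi> ` S) \<phi>" "\<And>x. x \<in> S \<Longrightarrow> \<phi> (\<psi> x) = x"
    and T: "T \<in> sets borel" "T \<subseteq> S"
  shows "emeasure lborel (\<psi> ` T) = (\<integral>\<^sup>+x. ennreal \<bar>det (matrix (\<psi>' x))\<bar> * indicator T x \<partial>lborel)"
proof -
  define J where "J x = (if x \<in> S then \<bar>det (matrix (\<psi>' x))\<bar> else 0)" for x
  have J: "J \<in> borel_measurable borel"
    unfolding J_def using S cont
    by (intro borel_measurable_continuous_on_if continuous_on_rabs) auto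
  have Jpos: "0 \<le> J x" for x by (simp add: J_def)
  have inj: "inj_on \<psi> S" using inv(3) by (metis inj_onI)
  have bor: "\<psi> ` X \<in> sets borel" if "X \<in> sets borel" "X \<subseteq> S" for X
    by (rule borel_image_of_inverse[OF inv that])
  obtain C where C: "\<And>n. compact (C n)" "\<And>n. C n \<subseteq> S" "\<And>n. C n \<subseteq> interior (C (Suc n))" "\<Union>(range C) = S"
    using open_Union_compact_subsets[OF S] by metis
  have incC: "incseq C"
    by (rule incseq_SucI) (use C(3) interior_subset in blast)
  have piece: "emeasure lborel (\<psi> ` X) = (\<integral>\<^sup>+x. ennreal (J x) * indicator X x \<partial>lborel)"
    if X: "X \<in> sets borel" "X \<subseteq> C n" for X n
  proof -
    have XS: "X \<subseteq> S" using X C by blast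
    obtain b where b: "\<And>x. x \<in> C n \<Longrightarrow> \<bar>det (matrix (\<psi>' x))\<bar> \<le> b"
      using compact_imp_bounded[OF compact_continuous_image[OF continuous_on_subset[OF cont C(2)] C(1)], of n]
      unfolding bounded_iff by auto
    have "(\<integral>\<^sup>+x. ennreal (J x) * indicator X x \<partial>lborel) \<le> (\<integral>\<^sup>+x. ennreal b * indicator (C n) x \<partial>lborel)"
      by (intro nn_integral_mono)
        (use X b XS in \<open>auto simp: indicator_def J_def intro!: ennreal_leI\<close>)
    also have "\<dots> = ennreal b * emeasure lborel (C n)"
      by (subst nn_integral_cmult_indicator) (simp_all add: compact_imp_closed[OF C(1)] borel_closed)
    also have "\<dots> < \<infinity>"
      using emeasure_compact_finite[OF C(1)] by (simp add: ennreal_mult_less_top)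
    finally have fin: "(\<integral>\<^sup>+x. ennreal (J x) * indicator X x \<partial>lborel) < \<infinity>" .
    then obtain r where r: "r \<ge> 0" "(\<integral>\<^sup>+x. ennreal (J x) * indicator X x \<partial>lborel) = ennreal r"
      by (cases "(\<integral>\<^sup>+x. ennreal (J x) * indicator X x \<partial>lborel)") auto
    have eq: "(\<integral>\<^sup>+x. ennreal (J x * indicator X x) \<partial>lborel) = ennreal r"
      using r(2) by (simp add: ennreal_mult' J_def ennreal_indicator)
    have "has_bochner_integral lborel (\<lambda>x. J x * indicator X x) r"
      by (rule has_bochner_integral_nn_integral[OF _ _ r(1) eq]) (use J X Jpos in auto)
    then have "((\<lambda>x. J x * indicator X x) has_integral r) UNIV"
      using has_integral_integral_lborel[of "\<lambda>x. J x * indicator X x"] by (simp add: has_bochner_integral_iff)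
    then have "((\<lambda>x. if x \<in> X then \<bar>det (matrix (\<psi>' x))\<bar> else 0) has_integral r) UNIV"
      by (rule has_integral_eq[rotated]) (use XS in \<open>auto simp: J_def indicator_def\<close>)
    then have "((\<lambda>x. \<bar>det (matrix (\<psi>' x))\<bar>) has_integral r) X"
      by (simp only: has_integral_restrict_UNIV)
    moreover have "X \<in> sets lebesgue" using X by auto
    moreover have "(\<psi> has_derivative \<psi>' x) (at x within X)" if "x \<in> X" for x
      by (rule has_derivative_at_withinI[OF der]) (use that XS in auto)
    ultimately have m: "\<psi> ` X \<in> lmeasurable" "measure lebesgue (\<psi> ` X) = r"
      using has_measure_differentiable_image[of X \<psi> \<psi>' r] inj_on_subset[OF inj XS] by auto
    have "emeasure lebesgue (\<psi> ` X) = ennreal r"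
      using m emeasure_eq_measure2[of "\<psi> ` X" lebesgue] by (auto simp: fmeasurable_def)
    then show ?thesis using bor[OF X(1) XS] r(2) by simp
  qed
  define D where "D = density lborel (\<lambda>x. ennreal (J x))"
  have em: "emeasure D X = (\<integral>\<^sup>+x. ennreal (J x) * indicator X x \<partial>lborel)" if "X \<in> sets borel" for X
    unfolding D_def using J that by (subst emeasure_density) auto
  let ?X = "\<lambda>n. T \<inter> C n"
  have "C n \<in> sets borel" for n by (rule borel_closed[OF compact_imp_closed[OF C(1)]])
  then have Xs: "range ?X \<subseteq> sets borel" using T by auto
  have Xi: "incseq ?X" using incC by (auto simp: incseq_def)
  have XU: "(\<Union>n. ?X n) = T" using C(4) T by auto
  have "emeasure lborel (\<psi> ` T) = emeasure lborel (\<Union>n. \<psi> ` ?X n)"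
    using XU by (metis image_UN)
  also have "\<dots> = (SUP n. emeasure lborel (\<psi> ` ?X n))"
  proof (rule SUP_emeasure_incseq[symmetric])
    show "range (\<lambda>n. \<psi> ` ?X n) \<subseteq> sets lborel"
      using bor Xs T by auto
    show "incseq (\<lambda>n. \<psi> ` ?X n)"
      unfolding incseq_def by (intro allI impI image_mono incseqD[OF Xi])
  qed
  also have "\<dots> = (SUP n. emeasure D (?X n))"
    using Xs by (intro SUP_cong refl) (subst em, auto intro!: piece)
  also have "\<dots> = emeasure D (\<Union>n. ?X n)"
    by (rule SUP_emeasure_incseq) (use Xs Xi in \<open>auto simp: D_def\<close>)
  also have "\<dots> = (\<integral>\<^sup>+x. ennreal (J x) * indicator T x \<partial>lborel)"
    unfolding XU by (rule em[OF T(1)])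
  also have "\<dots> = (\<integral>\<^sup>+x. ennreal \<bar>det (matrix (\<psi>' x))\<bar> * indicator T x \<partial>lborel)"
    by (intro nn_integral_cong) (use T in \<open>auto simp: J_def indicator_def\<close>)
  finally show ?thesis .
qed

lemma emeasure_image:
  fixes \<psi> :: "real ^ 'm::finite \<Rightarrow> real ^ 'm"
  assumes S: "open S" and der: "\<And>x. x \<in> S \<Longrightarrow> (\<psi> has_derivative \<psi>' x) (at x)"
    and cont: "continuous_on S (\<lambda>x. det (matrix (\<psi>' x)))"
    and inv: "open (\<psi> ` S)" "continuous_on (\<psi> ` S) \<phi>" "\<And>x. x \<in> S \<Longrightarrow> \<phi> (\<psi> x) = x"
    and T: "T \<in> sets borel" "T \<subseteq> S"
  shows "emeasure lborel (\<psi> ` T) = (\<integral>\<^sup>+x. ennreal \<bar>det (matrix (\<psi>' x))\<bar> * indicator T x \<partial>lborel)"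
proof -
  have re: "retag ` X = detag -` X" for X :: "(real ^ 'm) set"
    by (auto simp: image_iff) (metis retag_detag)
  note cre = continuous_on_retag continuous_on_detag
  have ore: "open (retag ` X)" if "open X" for X :: "(real ^ 'm) set"
    unfolding re by (rule open_vimage[OF that continuous_on_detag])
  have bre: "retag ` X \<in> sets borel" if "X \<in> sets borel" for X :: "(real ^ 'm) set"
    unfolding re using measurable_sets[OF retag_measurable(2) that] by simp
  have ere: "emeasure lborel (retag ` X) = emeasure lborel X" if "X \<in> sets borel" for X :: "(real ^ 'm) set"
  proof -
    have "emeasure lborel (retag ` X) = emeasure (distr lborel borel retag) (retag ` X)"
      by (simp only: lborel_retag)
    also have "\<dots> = emeasure lborel (retag -` (retag ` X))"
      using bre[OF that] by (subst emeasure_distr) simp_all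
    also have "retag -` (retag ` X) = X" by (auto simp: re)
    finally show ?thesis .
  qed
  let ?\<psi> = "\<lambda>w. retag (\<psi> (detag w))" and ?\<psi>' = "\<lambda>w v. retag (\<psi>' (detag w) (detag v))"
  have img: "?\<psi> ` retag ` X = retag ` \<psi> ` X" for X
    by (auto simp: image_iff)
  have bor: "\<psi> ` T \<in> sets borel" by (rule borel_image_of_inverse[OF inv T])
  have "emeasure lborel (\<psi> ` T) = emeasure lborel (?\<psi> ` retag ` T)"
    unfolding img by (rule ere[OF bor, symmetric])
  also have "\<dots> = (\<integral>\<^sup>+w. ennreal \<bar>det (matrix (?\<psi>' w))\<bar> * indicator (retag ` T) w \<partial>lborel)"
  proof (rule emeasure_image_wellorder[where S = "retag ` S" and \<phi> = "\<lambda>w. retag (\<phi> (detag w))"])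
    show "open (retag ` S)" "open (?\<psi> ` retag ` S)" unfolding img by (intro ore S inv)+
    show "continuous_on (?\<psi> ` retag ` S) (\<lambda>w. retag (\<phi> (detag w)))"
      unfolding img
      by (intro continuous_on_compose2[OF continuous_on_retag[of UNIV]] continuous_on_compose2[OF inv(2) cre(2)]) auto
    show "continuous_on (retag ` S) (\<lambda>w. det (matrix (?\<psi>' w)))"
      unfolding det_matrix_retag by (intro continuous_on_compose2[OF cont cre(2)]) auto
    show "(?\<psi> has_derivative ?\<psi>' w) (at w)" if "w \<in> retag ` S" for w
    proof -
      have w: "detag w \<in> S" using that by auto
      have 1: "(detag has_derivative detag) (at w)" "(retag has_derivative retag) (at z)" for z :: "real ^ 'm"
        by (rule bounded_linear_imp_has_derivative, rule bounded_linear_detag bounded_linear_retag)+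
      show ?thesis
        by (rule has_derivative_compose[OF has_derivative_compose[OF 1(1) der[OF w]] 1(2)])
    qed
  qed (use inv(3) T bre in auto)
  also have "\<dots> = (\<integral>\<^sup>+w. ennreal \<bar>det (matrix (\<psi>' (detag w)))\<bar> * indicator T (detag w) \<partial>distr lborel borel retag)"
    unfolding det_matrix_retag lborel_retag re by (simp add: indicator_def)
  also have "\<dots> = (\<integral>\<^sup>+w. ennreal (if detag w \<in> S then \<bar>det (matrix (\<psi>' (detag w)))\<bar> else 0) * indicator T (detag w) \<partial>distr lborel borel retag)"
    by (intro nn_integral_cong) (use T in \<open>auto simp: indicator_def\<close>)
  also have "\<dots> = (\<integral>\<^sup>+x. ennreal (if x \<in> S then \<bar>det (matrix (\<psi>' x))\<bar> else 0) * indicator T x \<partial>lborel)"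
  proof -
    have [measurable]: "(\<lambda>x. if x \<in> S then \<bar>det (matrix (\<psi>' x))\<bar> else 0) \<in> borel_measurable borel"
      using S cont by (intro borel_measurable_continuous_on_if continuous_on_rabs) auto
    have [measurable]: "T \<in> sets borel" by fact
    show ?thesis by (subst nn_integral_distr) (simp_all cong: if_cong)
  qed
  also have "\<dots> = (\<integral>\<^sup>+x. ennreal \<bar>det (matrix (\<psi>' x))\<bar> * indicator T x \<partial>lborel)"
    by (intro nn_integral_cong) (use T in \<open>auto simp: indicator_def\<close>)
  finally show ?thesis .
qed

text \<open>The formula for the measure of images says that \<open>\<psi>\<close> maps the measure with density
  \<open>\<bar>det D\<psi>\<bar>\<close> on \<open>S\<close> to Lebesgue measure on the image; integrate \<open>f\<close> with respect to both.\<close>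

lemma nn_integral_image:
  fixes \<psi> :: "real ^ 'm::finite \<Rightarrow> real ^ 'm"
  assumes S: "open S" and der: "\<And>x. x \<in> S \<Longrightarrow> (\<psi> has_derivative \<psi>' x) (at x)"
    and cont: "continuous_on S (\<lambda>x. det (matrix (\<psi>' x)))"
    and inv: "open (\<psi> ` S)" "continuous_on (\<psi> ` S) \<phi>" "\<And>x. x \<in> S \<Longrightarrow> \<phi> (\<psi> x) = x"
    and f: "f \<in> borel_measurable borel"
  shows "(\<integral>\<^sup>+y. f y * indicator (\<psi> ` S) y \<partial>lborel) =
    (\<integral>\<^sup>+x. ennreal \<bar>det (matrix (\<psi>' x))\<bar> * f (\<psi> x) * indicator S x \<partial>lborel)"
proof -
  define J where "J x = (if x \<in> S then \<bar>det (matrix (\<psi>' x))\<bar> else 0)" for x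
  define \<psi>h where "\<psi>h x = (if x \<in> S then \<psi> x else 0)" for x
  have [measurable]: "J \<in> borel_measurable borel"
    unfolding J_def using S cont
    by (intro borel_measurable_continuous_on_if continuous_on_rabs) auto
  have "continuous_on S \<psi>"
    using der has_derivative_continuous by (intro continuous_at_imp_continuous_on) blast
  then have [measurable]: "\<psi>h \<in> borel_measurable borel"
    unfolding \<psi>h_def using S by (intro borel_measurable_continuous_on_if) auto
  note [measurable] = f
  have img: "\<psi> ` S \<in> sets borel" using inv(1) by (rule borel_open)
  define D where "D = density lborel (\<lambda>x. ennreal (J x))"
  have [simp]: "sets D = sets borel" "space D = UNIV" by (simp_all add: D_def)
  have [measurable]: "\<psi>h \<in> measurable D borel"
    using \<open>\<psi>h \<in> borel_measurable borel\<close> by (simp add: measurable_def)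
  have eq: "distr D borel \<psi>h = density lborel (indicator (\<psi> ` S))"
  proof (rule measure_eqI)
    fix Z assume "Z \<in> sets (distr D borel \<psi>h)"
    then have Z [measurable]: "Z \<in> sets borel" by simp
    have pre: "\<psi>h -` Z \<in> sets borel"
      using measurable_sets[OF \<open>\<psi>h \<in> borel_measurable borel\<close> Z] by simp
    have "emeasure (distr D borel \<psi>h) Z = (\<integral>\<^sup>+x. ennreal (J x) * indicator (\<psi>h -` Z) x \<partial>lborel)"
      using pre by (subst emeasure_distr) (auto simp: D_def emeasure_density)
    also have "\<dots> = (\<integral>\<^sup>+x. ennreal \<bar>det (matrix (\<psi>' x))\<bar> * indicator (S \<inter> \<psi>h -` Z) x \<partial>lborel)"
      by (intro nn_integral_cong) (auto simp: J_def indicator_def)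
    also have "\<dots> = emeasure lborel (\<psi> ` (S \<inter> \<psi>h -` Z))"
      by (rule emeasure_image[OF S der cont inv, symmetric]) (use pre borel_open[OF S] in auto)
    also have "\<psi> ` (S \<inter> \<psi>h -` Z) = \<psi> ` S \<inter> Z" by (auto simp: \<psi>h_def)
    also have "emeasure lborel (\<psi> ` S \<inter> Z) = emeasure (density lborel (indicator (\<psi> ` S))) Z"
      using img by (subst emeasure_density) (simp_all add: indicator_inter_arith[symmetric])
    finally show "emeasure (distr D borel \<psi>h) Z = emeasure (density lborel (indicator (\<psi> ` S))) Z" .
  qed simp
  have "(\<integral>\<^sup>+y. f y * indicator (\<psi> ` S) y \<partial>lborel) = (\<integral>\<^sup>+y. f y \<partial>density lborel (indicator (\<psi> ` S)))"
    using img by (subst nn_integral_density) (simp_all add: mult.commute)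
  also have "\<dots> = (\<integral>\<^sup>+x. f (\<psi>h x) \<partial>D)"
    unfolding eq[symmetric] by (rule nn_integral_distr) measurable
  also have "\<dots> = (\<integral>\<^sup>+x. ennreal (J x) * f (\<psi>h x) \<partial>lborel)"
    unfolding D_def by (rule nn_integral_density) measurable
  also have "\<dots> = (\<integral>\<^sup>+x. ennreal \<bar>det (matrix (\<psi>' x))\<bar> * f (\<psi> x) * indicator S x \<partial>lborel)"
    by (intro nn_integral_cong) (auto simp: J_def \<psi>h_def indicator_def)
  finally show ?thesis .
qed

section \<open>The Riemannian measure\<close>

context riemannian
begin

definition vol_density :: "('b, 'n) chart \<Rightarrow> real ^ 'n \<Rightarrow> real" where
  "vol_density c x = sqrt (det ((\<chi> i j. met c x (axis i 1) (axis j 1)) :: real ^ 'n ^ 'n))"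

definition chart_vol :: "('b, 'n) chart \<Rightarrow> 'b set \<Rightarrow> ennreal" where
  "chart_vol c S = (\<integral>\<^sup>+x. ennreal (vol_density c x) * indicator (snd c ` S) x \<partial>lborel)"

lemma continuous_vol_density:
  assumes "c \<in> B"
  shows "continuous_on (snd c ` fst c) (vol_density c)"
proof -
  interpret riemannian_domain "snd c ` fst c" "met c"
    by (rule riemannian_domain_chart[OF assms open_chart(2)[OF assms] order_refl])
  have "smooth_on (snd c ` fst c) (\<lambda>x. det ((\<chi> i j. met c x (axis i 1) (axis j 1)) :: real ^ 'n ^ 'n))"
    by (rule smooth_on_det[OF open_domain]) (simp add: metric_smooth)
  then show ?thesis
    unfolding vol_density_def[abs_def] by (intro continuous_on_real_sqrt smooth_on_continuous_on)
qed

text \<open>The matrices of the metric in the two charts are congruent by the Jacobian matrix of the transition.\<close>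

lemma vol_density_change_chart:
  assumes "c \<in> B" "d \<in> B" "p \<in> fst c" "p \<in> fst d"
  shows "vol_density c (snd c p) = \<bar>det (matrix (change_chart c d p))\<bar> * vol_density d (snd d p)"
proof -
  let ?G = "\<lambda>c. (\<chi> i j. met c (snd c p) (axis i 1) (axis j 1)) :: real ^ 'n ^ 'n"
  let ?t = "change_chart c d p"
  have eq: "met c (snd c p) v w = met d (snd d p) (?t v) (?t w)" for v w
    unfolding metric_in_chart_pull[OF assms(1,3)] metric_in_chart_pull[OF assms(2,4)]
    using change_chart_compose[OF assms(1,2) chart_at(1) assms(3,4) chart_at(2)] by simp
  interpret riemannian_domain "snd d ` fst d" "met d"
    by (rule riemannian_domain_chart[OF assms(2) open_chart(2)[OF assms(2)] order_refl])
  have bil: "bilinear (met d (snd d p))" by (rule metric_bilinear) (use assms in auto)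
  have F: "(\<chi> i. ?t (axis i 1)) = transpose (matrix ?t)"
    by (simp add: matrix_def transpose_def vec_eq_iff)
  have "?G c = transpose (matrix ?t) ** ?G d ** transpose (transpose (matrix ?t))"
    unfolding eq F[symmetric] by (rule bilinear_frame_matrix[OF bil])
  then have "det (?G c) = (det (matrix ?t))\<^sup>2 * det (?G d)"
    by (simp add: det_mul det_transpose power2_eq_square)
  then show ?thesis
    by (simp add: vol_density_def real_sqrt_mult)
qed

lemma vol_density_measurable:
  assumes "c \<in> B"
  shows "(\<lambda>x. if x \<in> snd c ` fst c then vol_density c x else 0) \<in> borel_measurable borel"
  using open_chart(2)[OF assms] continuous_vol_density[OF assms]
  by (intro borel_measurable_continuous_on_if) auto

lemma chart_image_borel:
  assumes "c \<in> B" "S \<in> sets borel" "S \<subseteq> fst c"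
  shows "snd c ` S \<in> sets borel"
  by (rule borel_image_of_inverse[OF open_chart(2)[OF assms(1)] continuous_chart(2)[OF assms(1)]
        chart_inv_chart[OF assms(1)] assms(2,3)])

text \<open>The factor by which the densities differ is the Jacobian of the transition, which the transformation
  formula absorbs.\<close>

lemma chart_vol_overlap:
  assumes "c \<in> B" "d \<in> B" "S \<in> sets borel" "S \<subseteq> fst c" "S \<subseteq> fst d"
  shows "chart_vol c S = chart_vol d S"
proof -
  let ?O = "snd c ` (fst c \<inter> fst d)" and ?\<psi> = "\<lambda>x. snd d (chart_inv c x)"
  let ?\<psi>' = "\<lambda>x v. dirderiv v ?\<psi> x"
  have sm: "smooth_on ?O ?\<psi>" by (rule transition_smooth[OF assms(1,2)])
  have O: "open ?O" by (rule open_overlap[OF assms(1,2)])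
  have img: "?\<psi> ` ?O = snd d ` (fst d \<inter> fst c)"
    unfolding image_image Int_commute[of "fst d"] by (rule image_cong) (use assms in \<open>auto simp: chart_inv_chart\<close>)
  define f where "f = (\<lambda>y. ennreal (if y \<in> snd d ` fst d then vol_density d y else 0) * indicator (snd d ` S) y)"
  have f: "f \<in> borel_measurable borel"
    unfolding f_def using vol_density_measurable[OF assms(2)] chart_image_borel[OF assms(2,3,5)] by measurable
  have "chart_vol d S = (\<integral>\<^sup>+y. f y * indicator (?\<psi> ` ?O) y \<partial>lborel)"
    unfolding chart_vol_def img by (intro nn_integral_cong) (use assms in \<open>auto simp: f_def indicator_def\<close>)
  also have "\<dots> = (\<integral>\<^sup>+x. ennreal \<bar>det (matrix (?\<psi>' x))\<bar> * f (?\<psi> x) * indicator ?O x \<partial>lborel)"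
  proof (rule nn_integral_image[OF O _ _ _ _ _ f])
    show "(?\<psi> has_derivative ?\<psi>' x) (at x)" if "x \<in> ?O" for x
      by (rule smooth_on_has_derivative[OF sm that])
    have "smooth_on ?O (\<lambda>x. det (matrix (?\<psi>' x)))"
      by (rule smooth_on_det[OF O]) (simp add: matrix_def, intro smooth_on_vec_nth O smooth_on_dirderiv sm)
    then show "continuous_on ?O (\<lambda>x. det (matrix (?\<psi>' x)))" by (rule smooth_on_continuous_on)
    show "open (?\<psi> ` ?O)" unfolding img by (rule open_overlap[OF assms(2,1)])
    show "continuous_on (?\<psi> ` ?O) (\<lambda>y. snd c (chart_inv d y))"
      unfolding img by (rule smooth_on_continuous_on[OF transition_smooth[OF assms(2,1)]])
    show "snd c (chart_inv d (?\<psi> x)) = x" if "x \<in> ?O" for x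
      using that assms by (auto simp: chart_inv_chart)
  qed
  also have "\<dots> = chart_vol c S"
    unfolding chart_vol_def
  proof (intro nn_integral_cong)
    fix x
    show "ennreal \<bar>det (matrix (?\<psi>' x))\<bar> * f (?\<psi> x) * indicator ?O x =
        ennreal (vol_density c x) * indicator (snd c ` S) x"
    proof (cases "x \<in> ?O")
      case True
      then obtain p where p: "p \<in> fst c" "p \<in> fst d" "x = snd c p" by auto
      have mem: "snd d p \<in> snd d ` S \<longleftrightarrow> p \<in> S" "snd c p \<in> snd c ` S \<longleftrightarrow> p \<in> S"
        using p assms inj_on_image_mem_iff[OF inj_on_chart] by blast+
      have "?\<psi>' x = change_chart c d p" by (simp add: p change_chart_dirderiv[abs_def])
      then show ?thesis
        using True p assms vol_density_change_chart[OF assms(1,2) p(1,2)]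
        by (simp add: f_def chart_inv_chart mem indicator_def ennreal_mult'[symmetric])
    next
      case False
      then have "x \<notin> snd c ` S" using assms by auto
      then show ?thesis using False by simp
    qed
  qed
  finally show ?thesis by simp
qed

lemma chart_vol_eq_emeasure:
  assumes "c \<in> B" "S \<in> sets borel" "S \<subseteq> fst c"
  shows "chart_vol c S = emeasure (density lborel
    (\<lambda>x. ennreal (if x \<in> snd c ` fst c then vol_density c x else 0))) (snd c ` S)"
proof -
  have "emeasure (density lborel
    (\<lambda>x. ennreal (if x \<in> snd c ` fst c then vol_density c x else 0))) (snd c ` S)
    = (\<integral>\<^sup>+x. ennreal (if x \<in> snd c ` fst c then vol_density c x else 0) * indicator (snd c ` S) x \<partial>lborel)"
    using vol_density_measurable[OF assms(1)] chart_image_borel[OF assms] by (subst emeasure_density) auto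
  also have "\<dots> = chart_vol c S"
    unfolding chart_vol_def by (intro nn_integral_cong) (use assms in \<open>auto simp: indicator_def\<close>)
  finally show ?thesis by simp
qed

lemma chart_vol_suminf:
  fixes S :: "nat \<Rightarrow> 'b set"
  assumes "c \<in> B" "\<And>i. S i \<in> sets borel" "\<And>i. S i \<subseteq> fst c" "disjoint_family S"
  shows "(\<Sum>i. chart_vol c (S i)) = chart_vol c (\<Union>i. S i)"
proof -
  have "disjoint_family (\<lambda>i. snd c ` S i)"
    unfolding disjoint_family_on_def
  proof (intro ballI impI)
    fix m n :: nat assume "m \<noteq> n"
    then have "S m \<inter> S n = {}" using assms(4) by (auto simp: disjoint_family_on_def)
    then show "snd c ` S m \<inter> snd c ` S n = {}"
      using inj_on_image_Int[OF inj_on_chart[OF assms(1)] assms(3)[of m] assms(3)[of n]] by auto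
  qed
  then show ?thesis
    using assms chart_image_borel[OF assms(1)]
    by (subst (1 2) chart_vol_eq_emeasure[OF assms(1)]) (auto simp: image_UN intro!: suminf_emeasure)
qed

lemma countable_atlas:
  obtains C :: "nat \<Rightarrow> ('b, 'n) chart" where "\<And>n. C n \<in> B" "(\<Union>n. fst (C n)) = UNIV"
proof -
  have op: "openin (top_of_set UNIV) S" if "S \<in> fst ` B" for S
    using that open_chart(1) by (auto simp: open_openin[symmetric])
  obtain F where F: "F \<subseteq> fst ` B" "countable F" "\<Union>F = \<Union>(fst ` B)"
    using Lindelof_openin[OF op] by blast
  have U: "\<Union>F = UNIV" using F(3) atlas by (auto simp: smooth_atlas_def)
  then have "F \<noteq> {}" by auto
  have "\<exists>c. c \<in> B \<and> fst c = from_nat_into F n" for n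
  proof -
    have "from_nat_into F n \<in> fst ` B" using from_nat_into[OF \<open>F \<noteq> {}\<close>] F(1) by blast
    then show ?thesis by (elim imageE) metis
  qed
  then obtain C where C: "\<And>n. C n \<in> B" "\<And>n. fst (C n) = from_nat_into F n" by metis
  have "(\<Union>n. fst (C n)) = UNIV"
    using range_from_nat_into[OF \<open>F \<noteq> {}\<close> F(2)] U C(2) by simp
  with C(1) that show ?thesis by blast
qed

text \<open>The measure is glued from the pieces that a countable family of charts adds one after the
  other; the transformation formula makes the result independent of the family.\<close>

lemma riemannian_volume:
  shows sets_riemannian_volume: "sets (riemannian_volume B h) = sets borel"
    and emeasure_riemannian_volume: "\<And>c S. c \<in> B \<Longrightarrow> S \<in> sets borel \<Longrightarrow> S \<subseteq> fst c \<Longrightarrow>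
      emeasure (riemannian_volume B h) S = chart_vol c S"
proof -
  let ?P = "\<lambda>\<mu> :: 'b measure. sets \<mu> = sets borel \<and>
     (\<forall>c\<in>B. \<forall>S\<in>sets borel. S \<subseteq> fst c \<longrightarrow> emeasure \<mu> S = chart_vol c S)"
  obtain C :: "nat \<Rightarrow> ('b, 'n) chart" where C: "\<And>n. C n \<in> B" "(\<Union>n. fst (C n)) = UNIV"
    using countable_atlas by blast
  define D where "D = disjointed (\<lambda>n. fst (C n))"
  have D: "D n \<in> sets borel" "D n \<subseteq> fst (C n)" for n
    unfolding D_def disjointed_def using open_chart(1)[OF C(1)] by (auto intro!: sets.Diff sets.finite_UN borel_open)
  have Ddis: "disjoint_family D" unfolding D_def by (rule disjoint_family_disjointed)
  have DU: "(\<Union>n. D n) = UNIV" unfolding D_def UN_disjointed_eq by (rule C(2))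
  have split: "S = (\<Union>n. S \<inter> D n)" for S using DU by blast
  have disS: "disjoint_family (\<lambda>n. S \<inter> D n)" for S using Ddis by (auto simp: disjoint_family_on_def)
  define vol where "vol S = (\<Sum>n. chart_vol (C n) (S \<inter> D n))" for S
  define \<mu> where "\<mu> = measure_of UNIV (sets borel) vol"
  have vol_chart: "vol S = chart_vol c S" if "c \<in> B" "S \<in> sets borel" "S \<subseteq> fst c" for c S
  proof -
    have "vol S = (\<Sum>n. chart_vol c (S \<inter> D n))"
      unfolding vol_def
      by (intro suminf_cong chart_vol_overlap C) (use that D in auto)
    also have "\<dots> = chart_vol c (\<Union>n. S \<inter> D n)"
      by (rule chart_vol_suminf[OF that(1) _ _ disS]) (use that D in auto)
    finally show ?thesis using split[of S] by simp
  qed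
  have sets\<mu>: "sets \<mu> = sets borel"
    unfolding \<mu>_def using sets.sigma_sets_eq[of "borel :: 'b measure"] by (simp add: sets_measure_of)
  have em\<mu>: "emeasure \<mu> S = vol S" if "S \<in> sets borel" for S
    unfolding \<mu>_def
  proof (rule emeasure_measure_of_sigma)
    show "sigma_algebra UNIV (sets (borel :: 'b measure))"
      using sets.sigma_algebra_axioms[of "borel :: 'b measure"] by simp
    show "positive (sets borel) vol" by (simp add: positive_def vol_def chart_vol_def)
    show "countably_additive (sets borel) vol"
      unfolding countably_additive_def
    proof (intro allI impI)
      fix X :: "nat \<Rightarrow> 'b set"
      assume X: "range X \<subseteq> sets borel" "disjoint_family X"
      have "(\<Sum>i. vol (X i)) = (\<Sum>i. \<integral>\<^sup>+n. chart_vol (C n) (X i \<inter> D n) \<partial>count_space UNIV)"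
        by (simp add: vol_def nn_integral_count_space_nat)
      also have "\<dots> = (\<integral>\<^sup>+n. (\<Sum>i. chart_vol (C n) (X i \<inter> D n)) \<partial>count_space UNIV)"
        by (rule nn_integral_suminf[symmetric]) simp
      also have "\<dots> = (\<integral>\<^sup>+n. chart_vol (C n) (\<Union>i. X i \<inter> D n) \<partial>count_space UNIV)"
        by (intro nn_integral_cong chart_vol_suminf C)
          (use X D(1) in \<open>auto simp: disjoint_family_on_def dest: subsetD[OF D(2)]\<close>)
      also have "\<dots> = vol (\<Union>i. X i)"
        by (simp add: vol_def nn_integral_count_space_nat)
      finally show "(\<Sum>i. vol (X i)) = vol (\<Union>i. X i)" .
    qed
  qed (rule that)
  have "?P \<mu>" using sets\<mu> em\<mu> vol_chart by simp
  moreover have "\<nu> = \<mu>" if "?P \<nu>" for \<nu>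
  proof (rule measure_eqI)
    show "sets \<nu> = sets \<mu>" using that sets\<mu> by simp
    fix S assume "S \<in> sets \<nu>"
    then have S: "S \<in> sets borel" using that by simp
    have "emeasure \<nu> S = emeasure \<nu> (\<Union>n. S \<inter> D n)" using split[of S] by simp
    also have "\<dots> = (\<Sum>n. emeasure \<nu> (S \<inter> D n))"
      by (rule suminf_emeasure[symmetric, OF _ disS]) (use that S D in auto)
    also have "\<dots> = (\<Sum>n. chart_vol (C n) (S \<inter> D n))"
    proof (rule suminf_cong)
      fix n
      show "emeasure \<nu> (S \<inter> D n) = chart_vol (C n) (S \<inter> D n)"
        by (rule that[THEN conjunct2, rule_format, OF C(1)]) (use S D in auto)
    qed
    finally show "emeasure \<nu> S = emeasure \<mu> S" using em\<mu>[OF S] by (simp add: vol_def)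
  qed
  ultimately have "riemannian_volume B h = \<mu>"
    unfolding riemannian_volume_def chart_vol_def vol_density_def by (intro the_equality) blast+
  then show "sets (riemannian_volume B h) = sets borel" "\<And>c S. c \<in> B \<Longrightarrow> S \<in> sets borel \<Longrightarrow> S \<subseteq> fst c \<Longrightarrow>
      emeasure (riemannian_volume B h) S = chart_vol c S"
    using \<open>?P \<mu>\<close> by auto
qed

text \<open>The density is bounded on a compact coordinate ball around each point, and finitely many balls cover
  the compact set.\<close>

lemma compact_finite_volume:
  assumes "compact K"
  shows "emeasure (riemannian_volume B h) K < \<infinity>"
proof -
  let ?\<mu> = "riemannian_volume B h"
  have "\<exists>W. open W \<and> p \<in> W \<and> emeasure ?\<mu> W < \<infinity>" for p
  proof -
    let ?c = "chart_at B p"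
    have c: "?c \<in> B" "p \<in> fst ?c" by (rule chart_at)+
    obtain r where r: "r > 0" "cball (snd ?c p) r \<subseteq> snd ?c ` fst ?c"
      using open_chart(2)[OF c(1)] c(2) unfolding open_contains_cball by blast
    define W where "W = {q \<in> fst ?c. snd ?c q \<in> ball (snd ?c p) r}"
    have "open W"
      using continuous_open_preimage[OF continuous_chart(1)[OF c(1)] open_chart(1)[OF c(1)] open_ball]
      by (simp add: W_def vimage_def Int_def conj_commute)
    have "bounded (vol_density ?c ` cball (snd ?c p) r)"
      by (intro compact_imp_bounded compact_continuous_image compact_cball
          continuous_on_subset[OF continuous_vol_density[OF c(1)] r(2)])
    then obtain b where "\<forall>y\<in>vol_density ?c ` cball (snd ?c p) r. \<bar>y\<bar> \<le> b"
      unfolding bounded_iff real_norm_def by blast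
    then have b: "\<bar>vol_density ?c x\<bar> \<le> b" if "x \<in> cball (snd ?c p) r" for x
      using that by blast
    have "emeasure ?\<mu> W = chart_vol ?c W"
      by (rule emeasure_riemannian_volume[OF c(1) borel_open[OF \<open>open W\<close>]]) (auto simp: W_def)
    also have "\<dots> \<le> (\<integral>\<^sup>+x. ennreal b * indicator (cball (snd ?c p) r) x \<partial>lborel)"
      unfolding chart_vol_def
    proof (intro nn_integral_mono)
      fix x
      show "ennreal (vol_density ?c x) * indicator (snd ?c ` W) x \<le> ennreal b * indicator (cball (snd ?c p) r) x"
        using b[of x] by (auto simp: indicator_def W_def intro!: ennreal_leI)
    qed
    also have "\<dots> = ennreal b * emeasure lborel (cball (snd ?c p) r)"
      by (rule nn_integral_cmult_indicator) simp
    also have "\<dots> < \<infinity>"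
      using emeasure_compact_finite[OF compact_cball[of "snd ?c p" r]] by (simp add: ennreal_mult_less_top)
    finally show ?thesis using \<open>open W\<close> c r(1) by (intro exI[of _ W]) (auto simp: W_def)
  qed
  then obtain W where W: "\<And>p. open (W p)" "\<And>p. p \<in> W p" "\<And>p. emeasure ?\<mu> (W p) < \<infinity>" by metis
  obtain F where F: "F \<subseteq> K" "finite F" "K \<subseteq> (\<Union>p\<in>F. W p)"
    using compactE_image[OF assms, of K W] W by blast
  have "emeasure ?\<mu> K \<le> emeasure ?\<mu> (\<Union>p\<in>F. W p)"
    using W(1) F by (intro emeasure_mono) (auto simp: sets_riemannian_volume intro!: borel_open)
  also have "\<dots> \<le> (\<Sum>p\<in>F. emeasure ?\<mu> (W p))"
    using W(1) F by (intro emeasure_subadditive_finite) (auto simp: sets_riemannian_volume intro!: borel_open)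
  also have "\<dots> < \<infinity>" using F(2) W(3) by (induction F rule: finite_induct) (auto simp: less_top[symmetric])
  finally show ?thesis .
qed

end

section \<open>Differentiation of the energy\<close>

context riemannian_pair
begin

abbreviation "vol \<equiv> riemannian_volume A g"

lemma smooth_funD: "smooth_fun P F \<Longrightarrow> c \<in> A \<Longrightarrow> smooth_on (P \<times> snd c ` fst c) (in_source c F)"
  by (simp add: smooth_fun_def)

lemma smooth_fun_open: "smooth_fun P F \<Longrightarrow> open P"
  by (simp add: smooth_fun_def)

lemma smooth_fun_continuous:
  assumes "smooth_fun P F"
  shows "continuous_on (P \<times> UNIV) (\<lambda>z. F (fst z) (snd z))"
proof -
  have U: "P \<times> UNIV = (\<Union>c\<in>A. P \<times> fst c)" using M.chart_at by blast
  show ?thesis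
    unfolding U
  proof (rule continuous_on_open_UN)
    fix c assume c: "c \<in> A"
    show "open (P \<times> fst c)"
      using smooth_fun_open[OF assms] M.open_chart(1)[OF c] by (rule open_Times)
    have "continuous_on (P \<times> fst c) (\<lambda>z. in_source c F (fst z, snd c (snd z)))"
      by (rule continuous_on_compose2[OF smooth_on_continuous_on[OF smooth_funD[OF assms c]]])
        (auto intro!: continuous_intros continuous_on_compose2[OF M.continuous_chart(1)[OF c]])
    then show "continuous_on (P \<times> fst c) (\<lambda>z. F (fst z) (snd z))"
      by (rule continuous_on_eq) (use c in \<open>auto simp: M.chart_inv_chart\<close>)
  qed
qed

lemma smooth_fun_continuous_at:
  assumes "smooth_fun P F" "r \<in> P"
  shows "continuous_on UNIV (F r)"
proof -
  have "continuous_on UNIV (\<lambda>p :: 'a. (r, p))" by (intro continuous_intros)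
  from continuous_on_compose2[OF smooth_fun_continuous[OF assms(1)] this] show ?thesis
    using assms(2) by auto
qed

lemma smooth_fun_parameter:
  assumes "smooth_fun P F"
  shows "smooth_on P (\<lambda>r. F r p)"
proof -
  let ?c = "chart_at A p"
  have c: "?c \<in> A" "p \<in> fst ?c" by (rule M.chart_at)+
  note P = smooth_fun_open[OF assms]
  have "smooth_on P (\<lambda>r. in_source ?c F (r, snd ?c p))"
    by (rule smooth_on_compose[OF P _ smooth_funD[OF assms c(1)]])
      (use c P M.open_chart(2)[OF c(1)] in \<open>auto intro!: open_Times smooth_on_Pair smooth_on_id smooth_on_const\<close>)
  then show ?thesis using c by (simp add: M.chart_inv_chart)
qed

lemma dirderiv_slice_left: "dirderiv v (\<lambda>r. (r, x)) r = (v, 0)"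
  by (rule has_derivative_imp_dirderiv) (auto intro!: derivative_eq_intros)

lemma smooth_fun_dirderiv:
  assumes "smooth_fun P F"
  shows "smooth_fun P (\<lambda>r p. dirderiv b (\<lambda>r. F r p) r)"
  unfolding smooth_fun_def
proof (intro conjI ballI)
  note P = smooth_fun_open[OF assms]
  show "open P" by (rule P)
  fix c assume c: "c \<in> A"
  note Fc = smooth_funD[OF assms c]
  have O: "open (P \<times> snd c ` fst c)" using P M.open_chart(2)[OF c] by (rule open_Times)
  show "smooth_on (P \<times> snd c ` fst c) (\<lambda>z. dirderiv b (\<lambda>r. F r (chart_inv c (snd z))) (fst z))"
  proof (subst smooth_on_cong[OF O])
    fix z assume z: "z \<in> P \<times> snd c ` fst c"
    have "dirderiv b (\<lambda>r. in_source c F (r, snd z)) (fst z)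
        = dirderiv (dirderiv b (\<lambda>r. (r, snd z)) (fst z)) (in_source c F) (fst z, snd z)"
      by (rule dirderiv_compose[OF Fc _ _, where S = P])
        (use z P in \<open>auto intro!: smooth_on_Pair smooth_on_id smooth_on_const\<close>)
    then show "dirderiv b (\<lambda>r. F r (chart_inv c (snd z))) (fst z) = dirderiv (b, 0) (in_source c F) z"
      by (simp add: dirderiv_slice_left)
  next
    show "smooth_on (P \<times> snd c ` fst c) (dirderiv (b, 0) (in_source c F))"
      by (rule smooth_on_dirderiv[OF Fc])
  qed
qed

lemma set_integrable_continuous:
  fixes f :: "'a \<Rightarrow> real"
  assumes "continuous_on UNIV f" "compact K"
  shows "set_integrable vol K f"
proof -
  have "compact (f ` K)"
    by (rule compact_continuous_image[OF continuous_on_subset[OF assms(1)] assms(2)]) simp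
  then obtain b where b: "\<forall>y\<in>f ` K. norm y \<le> b"
    using compact_imp_bounded bounded_iff by blast
  have "f \<in> borel_measurable vol"
    using borel_measurable_continuous_onI[OF assms(1)] measurable_cong_sets[OF M.sets_riemannian_volume refl] by blast
  then show ?thesis
    unfolding set_integrable_def
    by (intro integrableI_bounded_set_indicator[where B = b])
      (use b M.compact_finite_volume[OF assms(2)] compact_imp_closed[OF assms(2)] in
        \<open>auto simp: M.sets_riemannian_volume intro: borel_closed\<close>)
qed

text \<open>By the mean value theorem the difference quotients are bounded by the maximum of the derivative over a
  compact set of parameters and points, so dominated convergence applies.\<close>

lemma leibniz_compact:
  assumes F: "smooth_fun P F" and r: "r \<in> P" and K: "compact K"
  shows "((\<lambda>t. LINT p:K|vol. F (r + t *\<^sub>R b) p) has_real_derivative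
      (LINT p:K|vol. dirderiv b (\<lambda>r. F r p) r)) (at 0)"
proof -
  let ?G = "\<lambda>r p. dirderiv b (\<lambda>r. F r p) r"
  note P = smooth_fun_open[OF F]
  note G = smooth_fun_dirderiv[OF F, of b]
  have "open ((\<lambda>t. r + t *\<^sub>R b) -` P)"
    by (rule open_vimage[OF P]) (auto intro!: continuous_intros)
  then obtain d where d: "d > 0" "cball 0 d \<subseteq> (\<lambda>t. r + t *\<^sub>R b) -` P"
    using r unfolding open_contains_cball by force
  then have inP: "r + t *\<^sub>R b \<in> P" if "\<bar>t\<bar> \<le> d" for t using that by auto
  have "compact ((\<lambda>(t, p). (r + t *\<^sub>R b, p)) ` ({-d..d} \<times> K))"
    by (rule compact_continuous_image[OF _ compact_Times[OF compact_Icc K]])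
      (auto simp: case_prod_beta' intro!: continuous_intros)
  then have "compact ((\<lambda>z. ?G (fst z) (snd z)) ` ((\<lambda>(t, p). (r + t *\<^sub>R b, p)) ` ({-d..d} \<times> K)))"
    by (rule compact_continuous_image[rotated]) (rule continuous_on_subset[OF smooth_fun_continuous[OF G]], use inP in auto)
  then obtain C where "\<forall>y\<in>(\<lambda>z. ?G (fst z) (snd z)) ` ((\<lambda>(t, p). (r + t *\<^sub>R b, p)) ` ({-d..d} \<times> K)). norm y \<le> C"
    using compact_imp_bounded bounded_iff by blast
  then have C: "\<bar>?G (r + t *\<^sub>R b) p\<bar> \<le> C" if "\<bar>t\<bar> \<le> d" "p \<in> K" for t p
  proof -
    have "t \<in> {-d..d}" using that by auto
    with that \<open>\<forall>y\<in>_. norm y \<le> C\<close> show ?thesis by (simp add: image_image)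
  qed
  have der: "((\<lambda>t. F (r + t *\<^sub>R b) p) has_real_derivative ?G (r + t *\<^sub>R b) p) (at t)" if "\<bar>t\<bar> \<le> d" for t p
    by (rule smooth_on_line_derivative[OF smooth_fun_parameter[OF F] inP[OF that]])
  have quot: "\<bar>(F (r + t *\<^sub>R b) p - F r p) / t\<bar> \<le> C" if t: "\<bar>t\<bar> \<le> d" "t \<noteq> 0" and p: "p \<in> K" for t p
  proof -
    have "norm (F (r + t *\<^sub>R b) p - F (r + 0 *\<^sub>R b) p) \<le> C * norm (t - 0)"
      by (rule field_differentiable_bound[where S = "{-d..d}"])
        (use t p d C in \<open>auto intro!: DERIV_subset[OF der]\<close>)
    then show ?thesis using t by (simp add: abs_divide divide_le_eq)
  qed
  have Kset: "K \<in> sets vol" using compact_imp_closed[OF K] by (simp add: M.sets_riemannian_volume borel_closed)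
  let ?I = "\<lambda>t. LINT p:K|vol. F (r + t *\<^sub>R b) p"
  have int: "set_integrable vol K (F (r + t *\<^sub>R b))" if "\<bar>t\<bar> \<le> d" for t
    by (rule set_integrable_continuous[OF smooth_fun_continuous_at[OF F inP[OF that]] K])
  have intG: "set_integrable vol K (?G r)"
    by (rule set_integrable_continuous[OF smooth_fun_continuous_at[OF G r] K])
  show ?thesis
    unfolding DERIV_def
  proof (rule LIMSEQ_SEQ_conv[THEN iffD1], intro allI impI)
    fix X :: "nat \<Rightarrow> real" assume X: "(\<forall>n. X n \<noteq> 0) \<and> X \<longlonglongrightarrow> 0"
    then have "eventually (\<lambda>n. dist (X n) 0 < d) sequentially"
      using d(1) tendstoD by blast
    then obtain N where N: "\<And>n. n \<ge> N \<Longrightarrow> \<bar>X n\<bar> \<le> d"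
      unfolding eventually_sequentially by (auto simp: dist_real_def intro: less_imp_le)
    define Z where "Z n = X (n + N)" for n
    have Z: "\<bar>Z n\<bar> \<le> d" "Z n \<noteq> 0" for n using N[of "n + N"] X by (auto simp: Z_def)
    have Z0: "Z \<longlonglongrightarrow> 0" unfolding Z_def using X LIMSEQ_ignore_initial_segment by blast
    have lim: "(\<lambda>n. LINT p|vol. indicator K p *\<^sub>R ((F (r + Z n *\<^sub>R b) p - F r p) / Z n))
        \<longlonglongrightarrow> (LINT p|vol. indicator K p *\<^sub>R ?G r p)"
    proof (rule integral_dominated_convergence[where w = "\<lambda>p. indicator K p *\<^sub>R C"])
      show "(\<lambda>p. indicator K p *\<^sub>R ?G r p) \<in> borel_measurable vol"
        using intG unfolding set_integrable_def by (rule borel_measurable_integrable)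
      show "(\<lambda>p. indicator K p *\<^sub>R ((F (r + Z n *\<^sub>R b) p - F r p) / Z n)) \<in> borel_measurable vol" for n
        using set_integrable_divide[OF set_integral_diff(1)[OF int[OF Z(1)] int[of 0]], of "Z n"] d(1) Z(2)
        unfolding set_integrable_def by (auto intro: borel_measurable_integrable)
      show "integrable vol (\<lambda>p. indicator K p *\<^sub>R C)"
        using Kset M.compact_finite_volume[OF K] by (auto intro!: integrable_real_indicator)
      show "AE p in vol. (\<lambda>n. indicator K p *\<^sub>R ((F (r + Z n *\<^sub>R b) p - F r p) / Z n)) \<longlonglongrightarrow> indicator K p *\<^sub>R ?G r p"
      proof (intro AE_I2 tendsto_scaleR tendsto_const)
        fix p
        have "(\<lambda>h. (F (r + (0 + h) *\<^sub>R b) p - F (r + 0 *\<^sub>R b) p) / h) \<midarrow>0\<rightarrow> ?G (r + 0 *\<^sub>R b) p"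
          using der[of 0 p] d(1) by (simp add: DERIV_def)
        then have "(\<lambda>n. (F (r + (0 + Z n) *\<^sub>R b) p - F (r + 0 *\<^sub>R b) p) / Z n) \<longlonglongrightarrow> ?G (r + 0 *\<^sub>R b) p"
          using Z0 Z(2) by (intro LIMSEQ_SEQ_conv[THEN iffD2, rule_format]) auto
        then show "(\<lambda>n. (F (r + Z n *\<^sub>R b) p - F r p) / Z n) \<longlonglongrightarrow> ?G r p" by simp
      qed
      show "AE p in vol. norm (indicator K p *\<^sub>R ((F (r + Z n *\<^sub>R b) p - F r p) / Z n)) \<le> indicator K p *\<^sub>R C" for n
        using quot[OF Z(1) Z(2)] by (intro AE_I2) (auto simp: indicator_def)
    qed
    have eqn: "(LINT p|vol. indicator K p *\<^sub>R ((F (r + Z n *\<^sub>R b) p - F r p) / Z n)) = (?I (0 + Z n) - ?I 0) / Z n" for n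
    proof -
      have int0: "set_integrable vol K (F r)" using int[of 0] d(1) by simp
      have "(LINT p|vol. indicator K p *\<^sub>R ((F (r + Z n *\<^sub>R b) p - F r p) / Z n))
        = (LINT p|vol. (indicator K p *\<^sub>R (F (r + Z n *\<^sub>R b) p - F r p)) / Z n)" by simp
      also have "\<dots> = (LINT p:K|vol. F (r + Z n *\<^sub>R b) p - F r p) / Z n"
        unfolding set_lebesgue_integral_def by (rule integral_divide_zero)
      also have "(LINT p:K|vol. F (r + Z n *\<^sub>R b) p - F r p) = ?I (0 + Z n) - ?I 0"
        using set_integral_diff(2)[OF int[OF Z(1)] int0] by simp
      finally show ?thesis .
    qed
    have "(\<lambda>n. (?I (0 + X (n + N)) - ?I 0) / X (n + N)) \<longlonglongrightarrow> (LINT p:K|vol. ?G r p)"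
      using lim unfolding eqn unfolding set_lebesgue_integral_def[of vol K "?G r", symmetric] Z_def .
    then show "(\<lambda>n. (?I (0 + X n) - ?I 0) / X n) \<longlonglongrightarrow> (LINT p:K|vol. ?G r p)"
      by (rule LIMSEQ_offset)
  qed
qed

subsection \<open>Energy densities\<close>

abbreviation "du U r p \<equiv> differential A B (U r) p"

lemma d3_norm_sq_cyclic:
  "d3_norm_sq A B h f u p = (\<Sum>i\<in>UNIV. \<Sum>j\<in>UNIV. \<Sum>k\<in>UNIV.
     h (u p) (differential A B u p (f i)) (differential A B u p (f j))
     * h (u p) (differential A B u p (f j)) (differential A B u p (f k))
     * h (u p) (differential A B u p (f k)) (differential A B u p (f i)))"
proof -
  have lin: "linear (\<lambda>x. h q x y)" for q y
    using N.metric_point(1)[of q] by (simp add: bilinear_def)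
  have sum2: "h q (\<Sum>j\<in>UNIV. \<Sum>k\<in>UNIV. c j k *\<^sub>R x k) y = (\<Sum>j\<in>UNIV. \<Sum>k\<in>UNIV. c j k * h q (x k) y)"
    for q y and c :: "'m \<Rightarrow> 'm \<Rightarrow> real" and x
    by (simp only: linear_sum[OF lin] linear_scale[OF lin] real_scaleR_def)
  show ?thesis
    unfolding d3_norm_sq_def d3_def Let_def by (simp only: sum2)
qed

lemma d3_norm_sq_frame_sum:
  "d3_norm_sq A B h (e p) (U r) p = frame_sum e U (du U) (du U) (du U) (du U) (du U) (du U) r p"
proof -
  let ?h = "\<lambda>i j. h (U r p) (du U r p (e p i)) (du U r p (e p j))"
  have "d3_norm_sq A B h (e p) (U r) p = (\<Sum>i\<in>UNIV. \<Sum>j\<in>UNIV. \<Sum>k\<in>UNIV. ?h i j * ?h j k * ?h k i)"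
    by (rule d3_norm_sq_cyclic)
  also have "\<dots> = (\<Sum>i\<in>UNIV. \<Sum>j\<in>UNIV. \<Sum>k\<in>UNIV. ?h i k * ?h k j * ?h j i)"
    by (intro sum.cong refl sum.swap)
  also have "\<dots> = (\<Sum>i\<in>UNIV. \<Sum>j\<in>UNIV. \<Sum>k\<in>UNIV. ?h i k * ?h k j * ?h i j)"
  proof (intro sum.cong refl)
    show "?h i k * ?h k j * ?h j i = ?h i k * ?h k j * ?h i j" for i j k
      by (subst (3) N.metric_point(2)) (rule refl)
  qed
  finally show ?thesis by (simp only: frame_sum_def)
qed

lemma smooth_fun_energy_density:
  assumes U: "smooth_family P U" and e: "\<And>p. orthonormal_frame (g p) (e p)"
  shows "smooth_fun P (\<lambda>r p. d3_norm_sq A B h (e p) (U r) p / 6)"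
proof -
  let ?S = "frame_sum e U (du U) (du U) (du U) (du U) (du U) (du U)"
  have "smooth_fun P ?S"
    by (intro smooth_fun_frame_sum smooth_hom_differential U e)
  then have S: "smooth_fun P ?S" .
  have "smooth_on (P \<times> snd c ` fst c) (\<lambda>z. in_source c ?S z * inverse 6)" if "c \<in> A" for c
    by (rule smooth_on_mult[OF open_Times[OF smooth_fun_open[OF S] M.open_chart(2)[OF that]]
          smooth_funD[OF S that] smooth_on_const])
  then show ?thesis
    using smooth_fun_open[OF S] unfolding smooth_fun_def d3_norm_sq_frame_sum[of e _ U] divide_inverse by blast
qed

text \<open>The velocity of the curve traced out by a point when the parameter moves in direction \<open>b\<close>, and below
  its covariant derivative when the parameter moves in direction \<open>a\<close>.\<close>

definition variation_field :: "('r::euclidean_space \<Rightarrow> 'a \<Rightarrow> 'b) \<Rightarrow> 'r \<Rightarrow> 'r \<Rightarrow> 'a \<Rightarrow> real ^ 'n" where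
  "variation_field U b r p = N.tangent (\<lambda>r. U r p) b r"

definition mixed_field :: "('r::euclidean_space \<Rightarrow> 'a \<Rightarrow> 'b) \<Rightarrow> 'r \<Rightarrow> 'r \<Rightarrow> 'r \<Rightarrow> 'a \<Rightarrow> real ^ 'n" where
  "mixed_field U a b r p = N.cov (\<lambda>r. U r p) a (\<lambda>r. N.tangent (\<lambda>r. U r p) b r) r"

text \<open>The integrand of the first variation, \<open>\<Sum>\<^sub>i h(\<nabla>\<^sub>i W, d\<^sub>3u(e\<^sub>i))\<close>, with the definition of \<open>d\<^sub>3u\<close>
  written out.\<close>

definition pairing :: "('a \<Rightarrow> 'm \<Rightarrow> real ^ 'm) \<Rightarrow> ('a \<Rightarrow> 'b) \<Rightarrow> ('a \<Rightarrow> real ^ 'n) \<Rightarrow> 'a \<Rightarrow> real" where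
  "pairing e u W p = (\<Sum>i\<in>UNIV. \<Sum>j\<in>UNIV. \<Sum>k\<in>UNIV.
     h (u p) (induced_nabla A B h u p (e p i) W) (differential A B u p (e p k))
     * h (u p) (differential A B u p (e p k)) (differential A B u p (e p j))
     * h (u p) (differential A B u p (e p i)) (differential A B u p (e p j)))"

context
  fixes P :: "'r::euclidean_space set" and U :: "'r \<Rightarrow> 'a \<Rightarrow> 'b"
  assumes U: "smooth_family P U"
begin

lemma open_P: "open P"
  using U by (simp add: smooth_family_def)

lemma smooth_slice_left: "smooth_on P (\<lambda>r. (r, x))"
  by (intro smooth_on_Pair smooth_on_const smooth_on_id open_P)

lemma variation_field_in_source:
  assumes "c \<in> A" "p \<in> fst c" "r \<in> P"
  shows "variation_field U b r p = N.tangent (in_source c U) (b, 0) (r, snd c p)"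
  using N.tangent_compose[OF smooth_familyD[OF U assms(1)] smooth_slice_left assms(3), of "snd c p" b] assms
  by (simp add: variation_field_def dirderiv_slice_left M.chart_inv_chart)

lemma mixed_field_in_source:
  assumes "c \<in> A" "p \<in> fst c" "r \<in> P"
  shows "mixed_field U a b r p = N.cov (in_source c U) (a, 0) (N.tangent (in_source c U) (b, 0)) (r, snd c p)"
proof -
  note Uc = smooth_familyD[OF U assms(1)]
  have "mixed_field U a b r p = N.cov (\<lambda>r. in_source c U (r, snd c p)) a (\<lambda>r. N.tangent (in_source c U) (b, 0) (r, snd c p)) r"
    unfolding mixed_field_def
    by (rule N.cov_cong_open[OF open_P assms(3)])
      (use assms variation_field_in_source in \<open>auto simp: M.chart_inv_chart variation_field_def\<close>)
  also have "\<dots> = N.cov (in_source c U) (dirderiv a (\<lambda>r. (r, snd c p)) r) (N.tangent (in_source c U) (b, 0)) (r, snd c p)"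
    by (rule N.cov_compose[OF Uc N.smooth_along_tangent[OF Uc] smooth_slice_left assms(3)]) (use assms in auto)
  finally show ?thesis by (simp add: dirderiv_slice_left)
qed

lemma
  assumes W: "\<And>c. c \<in> A \<Longrightarrow> N.smooth_along (P \<times> snd c ` fst c) (in_source c U) (Wc c)"
    and eq: "\<And>c p. c \<in> A \<Longrightarrow> p \<in> fst c \<Longrightarrow> W p = Wc c (r, snd c p)" and r: "r \<in> P"
  shows smooth_section_slice: "smooth_section (U r) W"
    and induced_nabla_slice: "c \<in> A \<Longrightarrow> p \<in> fst c \<Longrightarrow> induced_nabla A B h (U r) p v W =
      N.cov (in_source c U) (0, M.in_chart c p v) (Wc c) (r, snd c p)"
proof -
  have sl: "N.smooth_along (snd c ` fst c) (\<lambda>x. U r (chart_inv c x)) (\<lambda>x. Wc c (r, x))" if "c \<in> A" for c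
    using N.smooth_along_compose[OF smooth_familyD[OF U that] W[OF that] M.open_chart(2)[OF that]
       smooth_slice[OF M.open_chart(2)[OF that]], of r] r by auto
  have Wx: "W (chart_inv c x) = Wc c (r, x)" if "c \<in> A" "x \<in> snd c ` fst c" for c x
    using eq[OF that(1) M.chart_chart_inv(2)[OF that]] M.chart_chart_inv(1)[OF that] by simp
  have al: "N.smooth_along (snd c ` fst c) (\<lambda>x. U r (chart_inv c x)) (\<lambda>x. W (chart_inv c x))" if c: "c \<in> A" for c
    unfolding N.smooth_along_def
  proof
    fix d assume d: "d \<in> B"
    show "smooth_on {x \<in> snd c ` fst c. U r (chart_inv c x) \<in> fst d}
        (\<lambda>x. N.in_chart d (U r (chart_inv c x)) (W (chart_inv c x)))"
      by (subst smooth_on_cong[OF N.open_chart_preimage[OF smooth_family_at[OF U r c] d],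
            where g = "\<lambda>x. N.in_chart d (U r (chart_inv c x)) (Wc c (r, x))"])
        (use sl[OF c] d Wx[OF c] in \<open>auto simp: N.smooth_along_def\<close>)
  qed
  then show "smooth_section (U r) W" by (simp add: smooth_section_def)
  show "induced_nabla A B h (U r) p v W = N.cov (in_source c U) (0, M.in_chart c p v) (Wc c) (r, snd c p)"
    if c: "c \<in> A" "p \<in> fst c"
  proof -
    have x: "snd c p \<in> snd c ` fst c" using c by auto
    have "induced_nabla A B h (U r) p v W
      = N.cov (\<lambda>x. U r (chart_inv c x)) (M.in_chart c p v) (\<lambda>x. W (chart_inv c x)) (snd c p)"
      by (rule induced_nabla_in_source[OF smooth_family_at[OF U r c(1)] al[OF c(1)] c])
    also have "\<dots> = N.cov (\<lambda>x. in_source c U (r, x)) (M.in_chart c p v) (\<lambda>x. Wc c (r, x)) (snd c p)"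
      by (rule N.cov_cong_open[OF M.open_chart(2)[OF c(1)] x]) (simp_all add: Wx[OF c(1)])
    also have "\<dots> = N.cov (in_source c U) (dirderiv (M.in_chart c p v) (\<lambda>x. (r, x)) (snd c p)) (Wc c) (r, snd c p)"
      by (rule N.cov_compose[OF smooth_familyD[OF U c(1)] W[OF c(1)] smooth_slice[OF M.open_chart(2)[OF c(1)]] x])
        (use r x in auto)
    finally show ?thesis by (simp add: dirderiv_slice)
  qed
qed

lemma smooth_section_variation: "r \<in> P \<Longrightarrow> smooth_section (U r) (variation_field U b r)"
  by (rule smooth_section_slice[where Wc = "\<lambda>c. N.tangent (in_source c U) (b, 0)"])
    (use variation_field_in_source N.smooth_along_tangent[OF smooth_familyD[OF U]] in auto)

lemma smooth_section_mixed: "r \<in> P \<Longrightarrow> smooth_section (U r) (mixed_field U a b r)"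
  by (rule smooth_section_slice[where Wc = "\<lambda>c. N.cov (in_source c U) (a, 0) (N.tangent (in_source c U) (b, 0))"])
    (use mixed_field_in_source N.smooth_along_cov[OF smooth_familyD[OF U] N.smooth_along_tangent[OF smooth_familyD[OF U]]] in auto)

end

end

section \<open>Variations of the energy density on manifolds\<close>

context riemannian_pair
begin

lemma curvature_riemann:
  "curvature B h q X Y Z = riemann (N.met (chart_at B q)) (snd (chart_at B q) q) X Y Z"
proof -
  let ?d = "chart_at B q"
  have d: "?d \<in> B" "q \<in> fst ?d" by (rule N.chart_at)+
  interpret D: riemannian_domain "snd ?d ` fst ?d" "N.met ?d"
    by (rule N.riemannian_domain_chart[OF d(1) N.open_chart(2)[OF d(1)] order_refl])
  have q: "snd ?d q \<in> snd ?d ` fst ?d" using d by auto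
  have lc: "levi_civita B h ?d = christoffel (N.met ?d)"
    by (intro ext) (simp add: levi_civita_def christoffel_def dirderiv_def)
  have fc: "frechet_derivative (\<lambda>_. z) (at y) = (\<lambda>_. 0)" for y z :: "real ^ 'n"
    using frechet_derivative_const by blast
  have na: "nabla_in_chart B h ?d (\<lambda>_. v) (\<lambda>_. w) = (\<lambda>y. christoffel (N.met ?d) y v w)" for v w
    by (intro ext) (simp add: nabla_in_chart_def lc fc)
  have zero: "christoffel (N.met ?d) (snd ?d q) 0 w = 0" for w
    by (rule bilinear_lzero[OF D.christoffel_bilinear[OF q]])
  have br: "lie_bracket (\<lambda>_. v) (\<lambda>_. w) = (\<lambda>_. 0)" for v w :: "real ^ 'n"
    by (intro ext) (simp add: lie_bracket_def fc)
  show ?thesis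
    unfolding curvature_def curvature_in_chart_def Let_def br na zero
    by (simp add: nabla_in_chart_def lc riemann_def dirderiv_def)
qed

context
  fixes P :: "'r::euclidean_space set" and U :: "'r \<Rightarrow> 'a \<Rightarrow> 'b" and r :: 'r and p :: 'a
    and e :: "'a \<Rightarrow> 'm \<Rightarrow> real ^ 'm"
  assumes U: "smooth_family P U" and r: "r \<in> P"
begin

text \<open>The point \<open>p\<close> is kept fixed, so its preferred chart and that at \<open>U r p\<close> can be used throughout, and
  the frame at \<open>p\<close> may be extended by constant coordinate vectors: only derivatives with respect to
  the parameters are taken, and these do not see the values at other points.\<close>

private abbreviation "c \<equiv> chart_at A p"
private abbreviation "d \<equiv> chart_at B (U r p)"
private abbreviation "x \<equiv> snd c p"
private abbreviation "y \<equiv> \<lambda>z. snd d (in_source c U z)"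
private abbreviation "\<Omega> \<equiv> {z \<in> P \<times> snd c ` fst c. in_source c U z \<in> fst d}"
private abbreviation "Q \<equiv> {r' \<in> P. U r' p \<in> fst d}"
private abbreviation f :: "'m \<Rightarrow> 'r \<times> (real ^ 'm)" where "f i \<equiv> (0, e p i)"
private abbreviation "S b z \<equiv> \<Sum>i\<in>UNIV. \<Sum>j\<in>UNIV. \<Sum>k\<in>UNIV.
    N.met d (y z) (covariant (N.met d) y (f i) (dirderiv (b, 0) y) z) (dirderiv (f k) y z)
    * N.met d (y z) (dirderiv (f k) y z) (dirderiv (f j) y z)
    * N.met d (y z) (dirderiv (f i) y z) (dirderiv (f j) y z)"

private lemma c: "c \<in> A" "p \<in> fst c" by (rule M.chart_at)+
private lemma d: "d \<in> B" "U r p \<in> fst d" by (rule N.chart_at)+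
private lemma Uc: "N.smooth_into (P \<times> snd c ` fst c) (in_source c U)" by (rule smooth_familyD[OF U c(1)])
private lemma \<Omega>: "open \<Omega>" by (rule N.open_chart_preimage[OF Uc d(1)])
private lemma y: "smooth_on \<Omega> y" "y ` \<Omega> \<subseteq> snd d ` fst d"
  using N.smooth_into_chart[OF Uc d(1)] by auto
private lemma dom: "riemannian_domain (snd d ` fst d) (N.met d)"
  by (rule N.riemannian_domain_chart[OF d(1) N.open_chart(2)[OF d(1)] order_refl])
private lemma QO: "r' \<in> Q \<longleftrightarrow> (r', x) \<in> \<Omega>"
  using c by (auto simp: M.chart_inv_chart)
private lemma Q: "open Q"
proof -
  have "open ((\<lambda>r'. (r', x)) -` \<Omega>)" by (rule open_vimage[OF \<Omega>]) (intro continuous_intros)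
  moreover have "(\<lambda>r'. (r', x)) -` \<Omega> = Q" using QO by blast
  ultimately show ?thesis by simp
qed
private lemma rQ: "r \<in> Q" using r d by simp
private lemma yr: "y (r', x) = snd d (U r' p)" using c by (simp add: M.chart_inv_chart)

text \<open>The following facts replace the intrinsic quantities at \<open>p\<close> by their coordinate expressions.\<close>

private lemma metric_transfer:
  "r' \<in> Q \<Longrightarrow> h (U r' p) v w = N.met d (y (r', x)) (N.in_chart d (U r' p) v) (N.in_chart d (U r' p) w)"
  using N.metric_in_chart_eq[OF d(1), of "U r' p" v w] unfolding yr by simp

private lemma differential_transfer:
  "r' \<in> Q \<Longrightarrow> N.in_chart d (U r' p) (du U r' p v) = dirderiv (0, v) y (r', x)"
  using differential_family[OF U _ c, of r' v] N.tangent_in_chart[OF Uc d(1), of "(r', x)" "(0, v)"] c QO[of r']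
  by (simp add: M.in_chart_preferred M.chart_inv_chart)

private lemma nabla_transfer:
  assumes al: "\<And>c. c \<in> A \<Longrightarrow> N.smooth_along (P \<times> snd c ` fst c) (in_source c U) (Wc c)"
    and eq: "\<And>c p. c \<in> A \<Longrightarrow> p \<in> fst c \<Longrightarrow> W p = Wc c (r, snd c p)"
    and loc: "\<And>z. z \<in> \<Omega> \<Longrightarrow> N.in_chart d (in_source c U z) (Wc c z) = w z"
  shows "N.in_chart d (U r p) (induced_nabla A B h (U r) p v W) = covariant (N.met d) y (0, v) w (r, x)"
proof -
  have z: "(r, x) \<in> \<Omega>" using rQ QO by simp
  have "N.in_chart d (U r p) (induced_nabla A B h (U r) p v W)
      = N.in_chart d (in_source c U (r, x)) (N.cov (in_source c U) (0, v) (Wc c) (r, x))"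
    using induced_nabla_slice[OF U al eq r c, of v] c by (simp add: M.in_chart_preferred M.chart_inv_chart)
  also have "\<dots> = covariant (N.met d) y (0, v) (\<lambda>z. N.in_chart d (in_source c U z) (Wc c z)) (r, x)"
    by (rule N.cov_in_chart[OF Uc al[OF c(1)] d(1)]) (use z in auto)
  also have "\<dots> = covariant (N.met d) y (0, v) w (r, x)"
    by (rule covariant_cong_open[OF \<Omega> z refl loc])
  finally show ?thesis .
qed

private lemma variation_transfer:
  "N.in_chart d (U r p) (induced_nabla A B h (U r) p v (variation_field U b r))
    = covariant (N.met d) y (0, v) (dirderiv (b, 0) y) (r, x)"
  by (rule nabla_transfer[where Wc = "\<lambda>c. N.tangent (in_source c U) (b, 0)"])
    (use N.smooth_along_tangent[OF smooth_familyD[OF U]] variation_field_in_source[OF U _ _ r]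
      N.tangent_in_chart[OF Uc d(1)] in auto)

private lemma mixed_transfer:
  "N.in_chart d (U r p) (induced_nabla A B h (U r) p v (mixed_field U a b r))
    = covariant (N.met d) y (0, v) (covariant (N.met d) y (a, 0) (dirderiv (b, 0) y)) (r, x)"
proof (rule nabla_transfer[where Wc = "\<lambda>c. N.cov (in_source c U) (a, 0) (N.tangent (in_source c U) (b, 0))"])
  show "N.smooth_along (P \<times> snd c ` fst c) (in_source c U) (N.cov (in_source c U) (a, 0) (N.tangent (in_source c U) (b, 0)))"
    if "c \<in> A" for c
    by (rule N.smooth_along_cov[OF smooth_familyD[OF U that] N.smooth_along_tangent[OF smooth_familyD[OF U that]]])
  show "mixed_field U a b r p = N.cov (in_source c U) (a, 0) (N.tangent (in_source c U) (b, 0)) (r, snd c p)"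
    if "c \<in> A" "p \<in> fst c" for c p
    by (rule mixed_field_in_source[OF U that r])
  fix z assume z: "z \<in> \<Omega>"
  have "N.in_chart d (in_source c U z) (N.cov (in_source c U) (a, 0) (N.tangent (in_source c U) (b, 0)) z)
    = covariant (N.met d) y (a, 0) (\<lambda>z. N.in_chart d (in_source c U z) (N.tangent (in_source c U) (b, 0) z)) z"
    by (rule N.cov_in_chart[OF Uc N.smooth_along_tangent[OF Uc] d(1)]) (use z in auto)
  also have "\<dots> = covariant (N.met d) y (a, 0) (dirderiv (b, 0) y) z"
    by (rule covariant_cong_open[OF \<Omega> z refl N.tangent_in_chart[OF Uc d(1)]]) auto
  finally show "N.in_chart d (in_source c U z) (N.cov (in_source c U) (a, 0) (N.tangent (in_source c U) (b, 0)) z)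
      = covariant (N.met d) y (a, 0) (dirderiv (b, 0) y) z" .
qed

private lemma slice_dirderiv:
  assumes "smooth_on \<Omega> (F :: 'r \<times> (real ^ 'm) \<Rightarrow> real)" "\<And>r'. r' \<in> Q \<Longrightarrow> G r' = F (r', x)" "r' \<in> Q"
  shows "dirderiv b G r' = dirderiv (b, 0) F (r', x)"
proof -
  have "dirderiv b G r' = dirderiv b (\<lambda>r'. F (r', x)) r'"
    by (rule dirderiv_cong_open[OF Q assms(3,2)])
  also have "\<dots> = dirderiv (dirderiv b (\<lambda>r'. (r', x)) r') F (r', x)"
    by (rule dirderiv_compose[where g = "\<lambda>r'. (r', x)", OF assms(1) QO[THEN iffD1, OF assms(3)] _ assms(3)])
      (intro smooth_on_Pair smooth_on_id smooth_on_const Q)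
  finally show ?thesis by (simp add: dirderiv_slice_left)
qed

private lemma first_variation_local:
  assumes r': "r' \<in> Q"
  shows "dirderiv b (\<lambda>r. d3_norm_sq A B h (e p) (U r) p / 6) r' = S b (r', x)"
proof -
  interpret D: riemannian_domain "snd d ` fst d" "N.met d" by (rule dom)
  let ?P = "\<lambda>i j z. N.met d (y z) (dirderiv (f i) y z) (dirderiv (f j) y z)"
  let ?F = "\<lambda>z. \<Sum>i\<in>UNIV. \<Sum>j\<in>UNIV. \<Sum>k\<in>UNIV. ?P i j z * ?P j k z * ?P k i z"
  have "smooth_on \<Omega> (?P i j)" for i j
    by (intro D.metric_field_smooth \<Omega> y smooth_on_dirderiv)
  then have F: "smooth_on \<Omega> ?F"
    by (intro smooth_on_sum smooth_on_mult \<Omega> finite)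
  have F6: "smooth_on \<Omega> (\<lambda>z. ?F z / 6)"
    by (rule smooth_on_linear[OF \<Omega> bounded_linear_divide F])
  have "dirderiv b (\<lambda>r. d3_norm_sq A B h (e p) (U r) p / 6) r' = dirderiv (b, 0) (\<lambda>z. ?F z / 6) (r', x)"
  proof (rule slice_dirderiv[OF F6 _ r'])
    fix r' assume r': "r' \<in> Q"
    show "d3_norm_sq A B h (e p) (U r') p / 6 = ?F (r', x) / 6"
      unfolding d3_norm_sq_cyclic metric_transfer[OF r'] differential_transfer[OF r'] ..
  qed
  also have "\<dots> = dirderiv (b, 0) ?F (r', x) / 6"
    by (rule dirderiv_linear[OF bounded_linear_divide F]) (use r' QO in simp)
  also have "\<dots> = S b (r', x)"
    using D.first_variation_density[OF \<Omega> y, of "(r', x)" "(b, 0)" f] r' QO by simp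
  finally show ?thesis .
qed

lemma first_variation_pointwise:
  "dirderiv b (\<lambda>r. d3_norm_sq A B h (e p) (U r) p / 6) r = pairing e (U r) (variation_field U b r) p"
  unfolding first_variation_local[OF rQ] pairing_def metric_transfer[OF rQ] differential_transfer[OF rQ]
    variation_transfer ..

lemma second_variation_pointwise:
  fixes a b :: 'r
  defines "V \<equiv> variation_field U a r" and "W \<equiv> variation_field U b r"
  defines "H \<equiv> h (U r p)" and "E \<equiv> \<lambda>i. du U r p (e p i)"
    and "DV \<equiv> \<lambda>i. induced_nabla A B h (U r) p (e p i) V"
    and "DW \<equiv> \<lambda>i. induced_nabla A B h (U r) p (e p i) W"
  shows "dirderiv a (\<lambda>r. dirderiv b (\<lambda>r. d3_norm_sq A B h (e p) (U r) p / 6) r) r =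
      (\<Sum>i\<in>UNIV. H (curvature B h (U r p) (V p) (E i) (W p)) (d3 A B h (e p) (U r) p (e p i)))
    + pairing e (U r) (mixed_field U a b r) p
    + (\<Sum>i\<in>UNIV. \<Sum>j\<in>UNIV. \<Sum>k\<in>UNIV. H (DV i) (DW k) * H (E k) (E j) * H (E i) (E j))
    + (\<Sum>i\<in>UNIV. \<Sum>j\<in>UNIV. \<Sum>k\<in>UNIV. H (DV i) (E k) * H (DW k) (E j) * H (E i) (E j))
    + (\<Sum>i\<in>UNIV. \<Sum>j\<in>UNIV. \<Sum>k\<in>UNIV. H (DV i) (E k) * H (E k) (DW j) * H (E i) (E j))
    + (\<Sum>i\<in>UNIV. \<Sum>j\<in>UNIV. \<Sum>k\<in>UNIV. H (DV i) (E k) * H (E k) (E j) * H (DW i) (E j))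
    + (\<Sum>i\<in>UNIV. \<Sum>j\<in>UNIV. \<Sum>k\<in>UNIV. H (DV i) (E k) * H (E k) (E j) * H (E i) (DW j))"
proof -
  interpret D: riemannian_domain "snd d ` fst d" "N.met d" by (rule dom)
  have z: "(r, x) \<in> \<Omega>" using rQ QO by simp
  have "smooth_on \<Omega> (S b)"
    by (intro smooth_on_sum smooth_on_mult D.metric_field_smooth D.covariant_smooth \<Omega> y smooth_on_dirderiv finite)
  then have "dirderiv a (\<lambda>r. dirderiv b (\<lambda>r. d3_norm_sq A B h (e p) (U r) p / 6) r) r = dirderiv (a, 0) (S b) (r, x)"
    by (rule slice_dirderiv[where F = "S b", OF _ first_variation_local rQ])
  moreover have curv: "N.in_chart d (U r p) (curvature B h (U r p) v v' v'') =
      riemann (N.met d) (y (r, x)) (N.in_chart d (U r p) v) (N.in_chart d (U r p) v') (N.in_chart d (U r p) v'')" for v v' v''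
    by (simp only: curvature_riemann yr N.in_chart_preferred)
  have var: "N.in_chart d (U r p) (variation_field U b r p) = dirderiv (b, 0) y (r, x)" for b
    using variation_field_in_source[OF U c r, of b] N.tangent_in_chart[OF Uc d(1), of "(r, x)" "(b, 0)"] z c
    by (simp add: M.chart_inv_chart)
  have sum2: "H v (\<Sum>j\<in>UNIV. \<Sum>k\<in>UNIV. t j k *\<^sub>R E k) = (\<Sum>j\<in>UNIV. \<Sum>k\<in>UNIV. t j k * H v (E k))"
    for v and t :: "'m \<Rightarrow> 'm \<Rightarrow> real"
  proof -
    have lin: "linear (H v)" using N.metric_point(1)[of "U r p"] by (simp add: H_def bilinear_def)
    show ?thesis by (simp only: linear_sum[OF lin] linear_scale[OF lin] real_scaleR_def)
  qed
  have T1: "(\<Sum>i\<in>UNIV. H (curvature B h (U r p) (V p) (E i) (W p)) (d3 A B h (e p) (U r) p (e p i))) =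
    (\<Sum>i\<in>UNIV. \<Sum>j\<in>UNIV. \<Sum>k\<in>UNIV. H (curvature B h (U r p) (V p) (E i) (W p)) (E k) * H (E k) (E j) * H (E i) (E j))"
  proof (rule sum.cong[OF refl])
    fix i
    have "d3 A B h (e p) (U r) p (e p i) = (\<Sum>j\<in>UNIV. \<Sum>k\<in>UNIV. (H (E i) (E j) * H (E j) (E k)) *\<^sub>R E k)"
      by (simp add: d3_def Let_def H_def E_def)
    then have "H (curvature B h (U r p) (V p) (E i) (W p)) (d3 A B h (e p) (U r) p (e p i)) =
      (\<Sum>j\<in>UNIV. \<Sum>k\<in>UNIV. H (E i) (E j) * H (E j) (E k) * H (curvature B h (U r p) (V p) (E i) (W p)) (E k))"
      by (simp only: sum2)
    also have "\<dots> = (\<Sum>j\<in>UNIV. \<Sum>k\<in>UNIV. H (curvature B h (U r p) (V p) (E i) (W p)) (E k) * H (E k) (E j) * H (E i) (E j))"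
    proof (intro sum.cong refl)
      fix j k
      have "H (E j) (E k) = H (E k) (E j)" unfolding H_def by (rule N.metric_point(2))
      then show "H (E i) (E j) * H (E j) (E k) * H (curvature B h (U r p) (V p) (E i) (W p)) (E k)
        = H (curvature B h (U r p) (V p) (E i) (W p)) (E k) * H (E k) (E j) * H (E i) (E j)" by simp
    qed
    finally show "H (curvature B h (U r p) (V p) (E i) (W p)) (d3 A B h (e p) (U r) p (e p i)) =
      (\<Sum>j\<in>UNIV. \<Sum>k\<in>UNIV. H (curvature B h (U r p) (V p) (E i) (W p)) (E k) * H (E k) (E j) * H (E i) (E j))" .
  qed
  note sv = D.second_variation_density[OF \<Omega> y z, of "(a, 0)" f "(b, 0)"]
  show ?thesis
    unfolding T1 unfolding H_def E_def DV_def DW_def V_def W_def pairing_def metric_transfer[OF rQ] curv var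
      differential_transfer[OF rQ] variation_transfer mixed_transfer
    using calculation sv by simp
qed

end

end

section \<open>The weak form of the harmonic map equation\<close>

context manifold
begin

lemma smooth_into_local:
  assumes "\<And>x. x \<in> S \<Longrightarrow> \<exists>T. x \<in> T \<and> T \<subseteq> S \<and> smooth_into T U"
  shows "smooth_into S U"
proof -
  obtain T where T: "\<And>x. x \<in> S \<Longrightarrow> x \<in> T x" "\<And>x. x \<in> S \<Longrightarrow> T x \<subseteq> S" "\<And>x. x \<in> S \<Longrightarrow> smooth_into (T x) U"
    using assms by metis
  have S: "S = (\<Union>x\<in>S. T x)" using T by blast
  have oT: "open (T x)" if "x \<in> S" for x by (rule open_smooth_into[OF T(3)[OF that]])
  show ?thesis
    unfolding smooth_into_def
  proof (intro conjI ballI)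
    show "open S" by (subst S) (use oT in blast)
    have "continuous_on (\<Union>x\<in>S. T x) U"
      by (rule continuous_on_open_UN) (use T(3) in \<open>auto simp: smooth_into_def\<close>)
    then show "continuous_on S U" using S by simp
    fix d assume d: "d \<in> B"
    show "smooth_on {x \<in> S. U x \<in> fst d} (\<lambda>x. snd d (U x))"
    proof (rule smooth_on_local)
      fix x assume x: "x \<in> {x \<in> S. U x \<in> fst d}"
      then have "smooth_on {x' \<in> T x. U x' \<in> fst d} (\<lambda>x. snd d (U x))" "open {x' \<in> T x. U x' \<in> fst d}"
        using smooth_into_chart[OF T(3) d] open_chart_preimage[OF T(3) d] by auto
      then show "\<exists>T. open T \<and> x \<in> T \<and> smooth_on T (\<lambda>x. snd d (U x))" using x T(1) by blast
    qed
  qed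
qed

lemma smooth_into_cong:
  assumes "smooth_into S U" "\<And>x. x \<in> S \<Longrightarrow> U x = U' x"
  shows "smooth_into S U'"
  unfolding smooth_into_def
proof (intro conjI ballI)
  show "open S" by (rule open_smooth_into[OF assms(1)])
  show "continuous_on S U'"
    using assms by (auto simp: smooth_into_def intro: continuous_on_eq)
  fix d assume d: "d \<in> B"
  have eq: "{x \<in> S. U' x \<in> fst d} = {x \<in> S. U x \<in> fst d}" using assms(2) by auto
  show "smooth_on {x \<in> S. U' x \<in> fst d} (\<lambda>x. snd d (U' x))"
    unfolding eq
    by (subst smooth_on_cong[OF open_chart_preimage[OF assms(1) d], where g = "\<lambda>x. snd d (U x)"])
      (use assms(2) smooth_into_chart[OF assms(1) d] in auto)
qed

lemma smooth_into_subset: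
  assumes "smooth_into S U" "open T" "T \<subseteq> S"
  shows "smooth_into T U"
  unfolding smooth_into_def
proof (intro conjI ballI assms)
  show "continuous_on T U" using assms by (auto simp: smooth_into_def intro: continuous_on_subset)
  fix d assume d: "d \<in> B"
  show "smooth_on {x \<in> T. U x \<in> fst d} (\<lambda>x. snd d (U x))"
    by (rule smooth_on_subset[OF smooth_into_chart[OF assms(1) d]]) (use assms(3) in auto)
qed

lemma smooth_into_chart_inv:
  assumes "open S" "smooth_on S w" "w ` S \<subseteq> snd d ` fst d" "d \<in> B"
  shows "smooth_into S (\<lambda>x. chart_inv d (w x))"
  unfolding smooth_into_def
proof (intro conjI ballI assms)
  show cont: "continuous_on S (\<lambda>x. chart_inv d (w x))"
    by (rule continuous_on_compose2[OF continuous_chart(2)[OF assms(4)] smooth_on_continuous_on[OF assms(2)] assms(3)])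
  fix d' assume d': "d' \<in> B"
  have o: "open {x \<in> S. chart_inv d (w x) \<in> fst d'}"
    using continuous_open_preimage[OF cont assms(1) open_chart(1)[OF d']]
    by (simp add: vimage_def Int_def conj_commute)
  show "smooth_on {x \<in> S. chart_inv d (w x) \<in> fst d'} (\<lambda>x. snd d' (chart_inv d (w x)))"
  proof (rule smooth_on_compose[OF o open_overlap[OF assms(4) d'] transition_smooth[OF assms(4) d']])
    show "smooth_on {x \<in> S. chart_inv d (w x) \<in> fst d'} w" by (rule smooth_on_subset[OF assms(2)]) auto
    show "w ` {x \<in> S. chart_inv d (w x) \<in> fst d'} \<subseteq> snd d ` (fst d \<inter> fst d')"
      using assms(3) chart_chart_inv[OF assms(4)] by (force simp: image_iff)
  qed
qed

definition smooth_scalar :: "('b \<Rightarrow> real) \<Rightarrow> bool" where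
  "smooth_scalar \<phi> \<longleftrightarrow> (\<forall>c\<in>B. smooth_on (snd c ` fst c) (\<lambda>x. \<phi> (chart_inv c x)))"

text \<open>A cut-off function in a chart, extended by zero. The extension is smooth because the support is
  compact and hence closed in the manifold.\<close>

lemma bump_function_exists:
  assumes "open G" "p \<in> G"
  obtains \<phi> W K where "smooth_scalar \<phi>" "open W" "p \<in> W" "\<And>q. q \<in> W \<Longrightarrow> \<phi> q = 1"
    "compact K" "K \<subseteq> G" "\<And>q. q \<notin> K \<Longrightarrow> \<phi> q = 0"
proof -
  let ?c = "chart_at B p"
  have c: "?c \<in> B" "p \<in> fst ?c" by (rule chart_at)+
  have "open (snd ?c ` (fst ?c \<inter> G))" by (intro open_chart_image c open_Int open_chart assms) auto
  then obtain s where s: "s > 0" "cball (snd ?c p) s \<subseteq> snd ?c ` (fst ?c \<inter> G)"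
    using c assms unfolding open_contains_cball by blast
  define \<rho> where "\<rho> = s / 2"
  have \<rho>: "\<rho> > 0" "cball (snd ?c p) (2 * \<rho>) \<subseteq> snd ?c ` (fst ?c \<inter> G)" using s by (auto simp: \<rho>_def)
  obtain \<phi>0 where \<phi>0: "smooth_on UNIV \<phi>0" "\<And>x. dist (snd ?c p) x \<le> \<rho> \<Longrightarrow> \<phi>0 x = (1::real)"
    "\<And>x. dist (snd ?c p) x \<ge> 2 * \<rho> \<Longrightarrow> \<phi>0 x = 0"
    using smooth_bump_exists[OF \<rho>(1), of "snd ?c p"] by blast
  define \<phi> where "\<phi> q = (if q \<in> fst ?c then \<phi>0 (snd ?c q) else 0)" for q
  define K where "K = chart_inv ?c ` cball (snd ?c p) (2 * \<rho>)"
  define W where "W = {q \<in> fst ?c. snd ?c q \<in> ball (snd ?c p) \<rho>}"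
  have sub: "cball (snd ?c p) (2 * \<rho>) \<subseteq> snd ?c ` fst ?c" using \<rho>(2) by auto
  have K: "compact K"
    unfolding K_def by (rule compact_continuous_image[OF continuous_on_subset[OF continuous_chart(2)[OF c(1)] sub] compact_cball])
  have KG: "K \<subseteq> G" using \<rho>(2) c by (auto simp: K_def chart_inv_chart subset_iff image_iff)
  have off: "\<phi> q = 0" if "q \<notin> K" for q
  proof (cases "q \<in> fst ?c")
    case True
    have "snd ?c q \<notin> cball (snd ?c p) (2 * \<rho>)"
      using that chart_inv_chart[OF c(1) True] unfolding K_def by (metis imageI)
    then show ?thesis using \<phi>0(3)[of "snd ?c q"] True by (simp add: \<phi>_def)
  qed (simp add: \<phi>_def)
  have "smooth_scalar \<phi>"
    unfolding smooth_scalar_def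
  proof (intro ballI smooth_on_local)
    fix c' x assume c': "c' \<in> B" and x: "x \<in> snd c' ` fst c'"
    show "\<exists>T. open T \<and> x \<in> T \<and> smooth_on T (\<lambda>x. \<phi> (chart_inv c' x))"
    proof (cases "chart_inv c' x \<in> fst ?c")
      case True
      let ?T = "snd c' ` (fst c' \<inter> fst ?c)"
      have T: "open ?T" by (rule open_overlap[OF c' c(1)])
      have "smooth_on ?T (\<lambda>x. \<phi>0 (snd ?c (chart_inv c' x)))"
        by (rule smooth_on_compose[OF T open_UNIV \<phi>0(1) transition_smooth[OF c' c(1)]]) simp
      then have "smooth_on ?T (\<lambda>x. \<phi> (chart_inv c' x))"
        by (subst smooth_on_cong[OF T, where g = "\<lambda>x. \<phi>0 (snd ?c (chart_inv c' x))"])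
          (use c' in \<open>auto simp: \<phi>_def chart_inv_chart\<close>)
      moreover have "x \<in> ?T" using x True c' by (auto simp: chart_inv_chart)
      ultimately show ?thesis using T by blast
    next
      case False
      then have nK: "chart_inv c' x \<notin> K" using sub c by (auto simp: K_def chart_inv_chart subset_iff image_iff)
      let ?T = "snd c' ` (fst c' - K)"
      have T: "open ?T"
        by (intro open_chart_image c' open_Diff open_chart compact_imp_closed K) auto
      have "smooth_on ?T (\<lambda>x. \<phi> (chart_inv c' x))"
        by (subst smooth_on_cong[OF T, where g = "\<lambda>x. 0"])
          (use c' off in \<open>auto simp: chart_inv_chart smooth_on_const\<close>)
      moreover have "x \<in> ?T" using x nK c' by (auto simp: chart_inv_chart)
      ultimately show ?thesis using T by blast
    qed
  qed
  moreover have "open W"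
    using continuous_open_preimage[OF continuous_chart(1)[OF c(1)] open_chart(1)[OF c(1)] open_ball]
    by (simp add: W_def vimage_def Int_def conj_commute)
  moreover have "p \<in> W" using c \<rho>(1) by (simp add: W_def)
  moreover have "\<phi> q = 1" if "q \<in> W" for q
    using that \<phi>0(2)[of "snd ?c q"] by (auto simp: W_def \<phi>_def)
  ultimately show ?thesis using that[of \<phi> W K] K KG off by blast
qed

end

context riemannian_pair
begin

lemma smooth_family_variation:
  fixes P :: "'r::euclidean_space set"
  assumes U: "smooth_family P U" and "U 0 = u" "\<And>r p. r \<in> P \<Longrightarrow> p \<notin> K \<Longrightarrow> U r p = u p"
  shows "smooth_variation A B K u P U"
  unfolding smooth_variation_def
proof (intro conjI ballI allI impI assms)
  have P: "open P" using U by (simp add: smooth_family_def)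
  have UN: "P \<times> UNIV = (\<Union>c\<in>A. P \<times> fst c)" using M.chart_at by blast
  show "continuous_on (P \<times> UNIV) (\<lambda>(r, p). U r p)"
    unfolding UN
  proof (rule continuous_on_open_UN)
    fix c assume c: "c \<in> A"
    show "open (P \<times> fst c)" using P M.open_chart(1)[OF c] by (rule open_Times)
    have cont: "continuous_on (P \<times> snd c ` fst c) (in_source c U)"
      using smooth_familyD[OF U c] by (simp add: N.smooth_into_def)
    have "continuous_on (P \<times> fst c) (\<lambda>z. in_source c U (fst z, snd c (snd z)))"
      by (rule continuous_on_compose2[OF cont])
        (auto intro!: continuous_intros continuous_on_compose2[OF M.continuous_chart(1)[OF c]])
    then show "continuous_on (P \<times> fst c) (\<lambda>(r, p). U r p)"
      by (rule continuous_on_eq) (use c in \<open>auto simp: M.chart_inv_chart\<close>)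
  qed
  fix c d assume c: "c \<in> A" and d: "d \<in> B"
  have "{(r, x). r \<in> P \<and> x \<in> snd c ` fst c \<and> U r (chart_inv c x) \<in> fst d}
      = {z \<in> P \<times> snd c ` fst c. in_source c U z \<in> fst d}" by auto
  then show "smooth_on {(r, x). r \<in> P \<and> x \<in> snd c ` fst c \<and> U r (chart_inv c x) \<in> fst d}
      (\<lambda>(r, x). snd d (U r (chart_inv c x)))"
    using N.smooth_into_chart[OF smooth_familyD[OF U c] d] by (simp add: case_prod_beta')
qed

text \<open>The definition of the energy selects a frame by choice, but frame sums do not depend on the frame.\<close>

lemma Phi3_energy_frame:
  assumes U: "smooth_family P U" "r \<in> P" and e: "\<And>p. orthonormal_frame (g p) (e p)"
  shows "Phi3_energy A g B h K (U r) = (LINT p:K|vol. d3_norm_sq A B h (e p) (U r) p / 6)"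
proof -
  have "d3_norm_sq A B h (SOME f. orthonormal_frame (g p) f) (U r) p = d3_norm_sq A B h (e p) (U r) p" for p
  proof -
    define E where "E p = (SOME f. orthonormal_frame (g p) f)" for p
    have E: "orthonormal_frame (g p) (E p)" unfolding E_def by (rule someI[of _ "e p"]) (rule e)
    have lin: "linear (du U r p)" using smooth_hom_differential[OF U(1)] U(2) by (simp add: smooth_hom_def)
    have bil: "bilinear (\<lambda>v w. h (U r p) (du U r p v) (du U r p w))"
      using N.metric_point(1)[of "U r p"] lin
      by (auto simp: bilinear_def intro: linear_compose[unfolded comp_def])
    have "d3_norm_sq A B h (E p) (U r) p = d3_norm_sq A B h (e p) (U r) p"
      unfolding d3_norm_sq_frame_sum[of E p U] d3_norm_sq_frame_sum[of e p U] frame_sum_def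
      by (rule frame_sum_independent[OF bil bil bil M.metric_point(1) E e])
    then show ?thesis by (simp add: E_def)
  qed
  then show ?thesis by (simp add: Phi3_energy_def)
qed

lemma smooth_section_scale:
  assumes u: "smooth_map A B u" and W: "smooth_section u W" and \<phi>: "M.smooth_scalar \<phi>"
  shows "smooth_section u (\<lambda>p. \<phi> p *\<^sub>R W p)"
  unfolding smooth_section_def N.smooth_along_def
proof (intro ballI)
  fix c d assume c: "c \<in> A" and d: "d \<in> B"
  let ?S = "{x \<in> snd c ` fst c. u (chart_inv c x) \<in> fst d}"
  have S: "open ?S" by (rule N.open_chart_preimage[OF smooth_map_into[OF u c] d])
  have "smooth_on ?S (\<lambda>x. \<phi> (chart_inv c x) *\<^sub>R N.in_chart d (u (chart_inv c x)) (W (chart_inv c x)))"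
  proof (rule smooth_on_scaleR[OF S])
    show "smooth_on ?S (\<lambda>x. \<phi> (chart_inv c x))"
      by (rule smooth_on_subset[of "snd c ` fst c"]) (use \<phi> c in \<open>auto simp: M.smooth_scalar_def\<close>)
    show "smooth_on ?S (\<lambda>x. N.in_chart d (u (chart_inv c x)) (W (chart_inv c x)))"
      using W c d by (simp add: smooth_section_def N.smooth_along_def)
  qed
  then show "smooth_on ?S (\<lambda>x. N.in_chart d (u (chart_inv c x)) (\<phi> (chart_inv c x) *\<^sub>R W (chart_inv c x)))"
    by (subst smooth_on_cong[OF S, where g = "\<lambda>x. \<phi> (chart_inv c x) *\<^sub>R N.in_chart d (u (chart_inv c x)) (W (chart_inv c x))"])
      (use d linear_scale[OF N.in_chart_linear] in auto)
qed

lemma induced_nabla_add: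
  assumes u: "smooth_map A B u" and W: "smooth_section u W" "smooth_section u W'" "smooth_section u (\<lambda>p. W p + W' p)"
  shows "induced_nabla A B h u p v (\<lambda>p. W p + W' p) = induced_nabla A B h u p v W + induced_nabla A B h u p v W'"
proof -
  let ?c = "chart_at A p"
  have c: "?c \<in> A" "p \<in> fst ?c" by (rule M.chart_at)+
  note uc = smooth_map_into[OF u c(1)]
  have al: "N.smooth_along (snd ?c ` fst ?c) (\<lambda>x. u (chart_inv ?c x)) (\<lambda>x. W (chart_inv ?c x))"
    if "smooth_section u W" for W using that c(1) by (simp add: smooth_section_def)
  have x: "snd ?c p \<in> snd ?c ` fst ?c" using c by auto
  show ?thesis
    unfolding induced_nabla_in_source[OF uc al[OF W(1)] c] induced_nabla_in_source[OF uc al[OF W(2)] c]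
      induced_nabla_in_source[OF uc al[OF W(3)] c]
    by (rule N.cov_add[OF uc al[OF W(1)] al[OF W(2)] x])
qed

lemma induced_nabla_zero:
  assumes u: "smooth_map A B u" and G: "open G" "p \<in> G" "\<And>q. q \<in> G \<Longrightarrow> W q = 0"
  shows "induced_nabla A B h u p v W = 0"
proof -
  let ?c = "chart_at A p" and ?d = "chart_at B (u p)"
  have c: "?c \<in> A" "p \<in> fst ?c" by (rule M.chart_at)+
  have d: "?d \<in> B" "u p \<in> fst ?d" by (rule N.chart_at)+
  let ?T = "snd ?c ` (fst ?c \<inter> (G \<inter> u -` fst ?d))"
  have "continuous_on UNIV u" using u by (simp add: smooth_map_def)
  then have "open (u -` fst ?d)" using open_vimage[OF N.open_chart(1)[OF d(1)]] by blast
  then have T: "open ?T" "snd ?c p \<in> ?T"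
    using c d G by (auto intro!: M.open_chart_image open_Int M.open_chart)
  have z: "N.in_chart ?d (u (chart_inv ?c x)) (W (chart_inv ?c x)) = 0" if "x \<in> ?T" for x
    using that c G(3) linear_0[OF N.in_chart_linear[OF d(1)]] by (auto simp: M.chart_inv_chart)
  interpret D: riemannian_domain "snd ?d ` fst ?d" "N.met ?d"
    by (rule N.riemannian_domain_chart[OF d(1) N.open_chart(2)[OF d(1)] order_refl])
  have up: "u (chart_inv ?c (snd ?c p)) = u p" using c by (simp add: M.chart_inv_chart)
  have "induced_nabla A B h u p v W = covariant (N.met ?d) (\<lambda>x. snd ?d (u (chart_inv ?c x))) v
      (\<lambda>x. N.in_chart ?d (u (chart_inv ?c x)) (W (chart_inv ?c x))) (snd ?c p)"
    using c by (simp add: induced_nabla_def Let_def covariant_def M.chart_inv_chart differential_def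
        N.in_chart_preferred christoffel_def levi_civita_def dirderiv_def comp_def)
  also have "\<dots> = covariant (N.met ?d) (\<lambda>x. snd ?d (u (chart_inv ?c x))) v (\<lambda>_. 0) (snd ?c p)"
    by (rule covariant_cong_open[OF T refl z])
  also have "\<dots> = 0"
  proof -
    have "snd ?d (u p) \<in> snd ?d ` fst ?d" using d by auto
    then show ?thesis
      by (simp add: covariant_def dirderiv_const up bilinear_rzero[OF D.christoffel_bilinear])
  qed
  finally show ?thesis .
qed

lemma pairing_zero:
  assumes "smooth_map A B u" "open G" "p \<in> G" "\<And>q. q \<in> G \<Longrightarrow> W q = 0"
  shows "pairing e u W p = 0"
  using bilinear_lzero[OF N.metric_point(1)] by (simp add: pairing_def induced_nabla_zero[OF assms])

lemma pairing_add:
  assumes "smooth_map A B u" "smooth_section u W" "smooth_section u W'" "smooth_section u (\<lambda>p. W p + W' p)"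
  shows "pairing e u (\<lambda>p. W p + W' p) p = pairing e u W p + pairing e u W' p"
  unfolding pairing_def induced_nabla_add[OF assms] bilinear_ladd[OF N.metric_point(1)]
  by (simp only: distrib_right sum.distrib)

lemma integral_of_supported:
  fixes f :: "'a \<Rightarrow> real"
  assumes "\<And>p. p \<notin> K \<Longrightarrow> f p = 0"
  shows "set_integrable vol K f \<longleftrightarrow> integrable vol f" "(LINT p:K|vol. f p) = (LINT p|vol. f p)"
proof -
  have "(\<lambda>p. indicator K p *\<^sub>R f p) = f" using assms by (auto simp: indicator_def fun_eq_iff)
  then show "set_integrable vol K f \<longleftrightarrow> integrable vol f" "(LINT p:K|vol. f p) = (LINT p|vol. f p)"
    by (simp_all add: set_integrable_def set_lebesgue_integral_def)
qed

end

context riemannian_pair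
begin

text \<open>A section supported in the preimage of one chart of the target is the variation field of a
  straight-line variation in that chart.\<close>

lemma straight_line_variation:
  assumes u: "smooth_map A B u" and W: "smooth_section u W" and K: "compact K"
    and supp: "\<And>p. p \<notin> K \<Longrightarrow> W p = 0" and d: "d \<in> B" "u ` K \<subseteq> fst d"
  obtains \<epsilon> U where "\<epsilon> > 0" "smooth_family {-\<epsilon><..<\<epsilon>} U" "smooth_variation A B K u {-\<epsilon><..<\<epsilon>} U"
    "variation_field U (1::real) 0 = W"
proof -
  define G where "G = u -` fst d"
  have contu: "continuous_on UNIV u" using u by (simp add: smooth_map_def)
  have G: "open G" unfolding G_def using open_vimage[OF N.open_chart(1)[OF d(1)] contu] .
  have KG: "K \<subseteq> G" using d(2) by (auto simp: G_def)
  define \<eta> where "\<eta> p = N.in_chart d (u p) (W p)" for p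
  have \<eta>0: "\<eta> p = 0" if "p \<in> G" "p \<notin> K" for p
    using that supp linear_0[OF N.in_chart_linear[OF d(1)]] by (auto simp: \<eta>_def G_def)
  have src: "open (snd c ` (fst c \<inter> G))" "snd c ` (fst c \<inter> G) = {x \<in> snd c ` fst c. u (chart_inv c x) \<in> fst d}"
    if "c \<in> A" for c
    using M.open_chart_image[OF that open_Int[OF M.open_chart(1)[OF that] G]]
      M.chart_image_eq[OF that Int_lower1, of G] M.chart_chart_inv(2)[OF that] by (auto simp: G_def)
  have \<eta>s: "smooth_on (snd c ` (fst c \<inter> G)) (\<lambda>x. \<eta> (chart_inv c x))" if "c \<in> A" for c
    using W that d(1) unfolding src(2)[OF that] by (simp add: smooth_section_def N.smooth_along_def \<eta>_def)
  have us: "smooth_on (snd c ` (fst c \<inter> G)) (\<lambda>x. snd d (u (chart_inv c x)))" if "c \<in> A" for c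
    unfolding src(2)[OF that] by (rule N.smooth_into_chart[OF smooth_map_into[OF u that] d(1)])
  have cont: "continuous_on G f" if "\<And>c. c \<in> A \<Longrightarrow> smooth_on (snd c ` (fst c \<inter> G)) (\<lambda>x. f (chart_inv c x))"
    for f :: "'a \<Rightarrow> real ^ 'n"
  proof -
    have eq: "G = (\<Union>c\<in>A. fst c \<inter> G)" using M.chart_at by blast
    have "continuous_on (\<Union>c\<in>A. fst c \<inter> G) f"
    proof (rule continuous_on_open_UN)
      fix c assume c: "c \<in> A"
      show "open (fst c \<inter> G)" using M.open_chart(1)[OF c] G by (rule open_Int)
      have "continuous_on (fst c \<inter> G) (\<lambda>p. f (chart_inv c (snd c p)))"
        by (rule continuous_on_compose2[OF smooth_on_continuous_on[OF that[OF c]]])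
          (auto intro: continuous_on_subset[OF M.continuous_chart(1)[OF c]])
      then show "continuous_on (fst c \<inter> G) f"
        by (rule continuous_on_eq) (use c in \<open>auto simp: M.chart_inv_chart\<close>)
    qed
    then show ?thesis using eq by simp
  qed
  have "compact ((\<lambda>p. snd d (u p)) ` K)"
    by (rule compact_continuous_image[OF continuous_on_subset[OF cont[OF us] KG] K])
  moreover have "(\<lambda>p. snd d (u p)) ` K \<subseteq> snd d ` fst d" using d(2) by auto
  ultimately obtain \<delta> where \<delta>: "\<delta> > 0" "(\<Union>y\<in>(\<lambda>p. snd d (u p)) ` K. ball y \<delta>) \<subseteq> snd d ` fst d"
    using compact_subset_open_imp_ball_epsilon_subset[OF _ N.open_chart(2)[OF d(1)]] by metis
  have "compact (\<eta> ` K)"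
    by (rule compact_continuous_image[OF continuous_on_subset[OF cont[OF \<eta>s] KG] K])
  then obtain b where b: "b > 0" "\<forall>y\<in>\<eta> ` K. norm y \<le> b"
    using compact_imp_bounded bounded_pos by blast
  \<comment> \<open>For \<open>\<bar>t\<bar> < \<epsilon>\<close> the displacement \<open>t \<eta>\<close> is shorter than \<open>\<delta>\<close>, so the variation stays in the chart.\<close>
  define \<epsilon> where "\<epsilon> = \<delta> / b"
  have \<epsilon>: "\<epsilon> > 0" using \<delta>(1) b(1) by (simp add: \<epsilon>_def)
  define P where "P = {-\<epsilon><..<\<epsilon>}"
  have P: "open P" "0 \<in> P" using \<epsilon> by (auto simp: P_def)
  define w where "w t p = snd d (u p) + t *\<^sub>R \<eta> p" for t p
  have inside: "w t p \<in> snd d ` fst d" if "t \<in> P" "p \<in> G" for t p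
  proof (cases "p \<in> K")
    case True
    have "norm (t *\<^sub>R \<eta> p) \<le> \<bar>t\<bar> * b" using b True by (auto intro: mult_left_mono)
    also have "\<dots> < \<epsilon> * b" using that(1) b(1) by (intro mult_strict_right_mono) (auto simp: P_def)
    finally have "dist (snd d (u p)) (w t p) < \<delta>" using b(1) by (simp add: w_def dist_norm \<epsilon>_def)
    then show ?thesis using \<delta>(2) True by force
  next
    case False
    then show ?thesis using that \<eta>0 by (auto simp: w_def G_def)
  qed
  \<comment> \<open>Off \<open>K\<close> both cases give \<open>u\<close>, so the definitions on the open sets \<open>G\<close> and \<open>- K\<close> fit together.\<close>
  define U where "U t p = (if p \<in> G then chart_inv d (w t p) else u p)" for t p
  have Uoff: "U t p = u p" if "p \<notin> K" for t p
    using that \<eta>0 d(1) by (auto simp: U_def w_def G_def N.chart_inv_chart)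
  have U0: "U 0 = u"
    using d(1) by (auto simp: U_def w_def G_def N.chart_inv_chart fun_eq_iff)
  have fam: "smooth_family P U"
    unfolding smooth_family_def
  proof (intro conjI ballI P N.smooth_into_local)
    fix c z assume c: "c \<in> A" and z: "z \<in> P \<times> snd c ` fst c"
    show "\<exists>T. z \<in> T \<and> T \<subseteq> P \<times> snd c ` fst c \<and> N.smooth_into T (in_source c U)"
    proof (cases "chart_inv c (snd z) \<in> G")
      case True
      let ?T = "P \<times> snd c ` (fst c \<inter> G)"
      have T: "open ?T" using P(1) src(1)[OF c] by (rule open_Times)
      have lift: "smooth_on ?T (\<lambda>z. f (snd z))" if "smooth_on (snd c ` (fst c \<inter> G)) f"
        for f :: "real ^ 'm \<Rightarrow> real ^ 'n"
        by (rule smooth_on_compose[OF T src(1)[OF c] that smooth_on_snd[OF T]]) auto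
      have "smooth_on ?T (\<lambda>z. w (fst z) (chart_inv c (snd z)))"
        unfolding w_def
        by (intro smooth_on_add smooth_on_scaleR T lift[OF us[OF c]] lift[OF \<eta>s[OF c]]
            smooth_on_linear[OF T bounded_linear_fst smooth_on_id[OF T]])
      moreover have "(\<lambda>z. w (fst z) (chart_inv c (snd z))) ` ?T \<subseteq> snd d ` fst d"
        using inside c by (auto simp: M.chart_inv_chart)
      ultimately have "N.smooth_into ?T (\<lambda>z. chart_inv d (w (fst z) (chart_inv c (snd z))))"
        by (rule N.smooth_into_chart_inv[OF T _ _ d(1)])
      then have "N.smooth_into ?T (in_source c U)"
        by (rule N.smooth_into_cong) (use c in \<open>auto simp: U_def M.chart_inv_chart\<close>)
      moreover have "snd z \<in> snd c ` (fst c \<inter> G)"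
        unfolding M.chart_image_eq[OF c Int_lower1]
        using z True M.chart_chart_inv(2)[OF c, of "snd z"] by (simp add: mem_Times_iff)
      then have "z \<in> ?T" using z by (simp add: mem_Times_iff)
      ultimately show ?thesis by (intro exI[of _ ?T]) auto
    next
      case False
      let ?T = "P \<times> snd c ` (fst c - K)"
      have T0: "open (snd c ` (fst c - K))"
        by (intro M.open_chart_image c open_Diff M.open_chart compact_imp_closed K) auto
      have T: "open ?T" using P(1) T0 by (rule open_Times)
      have "N.smooth_into (P \<times> snd c ` fst c) (in_source c (\<lambda>_. u))"
        by (rule smooth_familyD[OF smooth_family_const[OF u P(1)] c])
      then have "N.smooth_into ?T (in_source c (\<lambda>_. u))"
        by (rule N.smooth_into_subset[OF _ T]) auto
      then have "N.smooth_into ?T (in_source c U)"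
        by (rule N.smooth_into_cong) (use c Uoff in \<open>auto simp: M.chart_inv_chart\<close>)
      moreover have "snd z \<in> snd c ` (fst c - K)"
        unfolding M.chart_image_eq[OF c Diff_subset]
        using z False KG M.chart_chart_inv(2)[OF c, of "snd z"] by (auto simp: mem_Times_iff)
      then have "z \<in> ?T" using z by (simp add: mem_Times_iff)
      ultimately show ?thesis by (intro exI[of _ ?T]) auto
    qed
  qed
  have "variation_field U 1 0 = W"
  proof
    fix p
    show "variation_field U 1 0 p = W p"
    proof (cases "p \<in> K")
      case False
      then have "(\<lambda>r. U r p) = (\<lambda>_. u p)" using Uoff by auto
      then show ?thesis using supp[OF False] by (simp add: variation_field_def N.tangent_def dirderiv_const)
    next
      case True
      then have p: "p \<in> G" "u p \<in> fst d" using KG by (auto simp: G_def)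
      let ?c = "chart_at A p"
      have c: "?c \<in> A" "p \<in> fst ?c" by (rule M.chart_at)+
      have Sl: "smooth_on P (\<lambda>r. (r, snd ?c p))"
        by (intro smooth_on_Pair smooth_on_id smooth_on_const P)
      have "N.smooth_into P (\<lambda>r. in_source ?c U (r, snd ?c p))"
        by (rule N.smooth_into_compose[OF smooth_familyD[OF fam c(1)] P(1) Sl]) (use c in auto)
      then have into: "N.smooth_into P (\<lambda>r. U r p)" using c by (simp add: M.chart_inv_chart)
      have "N.in_chart d (U 0 p) (N.tangent (\<lambda>r. U r p) 1 0) = dirderiv 1 (\<lambda>r. snd d (U r p)) 0"
        by (rule N.tangent_in_chart[OF into d(1) P(2)]) (use p U0 in auto)
      also have "\<dots> = dirderiv 1 (\<lambda>r. w r p) 0"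
        by (rule dirderiv_cong_open[OF P]) (use p inside N.chart_chart_inv(1)[OF d(1)] in \<open>auto simp: U_def\<close>)
      also have "\<dots> = \<eta> p"
      proof -
        have "((\<lambda>r. w r p) has_derivative (\<lambda>r. r *\<^sub>R \<eta> p)) (at 0)"
          unfolding w_def by (auto intro!: derivative_eq_intros)
        from has_derivative_imp_dirderiv[OF this, of 1] show ?thesis by simp
      qed
      finally have "N.in_chart d (u p) (variation_field U 1 0 p) = N.in_chart d (u p) (W p)"
        by (simp add: U0 variation_field_def \<eta>_def)
      then show ?thesis
        using N.change_chart_inverse[OF N.chart_at(1) d(1) N.chart_at(2) p(2)] by metis
    qed
  qed
  with that[OF \<epsilon>, of U] fam smooth_family_variation[OF fam U0 Uoff] show ?thesis
    unfolding P_def by blast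
qed

text \<open>For the straight-line variation the first variation of the energy is the integral in question.\<close>

lemma harmonic_local:
  assumes harm: "Phi3_harmonic A g B h u" and e: "\<And>p. orthonormal_frame (g p) (e p)"
    and W: "smooth_section u W" and K: "compact K"
    and supp: "\<And>p. p \<notin> K \<Longrightarrow> W p = 0" and d: "d \<in> B" "u ` K \<subseteq> fst d"
  shows "integrable vol (pairing e u W)" "(LINT p|vol. pairing e u W p) = 0"
proof -
  have u: "smooth_map A B u" using harm by (simp add: Phi3_harmonic_def)
  obtain \<epsilon> U where U: "\<epsilon> > 0" "smooth_family {-\<epsilon><..<\<epsilon>} U" "smooth_variation A B K u {-\<epsilon><..<\<epsilon>} U"
    "variation_field U (1::real) 0 = W"
    by (rule straight_line_variation[OF u W K supp d])
  have z: "0 \<in> {-\<epsilon><..<\<epsilon>}" using U(1) by auto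
  let ?F = "\<lambda>r p. d3_norm_sq A B h (e p) (U r) p / 6"
  have F: "smooth_fun {-\<epsilon><..<\<epsilon>} ?F" by (rule smooth_fun_energy_density[OF U(2) e])
  have U0: "U 0 = u" using U(3) by (simp add: smooth_variation_def)
  have pw: "dirderiv 1 (\<lambda>r. ?F r p) 0 = pairing e u W p" for p
    using first_variation_pointwise[OF U(2) z, of 1 e p] unfolding U0 U(4) .
  have off: "pairing e u W p = 0" if "p \<notin> K" for p
    by (rule pairing_zero[OF u, of "- K"]) (use that supp K in \<open>auto simp: compact_imp_closed open_Compl\<close>)
  have "continuous_on UNIV (pairing e u W)"
    using smooth_fun_continuous_at[OF smooth_fun_dirderiv[OF F, of 1] z] by (simp add: pw)
  then have "set_integrable vol K (pairing e u W)" using K by (rule set_integrable_continuous)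
  then show "integrable vol (pairing e u W)" using integral_of_supported(1)[OF off] by simp
  have "((\<lambda>t. LINT p:K|vol. ?F (0 + t *\<^sub>R 1) p) has_real_derivative (LINT p:K|vol. pairing e u W p)) (at 0)"
    using leibniz_compact[OF F z K, of 1] by (simp only: pw)
  then have "((\<lambda>t. Phi3_energy A g B h K (U t)) has_real_derivative (LINT p:K|vol. pairing e u W p)) (at 0)"
    by (rule has_field_derivative_transform_within_open[OF _ _ z])
      (simp_all add: Phi3_energy_frame[OF U(2) _ e] open_greaterThanLessThan)
  moreover have "((\<lambda>t. Phi3_energy A g B h K (U t)) has_real_derivative 0) (at 0)"
    by (rule harm[unfolded Phi3_harmonic_def, THEN conjunct2, rule_format, OF K U(1,3)])
  ultimately have "(LINT p:K|vol. pairing e u W p) = 0" by (rule DERIV_unique)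
  then show "(LINT p|vol. pairing e u W p) = 0" using integral_of_supported(2)[OF off] by simp
qed

text \<open>The compact set is covered by finitely many open sets on each of which a cut-off function \<open>\<phi>\<close> with
  support in the preimage of a chart is 1. By induction on their number: the local case applies to
  \<open>\<phi> W\<close>, and \<open>(1 - \<phi>) W\<close> is supported in a compact set that is covered by the other open sets.\<close>

lemma harmonic_weak_equation:
  assumes harm: "Phi3_harmonic A g B h u" and e: "\<And>p. orthonormal_frame (g p) (e p)"
    and "smooth_section u W" "compact K" "\<And>p. p \<notin> K \<Longrightarrow> W p = 0"
  shows "integrable vol (pairing e u W) \<and> (LINT p|vol. pairing e u W p) = 0"
proof -
  have u: "smooth_map A B u" using harm by (simp add: Phi3_harmonic_def)
  have contu: "continuous_on UNIV u" using u by (simp add: smooth_map_def)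
  define good where "good q \<phi> G L \<longleftrightarrow> M.smooth_scalar \<phi> \<and> open G \<and> q \<in> G \<and> (\<forall>p\<in>G. \<phi> p = 1) \<and> compact L \<and>
      L \<subseteq> u -` fst (chart_at B (u q)) \<and> (\<forall>p. p \<notin> L \<longrightarrow> \<phi> p = 0)" for q \<phi> G L
  have "\<exists>\<phi> G L. good q \<phi> G L" for q
  proof -
    have o: "open (u -` fst (chart_at B (u q)))" by (rule open_vimage[OF N.open_chart(1)[OF N.chart_at(1)] contu])
    have q: "q \<in> u -` fst (chart_at B (u q))" using N.chart_at(2) by simp
    show ?thesis
    proof (rule M.bump_function_exists[OF o q])
      fix \<phi> G L
      assume "M.smooth_scalar \<phi>" "open G" "q \<in> G" "\<And>p. p \<in> G \<Longrightarrow> \<phi> p = 1"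
        "compact L" "L \<subseteq> u -` fst (chart_at B (u q))" "\<And>p. p \<notin> L \<Longrightarrow> \<phi> p = 0"
      then show ?thesis by (intro exI[of _ \<phi>] exI[of _ G] exI[of _ L]) (simp add: good_def)
    qed
  qed
  then obtain \<phi> G L where good: "\<And>q. good q (\<phi> q) (G q) (L q)" by metis
  have \<phi>: "M.smooth_scalar (\<phi> q)" "open (G q)" "q \<in> G q" "p \<in> G q \<Longrightarrow> \<phi> q p = 1" "compact (L q)"
    "L q \<subseteq> u -` fst (chart_at B (u q))" "p \<notin> L q \<Longrightarrow> \<phi> q p = 0" for p q
    using good[of q] by (simp_all add: good_def)
  have "K \<subseteq> (\<Union>q\<in>K. G q)" using \<phi>(3) by blast
  then obtain Q where "Q \<subseteq> K" and Q: "finite Q" "K \<subseteq> (\<Union>q\<in>Q. G q)"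
    by (rule compactE_image[OF \<open>compact K\<close> \<phi>(2)])
  show ?thesis
    using Q(1,2) assms(3-5)
  proof (induction Q arbitrary: W K rule: finite_induct)
    case empty
    then have "pairing e u W p = 0" for p
      by (intro pairing_zero[OF u open_UNIV]) auto
    then show ?case by simp
  next
    case (insert q Q)
    let ?W1 = "\<lambda>p. \<phi> q p *\<^sub>R W p" and ?W2 = "\<lambda>p. (1 - \<phi> q p) *\<^sub>R W p"
    have s2: "M.smooth_scalar (\<lambda>p. 1 - \<phi> q p)"
      unfolding M.smooth_scalar_def
    proof
      fix c assume c: "c \<in> A"
      then have "smooth_on (snd c ` fst c) (\<lambda>x. \<phi> q (chart_inv c x))"
        using \<phi>(1)[of q] by (simp add: M.smooth_scalar_def)
      then show "smooth_on (snd c ` fst c) (\<lambda>x. 1 - \<phi> q (chart_inv c x))"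
        by (rule smooth_on_diff[OF M.open_chart(2)[OF c] smooth_on_const])
    qed
    have W1: "smooth_section u ?W1" by (rule smooth_section_scale[OF u insert.prems(2) \<phi>(1)])
    have W2: "smooth_section u ?W2" by (rule smooth_section_scale[OF u insert.prems(2) s2])
    have sum: "(\<lambda>p. ?W1 p + ?W2 p) = W" by (simp add: algebra_simps)
    have cK: "compact (L q \<inter> K)"
      by (rule compact_Int_closed[OF \<phi>(5) compact_imp_closed[OF insert.prems(3)]])
    have sK: "?W1 p = 0" if "p \<notin> L q \<inter> K" for p
      using that \<phi>(7)[of p q] insert.prems(4)[of p] by (cases "p \<in> K") auto
    have uK: "u ` (L q \<inter> K) \<subseteq> fst (chart_at B (u q))" using \<phi>(6)[of q] by auto
    note 1 = harmonic_local[OF harm e W1 cK sK N.chart_at(1) uK]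
    have "K - G q \<subseteq> (\<Union>q\<in>Q. G q)" using insert.prems(1) by auto
    moreover have "compact (K - G q)" using insert.prems(3) \<phi>(2) by (rule compact_diff)
    moreover have "?W2 p = 0" if "p \<notin> K - G q" for p
      using that insert.prems(4)[of p] \<phi>(4)[of p q] by (cases "p \<in> K") auto
    ultimately have 2: "integrable vol (pairing e u ?W2) \<and> (LINT p|vol. pairing e u ?W2 p) = 0"
      by (intro insert.IH[of "K - G q" ?W2] W2)
    have "pairing e u W p = pairing e u ?W1 p + pairing e u ?W2 p" for p
      using pairing_add[OF u W1 W2, of e p] insert.prems(2) by (simp only: sum)
    then have eq: "pairing e u W = (\<lambda>p. pairing e u ?W1 p + pairing e u ?W2 p)" by (rule ext)
    show ?case
      unfolding eq using 1 2 by simp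
  qed
qed

end

section \<open>The second variation formula\<close>

lemma (in riemannian_domain) riemann_zero: "y \<in> Y \<Longrightarrow> riemann H y 0 w z = 0"
proof -
  assume y: "y \<in> Y"
  have "dirderiv w (\<lambda>p. christoffel H p 0 z) y = dirderiv w (\<lambda>_. 0) y"
    by (rule dirderiv_cong_open[OF open_domain y bilinear_lzero[OF christoffel_bilinear]])
  moreover have "dirderiv 0 (\<lambda>p. christoffel H p w z) y = 0"
    by (rule linear_0[OF smooth_on_linear_dirderiv[OF christoffel_smooth y]])
  ultimately show ?thesis
    by (simp add: riemann_def dirderiv_const bilinear_lzero[OF christoffel_bilinear[OF y]]
        bilinear_rzero[OF christoffel_bilinear[OF y]])
qed

lemma (in manifold) velocity_eq_tangent:
  assumes "smooth_into S \<gamma>" "t \<in> S"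
  shows "velocity B \<gamma> t = tangent \<gamma> 1 t"
proof -
  let ?f = "\<lambda>r. snd (chart_at B (\<gamma> t)) (\<gamma> r)"
  have t: "t \<in> {t' \<in> S. \<gamma> t' \<in> fst (chart_at B (\<gamma> t))}" using assms(2) chart_at by auto
  note sm = smooth_into_chart[OF assms(1) chart_at(1)]
  have "(?f has_derivative (\<lambda>v. dirderiv v ?f t)) (at t)"
    by (rule smooth_on_has_derivative[OF sm t])
  moreover have "(\<lambda>v. dirderiv v ?f t) = (\<lambda>v. v *\<^sub>R dirderiv 1 ?f t)"
  proof
    fix v :: real
    show "dirderiv v ?f t = v *\<^sub>R dirderiv 1 ?f t"
      using linear_scale[OF smooth_on_linear_dirderiv[OF sm t], of v 1] by simp
  qed
  ultimately have "(?f has_vector_derivative dirderiv 1 ?f t) (at t)"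
    by (simp add: has_vector_derivative_def)
  then show ?thesis by (simp add: velocity_def tangent_def vector_derivative_at)
qed

context riemannian_pair
begin

lemma smooth_family_parameter:
  assumes U: "smooth_family P U"
  shows "N.smooth_into P (\<lambda>r. U r p)"
proof -
  let ?c = "chart_at A p"
  have c: "?c \<in> A" "p \<in> fst ?c" by (rule M.chart_at)+
  have "N.smooth_into P (\<lambda>r. in_source ?c U (r, snd ?c p))"
    by (rule N.smooth_into_compose[OF smooth_familyD[OF U c(1)] open_P[OF U] smooth_slice_left[OF U]]) (use c in auto)
  then show ?thesis using c by (simp add: M.chart_inv_chart)
qed

lemma
  assumes P: "open P" "r \<in> P" and const: "\<And>r. r \<in> P \<Longrightarrow> U r p = q"
  shows variation_field_zero: "variation_field U b r p = 0"
    and mixed_field_zero: "mixed_field U a b r p = 0"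
proof -
  have tan: "N.tangent (\<lambda>r. U r p) b r = 0" if "r \<in> P" for r
  proof -
    have "N.tangent (\<lambda>r. U r p) b r = dirderiv b (\<lambda>_. snd (chart_at B (U r p)) q) r"
      unfolding N.tangent_def by (rule dirderiv_cong_open[OF P(1) that]) (simp add: const)
    then show ?thesis by (simp add: dirderiv_const)
  qed
  then show "variation_field U b r p = 0" using P(2) by (simp add: variation_field_def)
  let ?d = "chart_at B q"
  have d: "?d \<in> B" "q \<in> fst ?d" by (rule N.chart_at)+
  interpret D: riemannian_domain "snd ?d ` fst ?d" "N.met ?d"
    by (rule N.riemannian_domain_chart[OF d(1) N.open_chart(2)[OF d(1)] order_refl])
  have "snd ?d q \<in> snd ?d ` fst ?d" using d by auto
  then have "N.cov (\<lambda>_. q) a (\<lambda>_. 0) r = 0"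
    using bilinear_lzero[OF D.christoffel_bilinear] by (simp add: N.cov_def covariant_def dirderiv_const)
  moreover have "mixed_field U a b r p = N.cov (\<lambda>_. q) a (\<lambda>_. 0) r"
    unfolding mixed_field_def by (rule N.cov_cong_open[OF P]) (simp_all add: const tan)
  ultimately show "mixed_field U a b r p = 0" by simp
qed

lemma curvature_zero: "curvature B h q 0 w z = 0"
proof -
  let ?d = "chart_at B q"
  have d: "?d \<in> B" "q \<in> fst ?d" by (rule N.chart_at)+
  interpret D: riemannian_domain "snd ?d ` fst ?d" "N.met ?d"
    by (rule N.riemannian_domain_chart[OF d(1) N.open_chart(2)[OF d(1)] order_refl])
  have "snd ?d q \<in> snd ?d ` fst ?d" using d by auto
  then show ?thesis by (simp add: curvature_riemann D.riemann_zero)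
qed

text \<open>Frame sums are continuous, and the covariant derivative of \<open>V\<close> vanishes off the compact set.\<close>

lemma integrable_supported_frame_sum:
  assumes u: "smooth_map A B u" and e: "\<And>p. orthonormal_frame (g p) (e p)"
    and V: "smooth_section u V" and K: "compact K" "\<And>p. p \<notin> K \<Longrightarrow> V p = 0"
    and L: "smooth_hom UNIV (\<lambda>_::real. u) L2" "smooth_hom UNIV (\<lambda>_. u) L3" "smooth_hom UNIV (\<lambda>_. u) L4"
      "smooth_hom UNIV (\<lambda>_. u) L5" "smooth_hom UNIV (\<lambda>_. u) L6"
  shows "integrable vol (frame_sum e (\<lambda>_. u) (\<lambda>_ p v. induced_nabla A B h u p v V) L2 L3 L4 L5 L6 0)"
    (is "integrable vol ?T")
    and "p \<notin> K \<Longrightarrow> frame_sum e (\<lambda>_. u) (\<lambda>_ p v. induced_nabla A B h u p v V) L2 L3 L4 L5 L6 0 p = 0"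
proof -
  have off: "?T p = 0" if "p \<notin> K" for p
  proof -
    have "induced_nabla A B h u p v V = 0" for v
      by (rule induced_nabla_zero[OF u, of "- K"]) (use that K in \<open>auto simp: compact_imp_closed open_Compl\<close>)
    then show ?thesis by (simp add: frame_sum_def bilinear_lzero[OF N.metric_point(1)])
  qed
  then show "p \<notin> K \<Longrightarrow> ?T p = 0" .
  have "smooth_fun UNIV (frame_sum e (\<lambda>_. u) (\<lambda>_ p v. induced_nabla A B h u p v V) L2 L3 L4 L5 L6)"
    by (rule smooth_fun_frame_sum[OF smooth_family_const[OF u open_UNIV] e smooth_hom_nabla[OF u V open_UNIV] L])
  then have "continuous_on UNIV ?T" by (rule smooth_fun_continuous_at) simp
  then have "set_integrable vol K ?T" using K(1) by (rule set_integrable_continuous)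
  moreover have "set_integrable vol K ?T \<longleftrightarrow> integrable vol ?T"
    by (rule integral_of_supported(1)) (rule off)
  ultimately show "integrable vol ?T" by (simp only:)
qed

lemma line_derivative_of_energy:
  assumes F: "smooth_fun P F" and r: "r \<in> P" and K: "compact K" and S: "open S" "0 \<in> S"
    and eq: "\<And>t. t \<in> S \<Longrightarrow> f t = (LINT p:K|vol. F (r + t *\<^sub>R b) p)"
  shows "(f has_real_derivative (LINT p:K|vol. dirderiv b (\<lambda>r. F r p) r)) (at 0)"
  by (rule has_field_derivative_transform_within_open[OF leibniz_compact[OF F r K] S]) (simp add: eq)

end

theorem theorem4p1:
  fixes A :: "('a::{t2_space, second_countable_topology}, 'm::finite) chart set"
    and g :: "'a \<Rightarrow> real ^ 'm \<Rightarrow> real ^ 'm \<Rightarrow> real"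
    and B :: "('b::{t2_space, second_countable_topology}, 'n::finite) chart set"
    and h :: "'b \<Rightarrow> real ^ 'n \<Rightarrow> real ^ 'n \<Rightarrow> real"
    and e :: "'a \<Rightarrow> 'm \<Rightarrow> real ^ 'm"
    and u :: "'a \<Rightarrow> 'b"
    and U :: "real \<Rightarrow> real \<Rightarrow> 'a \<Rightarrow> 'b"
    and V W :: "'a \<Rightarrow> real ^ 'n"
    and K :: "'a set" and \<epsilon> :: real
  assumes "riemannian_manifold A g"
    and "riemannian_manifold B h"
    and "\<forall>p. orthonormal_frame (g p) (e p)"
    and "Phi3_harmonic A g B h u"
    and "compact K"
    and "\<epsilon> > 0"
    and "smooth_variation A B K u ({-\<epsilon><..<\<epsilon>} \<times> {-\<epsilon><..<\<epsilon>}) (\<lambda>(s, t). U s t)"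
    and "V = (\<lambda>p. velocity B (\<lambda>t. U 0 t p) 0)"
    and "W = (\<lambda>p. velocity B (\<lambda>s. U s 0 p) 0)"
  shows
    "let dv = riemannian_volume A g;
         E = (\<lambda>s t. Phi3_energy A g B h K (U s t));
         H = (\<lambda>p. h (u p));
         R = (\<lambda>p. curvature B h (u p));
         du = (\<lambda>p i. differential A B u p (e p i));
         d3u = (\<lambda>p i. d3 A B h (e p) u p (e p i));
         DV = (\<lambda>p i. induced_nabla A B h u p (e p i) V);
         DW = (\<lambda>p i. induced_nabla A B h u p (e p i) W);
         T1 = (\<lambda>p. \<Sum>i\<in>UNIV. H p (R p (V p) (du p i) (W p)) (d3u p i));
         T2 = (\<lambda>p. \<Sum>i\<in>UNIV. \<Sum>j\<in>UNIV. \<Sum>k\<in>UNIV.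
                 H p (DV p i) (DW p k) * H p (du p k) (du p j) * H p (du p i) (du p j));
         T3 = (\<lambda>p. \<Sum>i\<in>UNIV. \<Sum>j\<in>UNIV. \<Sum>k\<in>UNIV.
                 H p (DV p i) (du p k) * H p (DW p k) (du p j) * H p (du p i) (du p j));
         T4 = (\<lambda>p. \<Sum>i\<in>UNIV. \<Sum>j\<in>UNIV. \<Sum>k\<in>UNIV.
                 H p (DV p i) (du p k) * H p (du p k) (DW p j) * H p (du p i) (du p j));
         T5 = (\<lambda>p. \<Sum>i\<in>UNIV. \<Sum>j\<in>UNIV. \<Sum>k\<in>UNIV.
                 H p (DV p i) (du p k) * H p (du p k) (du p j) * H p (DW p i) (du p j));
         T6 = (\<lambda>p. \<Sum>i\<in>UNIV. \<Sum>j\<in>UNIV. \<Sum>k\<in>UNIV.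
                 H p (DV p i) (du p k) * H p (du p k) (du p j) * H p (du p i) (DW p j))
     in (\<forall>T \<in> {T1, T2, T3, T4, T5, T6}. integrable dv T) \<and>
        (\<forall>s \<in> {-\<epsilon><..<\<epsilon>}. (\<lambda>t. E s t) differentiable (at 0)) \<and>
        ((\<lambda>s. deriv (\<lambda>t. E s t) 0) has_real_derivative
           (LINT p|dv. T1 p) + (LINT p|dv. T2 p) + (LINT p|dv. T3 p) +
           (LINT p|dv. T4 p) + (LINT p|dv. T5 p) + (LINT p|dv. T6 p)) (at 0)"
proof -
  interpret riemannian_pair A g B h
    by (intro riemannian_pair.intro riemannian.intro manifold.intro riemannian_axioms.intro)
      (use assms(1,2) in \<open>simp_all add: riemannian_manifold_def\<close>)
  define I where "I = {-\<epsilon><..<\<epsilon>}"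
  define P where "P = I \<times> I"
  define U2 where "U2 = (\<lambda>r. U (fst r) (snd r))"
  have e: "orthonormal_frame (g p) (e p)" for p using assms(3) by blast
  have I: "open I" "0 \<in> I" using \<open>\<epsilon> > 0\<close> by (auto simp: I_def)
  have P: "open P" "0 \<in> P" using I by (auto simp: P_def zero_prod_def intro: open_Times)
  have var: "smooth_variation A B K u P U2"
    using assms(7) by (simp add: P_def I_def U2_def case_prod_beta')
  have U2: "smooth_family P U2" by (rule smooth_variation_family[OF var P(1)])
  have U0: "U2 0 = u" using var by (simp add: smooth_variation_def)
  have off: "U2 r p = u p" if "p \<notin> K" "r \<in> P" for r p
    using var that by (simp add: smooth_variation_def)
  have u: "smooth_map A B u" using assms(4) by (simp add: Phi3_harmonic_def)
  note K = assms(5)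
  have Veq: "V = variation_field U2 (0, 1) 0"
  proof
    fix p
    have sl: "smooth_on I (\<lambda>t. (0 :: real, t))" by (rule smooth_slice[OF I(1)])
    have into: "N.smooth_into I (\<lambda>t. U2 (0, t) p)"
      by (rule N.smooth_into_compose[OF smooth_family_parameter[OF U2] I(1) sl]) (use I(2) in \<open>auto simp: P_def\<close>)
    have "V p = N.tangent (\<lambda>t. U2 (0, t) p) 1 0"
      using N.velocity_eq_tangent[OF into I(2)] by (simp add: assms(8) U2_def)
    also have "\<dots> = N.tangent (\<lambda>r. U2 r p) (dirderiv 1 (\<lambda>t. (0, t)) 0) (0, 0)"
      by (rule N.tangent_compose[OF smooth_family_parameter[OF U2] sl I(2)]) (use I(2) in \<open>simp add: P_def\<close>)
    also have "dirderiv 1 (\<lambda>t. (0 :: real, t :: real)) 0 = (0, 1)"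
      by (rule has_derivative_imp_dirderiv) (auto intro!: derivative_eq_intros)
    finally show "V p = variation_field U2 (0, 1) 0 p" by (simp add: variation_field_def zero_prod_def)
  qed
  have Weq: "W = variation_field U2 (1, 0) 0"
  proof
    fix p
    have sl: "smooth_on I (\<lambda>s. (s, 0 :: real))"
      by (intro smooth_on_Pair smooth_on_id smooth_on_const I(1))
    have into: "N.smooth_into I (\<lambda>s. U2 (s, 0) p)"
      by (rule N.smooth_into_compose[OF smooth_family_parameter[OF U2] I(1) sl]) (use I(2) in \<open>auto simp: P_def\<close>)
    have "W p = N.tangent (\<lambda>s. U2 (s, 0) p) 1 0"
      using N.velocity_eq_tangent[OF into I(2)] by (simp add: assms(9) U2_def)
    also have "\<dots> = N.tangent (\<lambda>r. U2 r p) (dirderiv 1 (\<lambda>s. (s, 0)) 0) (0, 0)"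
      by (rule N.tangent_compose[OF smooth_family_parameter[OF U2] sl I(2)]) (use I(2) in \<open>simp add: P_def\<close>)
    also have "dirderiv 1 (\<lambda>s. (s :: real, 0 :: real)) 0 = (1, 0)"
      by (rule dirderiv_slice_left)
    finally show "W p = variation_field U2 (1, 0) 0 p" by (simp add: variation_field_def zero_prod_def)
  qed
  have secV: "smooth_section u V" and secW: "smooth_section u W"
    using smooth_section_variation[OF U2 P(2)] unfolding Veq Weq U0 by auto
  have offV: "V p = 0" if "p \<notin> K" for p
    unfolding Veq by (rule variation_field_zero[where U = U2 and p = p and q = "u p", OF P off[OF that]])

  \<comment> \<open>The section \<open>\<nabla>\<^sub>V W\<close>, the only one to which harmonicity is applied.\<close>
  define X where "X = mixed_field U2 (0, 1) (1, 0) 0"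
  have secX: "smooth_section u X"
    using smooth_section_mixed[OF U2 P(2)] unfolding X_def U0 by auto
  have offX: "X p = 0" if "p \<notin> K" for p
    unfolding X_def by (rule mixed_field_zero[where U = U2 and p = p and q = "u p", OF P off[OF that]])
  have X: "integrable vol (pairing e u X)" "(LINT p|vol. pairing e u X p) = 0"
    using harmonic_weak_equation[OF assms(4) e secX K offX] by auto
  have offX': "pairing e u X p = 0" if "p \<notin> K" for p
    by (rule pairing_zero[OF u, of "- K"]) (use that K offX in \<open>auto simp: compact_imp_closed open_Compl\<close>)

  define F where "F r p = d3_norm_sq A B h (e p) (U2 r) p / 6" for r p
  have F: "smooth_fun P F"
    unfolding F_def[abs_def] by (rule smooth_fun_energy_density[OF U2 e])
  define G where "G r p = dirderiv (0, 1) (\<lambda>r. F r p) r" for r p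
  have G: "smooth_fun P G"
    unfolding G_def[abs_def] by (rule smooth_fun_dirderiv[OF F])
  define D where "D p = dirderiv (1, 0) (\<lambda>r. G r p) 0" for p
  let ?E = "\<lambda>s t. Phi3_energy A g B h K (U s t)"
  have E: "?E s t = (LINT p:K|vol. F (s, t) p)" if "s \<in> I" "t \<in> I" for s t
    using Phi3_energy_frame[OF U2 _ e, of "(s, t)" K] that by (simp add: U2_def F_def P_def)
  have dE: "((\<lambda>t. ?E s t) has_real_derivative (LINT p:K|vol. G (s, 0) p)) (at 0)" if s: "s \<in> I" for s
    unfolding G_def
    by (rule line_derivative_of_energy[OF F _ K I]) (use s I(2) E in \<open>auto simp: P_def\<close>)
  have ddE: "((\<lambda>s. deriv (\<lambda>t. ?E s t) 0) has_real_derivative (LINT p:K|vol. D p)) (at 0)"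
    unfolding D_def
    by (rule line_derivative_of_energy[OF G P(2) K I]) (use DERIV_imp_deriv[OF dE] in \<open>simp add: zero_prod_def\<close>)

  let ?L = "\<lambda>W (_ :: real) p v. induced_nabla A B h u p v W"
  let ?d = "\<lambda>(_ :: real). differential A B u"
  let ?T = "\<lambda>L2 L3 L4 L5 L6. frame_sum e (\<lambda>_ :: real. u) (?L V) L2 L3 L4 L5 L6 0"
  have hom: "smooth_hom UNIV (\<lambda>_ :: real. u) (?L W)" "smooth_hom UNIV (\<lambda>_ :: real. u) ?d"
    using smooth_hom_nabla[OF u secW open_UNIV] smooth_hom_differential[OF smooth_family_const[OF u open_UNIV]] by auto
  note int = integrable_supported_frame_sum(1)[OF u e secV K offV]
  note zero = integrable_supported_frame_sum(2)[OF u e secV K offV]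
  let ?T1 = "\<lambda>p. \<Sum>i\<in>UNIV. h (u p) (curvature B h (u p) (V p) (differential A B u p (e p i)) (W p)) (d3 A B h (e p) u p (e p i))"
  let ?T2 = "?T (?L W) ?d ?d ?d ?d" and ?T3 = "?T ?d (?L W) ?d ?d ?d" and ?T4 = "?T ?d ?d (?L W) ?d ?d"
    and ?T5 = "?T ?d ?d ?d (?L W) ?d" and ?T6 = "?T ?d ?d ?d ?d (?L W)"
  have D: "D p = ?T1 p + pairing e u X p + ?T2 p + ?T3 p + ?T4 p + ?T5 p + ?T6 p" for p
  proof -
    \<comment> \<open>In the order \<open>\<partial>\<^sub>t \<partial>\<^sub>s\<close> the curvature term is \<open>R(V, du) W\<close> rather than \<open>R(W, du) V\<close>.\<close>
    have "D p = dirderiv (0, 1) (dirderiv (1, 0) (\<lambda>r. F r p)) 0"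
      unfolding D_def G_def by (rule dirderiv_commute_real[OF P(1) smooth_fun_parameter[OF F] P(2)])
    then show ?thesis
      unfolding F_def second_variation_pointwise[OF U2 P(2)] frame_sum_def Veq Weq X_def U0 by simp
  qed
  have int2: "integrable vol ?T2" by (rule int[OF _ hom(1) hom(2) hom(2) hom(2) hom(2)])
  have int3: "integrable vol ?T3" by (rule int[OF _ hom(2) hom(1) hom(2) hom(2) hom(2)])
  have int4: "integrable vol ?T4" by (rule int[OF _ hom(2) hom(2) hom(1) hom(2) hom(2)])
  have int5: "integrable vol ?T5" by (rule int[OF _ hom(2) hom(2) hom(2) hom(1) hom(2)])
  have int6: "integrable vol ?T6" by (rule int[OF _ hom(2) hom(2) hom(2) hom(2) hom(1)])
  have offT2: "?T2 p = 0" if "p \<notin> K" for p by (rule zero[OF _ hom(1) hom(2) hom(2) hom(2) hom(2) that])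
  have offT3: "?T3 p = 0" if "p \<notin> K" for p by (rule zero[OF _ hom(2) hom(1) hom(2) hom(2) hom(2) that])
  have offT4: "?T4 p = 0" if "p \<notin> K" for p by (rule zero[OF _ hom(2) hom(2) hom(1) hom(2) hom(2) that])
  have offT5: "?T5 p = 0" if "p \<notin> K" for p by (rule zero[OF _ hom(2) hom(2) hom(2) hom(1) hom(2) that])
  have offT6: "?T6 p = 0" if "p \<notin> K" for p by (rule zero[OF _ hom(2) hom(2) hom(2) hom(2) hom(1) that])
  have offD: "D p = 0" if "p \<notin> K" for p
    unfolding D using offT2[OF that] offT3[OF that] offT4[OF that] offT5[OF that] offT6[OF that] offX'[OF that] offV[OF that]
    by (simp add: curvature_zero bilinear_lzero[OF N.metric_point(1)])
  have contD: "continuous_on UNIV D"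
    unfolding D_def[abs_def] by (rule smooth_fun_continuous_at[OF smooth_fun_dirderiv[OF G] P(2)])
  \<comment> \<open>The curvature term is integrable because all other terms of the identity for \<open>D\<close> are.\<close>
  have intD: "integrable vol D"
    by (rule integral_of_supported(1)[OF offD, THEN iffD1, OF _ set_integrable_continuous[OF contD K]])
  let ?S = "\<lambda>p. pairing e u X p + ?T2 p + ?T3 p + ?T4 p + ?T5 p + ?T6 p"
  have intS: "integrable vol ?S"
    by (intro Bochner_Integration.integrable_add X(1) int2 int3 int4 int5 int6)
  have "?T1 = (\<lambda>p. D p - ?S p)" using D by (simp add: fun_eq_iff)
  then have int1: "integrable vol ?T1" using Bochner_Integration.integrable_diff[OF intD intS] by simp
  have "(LINT p:K|vol. D p) = (LINT p|vol. D p)" by (rule integral_of_supported(2)[OF offD])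
  also have "\<dots> = (LINT p|vol. ?T1 p + pairing e u X p + ?T2 p + ?T3 p + ?T4 p + ?T5 p + ?T6 p)"
    by (simp only: D)
  also have "\<dots> = (LINT p|vol. ?T1 p) + (LINT p|vol. ?T2 p) + (LINT p|vol. ?T3 p) + (LINT p|vol. ?T4 p)
      + (LINT p|vol. ?T5 p) + (LINT p|vol. ?T6 p)"
    using X(1) int1 int2 int3 int4 int5 int6
    by (simp only: Bochner_Integration.integral_add Bochner_Integration.integrable_add X(2) add_0_right)
  finally have total: "(LINT p:K|vol. D p) = (LINT p|vol. ?T1 p) + (LINT p|vol. ?T2 p) + (LINT p|vol. ?T3 p)
      + (LINT p|vol. ?T4 p) + (LINT p|vol. ?T5 p) + (LINT p|vol. ?T6 p)" .
  have "(\<lambda>t. ?E s t) differentiable (at 0)" if "s \<in> {-\<epsilon><..<\<epsilon>}" for s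
    using dE[of s] that unfolding I_def real_differentiable_def by blast
  then have diff: "\<forall>s \<in> {-\<epsilon><..<\<epsilon>}. (\<lambda>t. ?E s t) differentiable (at 0)" by (rule ballI)
  have "\<forall>T \<in> {?T1, ?T2, ?T3, ?T4, ?T5, ?T6}. integrable vol T"
    by (intro ballI, elim insertE emptyE) (simp_all only: int1 int2 int3 int4 int5 int6)
  from conjI[OF this conjI[OF diff ddE[unfolded total]]] show ?thesis
    unfolding Let_def frame_sum_def[abs_def] .
qed

end
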